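(* Let $k$ and $m$ be positive integers and let $G$ be a finite simple graph with $c_k(G)=m$. Then $$c_{k+1}(G)\le \max\{\mathrm{LG}_k(m),\ \mathrm{SM}_k(m)\},$$ where, if $\mathrm{SM}_k(m)$ is undefined (i.e. $n_k=k$ in the canonical representation of $m$), the maximum is understood to be $\mathrm{LG}_k(m)$.
   Context: For a graph $G$, $c_i(G)$ is the number of cliques (complete subgraphs) on exactly $i$ vertices. Binomial coefficients are $\binom{n}{j}=0$ when $j>n$ or $j<0$. For integers, write $r_k(n_k,n_{k-1},\dots,n_{k-s})=\binom{n_k}{k}+\binom{n_{k-1}}{k-1}+\dots+\binom{n_{k-s}}{k-s}$. Canonical representation: every positive integer $m$ can be written uniquely as $m=r_k(n_k,\dots,n_{k-s})$ with $s\ge0$ and $n_k>n_{k-1}>\dots>n_{k-s}\ge k-s>0$. Second representation: $m$ can be written uniquely as $m=\binom{n_k}{k}+\binom{n_{k-1}}{k-1}+\sum_{i=1}^{s}\binom{a_{k-i}}{k-i}$ with $s\ge0$, $n_k>n_{k-1}\ge k-2$, $a_{k-1}>\dots>a_{k-s}\ge k-s>0$, and $\binom{n_{k-1}}{k-2}>\sum_{i=1}^s\binom{a_{k-i}}{k-i}$ (here $s=0$ means no $a$-terms, and $n_{k-1}=k-2$ corresponds to $m=\binom{n_k}{k}$). Define $\mathrm{LG}_k(m)=\binom{n_k}{k+1}+\binom{n_{k-1}}{k}+\sum_{i=1}^s\binom{a_{k-i}}{k-i+1}$. Turán numbers: $T_{n,r}$ is the graph on $n$ vertices partitioned into $r$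 parts as evenly as possible, two vertices adjacent iff in different parts; $\binom{n}{k}_r:=c_k(T_{n,r})$. For $r\ge k$, every positive integer $m$ has a unique representation $m=\sum_{i=0}^{s}\binom{b_{k-i}}{k-i}_{r-i}$ with $b_{k-i}-\lfloor b_{k-i}/(r-i)\rfloor>b_{k-i-1}$ for $0\le i<s$ and $b_{k-s}\ge k-s>0$. $\mathrm{SM}_k(m)$: let $n_k$ be the leading term of the canonical representation of $m$. If $n_k>k$, write $m=\sum_{i=0}^s\binom{b_{k-i}}{k-i}_{n_k-1-i}$ (the Turán representation with $r=n_k-1$) and set $\mathrm{SM}_k(m)=\sum_{i=0}^s\binom{b_{k-i}}{k-i+1}_{n_k-1-i}$. If $n_k=k$, $\mathrm{SM}_k(m)$ is undefined. *)

theory Defs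
  imports "HOL-Library.Ramsey"
begin

definition simple_graph :: "'a set \<Rightarrow> 'a set set \<Rightarrow> bool" where
  "simple_graph V E \<longleftrightarrow> E \<subseteq> [V]\<^bsup>2\<^esup>"

definition num_cliques :: "'a set \<Rightarrow> 'a set set \<Rightarrow> nat \<Rightarrow> nat" where
  "num_cliques V E i = card {K \<in> [V]\<^bsup>i\<^esup>. clique K E}"

(* Binomial coefficients at integer arguments, equal to 0 if j > n or j < 0.  Integers are
   needed only for k = 1 in LG_rep, where the lower indices -1 and the upper entry -1 occur. *)
definition ibinom :: "int \<Rightarrow> int \<Rightarrow> nat" where
  "ibinom n j = (if j > n \<or> j < 0 then 0 else nat n choose nat j)"

(* In all representations below, a sequence x_k, x_{k-1}, ..., x_{k-s} is a function x on nat,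
   applied to its subscripts; only the values at the relevant subscripts matter.  The
   condition k - s > 0 reads s < k, so the subtractions k - i do not truncate. *)

definition canonical_rep :: "nat \<Rightarrow> nat \<Rightarrow> nat \<Rightarrow> (nat \<Rightarrow> nat) \<Rightarrow> bool" where
  "canonical_rep k m s n \<longleftrightarrow>
     s < k \<and>
     (\<forall>i<s. n (k - i) > n (k - i - 1)) \<and>
     n (k - s) \<ge> k - s \<and>
     m = (\<Sum>i=0..s. n (k - i) choose (k - i))"

definition canonical_lead :: "nat \<Rightarrow> nat \<Rightarrow> nat" where
  "canonical_lead k m = (THE x. \<exists>s n. canonical_rep k m s n \<and> x = n k)"

(* p and q are n_k and n_{k-1}.  The alternative "q = k - 2 and s = 0" is the degenerate case
   m = binom(n_k, k).  For k > 1 it is subsumed by the strict inequality, whose left-hand side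
   is then 1; for k = 1 that side is binom(-1, -1) = 0 and the case has to be admitted
   explicitly. *)
definition LG_rep :: "nat \<Rightarrow> nat \<Rightarrow> nat \<Rightarrow> int \<Rightarrow> int \<Rightarrow> (nat \<Rightarrow> nat) \<Rightarrow> bool" where
  "LG_rep k m s p q a \<longleftrightarrow>
     p > q \<and> q \<ge> int k - 2 \<and>
     s < k \<and>
     (\<forall>i. 1 \<le> i \<and> i < s \<longrightarrow> a (k - i) > a (k - i - 1)) \<and>
     (s \<ge> 1 \<longrightarrow> a (k - s) \<ge> k - s) \<and>
     (ibinom q (int k - 2) > (\<Sum>i=1..s. a (k - i) choose (k - i)) \<or>
      q = int k - 2 \<and> s = 0) \<and>
     m = ibinom p (int k) + ibinom q (int k - 1) + (\<Sum>i=1..s. a (k - i) choose (k - i))"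

definition LG :: "nat \<Rightarrow> nat \<Rightarrow> nat" where
  "LG k m = (THE v. \<exists>s p q a. LG_rep k m s p q a \<and>
     v = ibinom p (int k + 1) + ibinom q (int k) + (\<Sum>i=1..s. a (k - i) choose (k - i + 1)))"

(* The vertices 0, ..., n - 1 are distributed over r > 0 parts by their residue modulo r; the
   part sizes then differ by at most 1. *)
definition turan_edges :: "nat \<Rightarrow> nat \<Rightarrow> nat set set" where
  "turan_edges n r = {{u, v} | u v. u < n \<and> v < n \<and> u mod r \<noteq> v mod r}"

definition turan_binom :: "nat \<Rightarrow> nat \<Rightarrow> nat \<Rightarrow> nat" where
  "turan_binom r n k = num_cliques {..<n} (turan_edges n r) k"

definition turan_rep :: "nat \<Rightarrow> nat \<Rightarrow> nat \<Rightarrow> nat \<Rightarrow> (nat \<Rightarrow> nat) \<Rightarrow> bool" where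
  "turan_rep r k m s b \<longleftrightarrow>
     s < k \<and>
     (\<forall>i<s. b (k - i) - b (k - i) div (r - i) > b (k - i - 1)) \<and>
     b (k - s) \<ge> k - s \<and>
     m = (\<Sum>i=0..s. turan_binom (r - i) (b (k - i)) (k - i))"

definition SM :: "nat \<Rightarrow> nat \<Rightarrow> nat option" where
  "SM k m =
     (let r = canonical_lead k m - 1 in
      if canonical_lead k m > k
      then Some (THE v. \<exists>s b. turan_rep r k m s b \<and>
             v = (\<Sum>i=0..s. turan_binom (r - i) (b (k - i)) (k - i + 1)))
      else None)"

end

theory Submission
  imports Defs "HOL-Library.Nat_Bijection"
begin

text \<open>
  Let n be the leading term of the canonical representation of m, so that m is at least n choose k
  and less than n + 1 choose k.

  Suppose first that every clique of G has at most r = n - 1 vertices. Colour the natural numbers by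
  their residues modulo r and call a set rainbow if its elements have distinct colours. Among families
  of m rainbow k-sets, the initial segments of the colexicographic order have the largest number of
  rainbow (k + 1)-sets all of whose k-subsets belong to the family (Frankl, Fueredi and Kalai); for an
  initial segment this number is the one read off the Turan representation. This is proved by
  compression: the sets avoiding a colour class, and the links of the vertices in the class, are
  replaced by initial segments, which is possible by induction on the number of colours. The graph
  enters through an idea of Frohmader: if v lies in the largest number of (k + 1)-cliques, then the
  vertices outside the neighbourhood of v, removed one at a time, can be placed into one new colour
  class over a family realising the clique numbers of the neighbourhood of v, which uses one colour less.

  Otherwise G contains an n-clique. The remaining vertices are removed one at a time, each removal
  being controlled by the Kruskal-Katona bound for its link, which is the coloured bound with many
  colours. If no remaining vertex lies in too many k-cliques, these bounds are added up by moving the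
  sizes of two families apart; otherwise one vertex already accounts for the term of LG with
  upper entry q and the bound for a cone over a family finishes the proof.
\<close>

section \<open>The colexicographic order\<close>

text \<open>The case distinction comes from counting: \<open>m\<close> is less than
  \<open>n + 1 choose k\<close>, so an n-clique uses up \<open>n choose k\<close> of the k-cliques
  and leaves fewer than \<open>n choose (k - 1)\<close> for the remaining vertices; without an
  n-clique, \<open>n - 1\<close> colours suffice. The obstacle in the coloured bound is that
  compression alone does not produce initial segments. A compressed family can still omit a
  predecessor x of a member y, but only if x and y are disjoint and jointly use all colours; for
  such pairs the numbers of (k + 1)-sets charged to x and y are compared. Compression is not
  iterated: a family with the least sum of binary codes among those at least as good is chosen. The
  modulus \<open>r\<close> stays fixed while the set \<open>C\<close> of admissible colours shrinks,
  because a link loses one colour; renumbering the vertices coloured in \<open>C\<close> gives back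
  a Turan graph with \<open>card C\<close> parts. The ground set is infinite, so every colour class
  has room for as many apices as needed. On sets below the modulus the rainbow condition is void,
  and the same bound becomes the Kruskal-Katona theorem.\<close>

text \<open>On finite sets of natural numbers, comparing binary encodings is comparing colexicographically.\<close>

lemma set_encode_less_power:
  assumes "\<And>a. a \<in> A \<Longrightarrow> a < d"
  shows "set_encode A < 2 ^ d"
proof -
  have "set_encode A \<le> (\<Sum>i\<in>{0..<d}. 2 ^ i)"
    unfolding set_encode_def by (rule sum_mono2) (use assms in auto)
  also have "\<dots> = 2 ^ d - 1"
    by (rule sum_power2)
  also have "\<dots> < 2 ^ d"
    by simp
  finally show ?thesis .
qed

text \<open>The bit of \<open>d\<close> outweighs all lower bits together. Above \<open>d\<close>
  inclusion suffices, since further elements of \<open>B\<close> only enlarge its code.\<close>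

lemma set_encode_lessI:
  assumes "finite A" "finite B" "d \<in> B" "d \<notin> A" "\<And>e. e > d \<Longrightarrow> e \<in> A \<Longrightarrow> e \<in> B"
  shows "set_encode A < set_encode B"
proof -
  have *: "set_encode A = set_encode {e\<in>A. e < d} + set_encode {e\<in>A. e > d}"
    unfolding set_encode_def using assms
    by (subst sum.union_disjoint[symmetric]) (auto intro!: sum.cong simp: not_less nat_less_le)
  have "set_encode {e\<in>A. e > d} \<le> set_encode {e\<in>B. e > d}"
    unfolding set_encode_def by (rule sum_mono2) (use assms in auto)
  moreover have "set_encode {e\<in>A. e < d} < 2 ^ d"
    by (rule set_encode_less_power) auto
  moreover have "2 ^ d + set_encode {e\<in>B. e > d} = set_encode (insert d {e\<in>B. e > d})"
    using assms by (simp add: set_encode_insert)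
  moreover have "\<dots> \<le> set_encode B"
    unfolding set_encode_def by (rule sum_mono2) (use assms in auto)
  ultimately show ?thesis using * by linarith
qed

lemma set_encode_lessE:
  assumes "finite A" "finite B" "set_encode A < set_encode B"
  obtains d where "d \<in> B" "d \<notin> A" "\<And>e. e > d \<Longrightarrow> e \<in> A \<longleftrightarrow> e \<in> B"
proof -
  define S where "S = (A - B) \<union> (B - A)"
  have fS: "finite S" using assms by (simp add: S_def)
  have "S \<noteq> {}" using assms(3) by (auto simp: S_def)
  define d where "d = Max S"
  have dS: "d \<in> S" using fS \<open>S \<noteq> {}\<close> by (simp add: d_def)
  have up: "e \<in> A \<longleftrightarrow> e \<in> B" if "e > d" for e
  proof -
    have "e \<notin> S" using that fS unfolding d_def by (meson Max_ge leD)
    then show ?thesis by (auto simp: S_def)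
  qed
  have "\<not> (d \<in> A \<and> d \<notin> B)"
    using set_encode_lessI[of B A d] assms up by fastforce
  then have "d \<in> B" "d \<notin> A" using dS by (auto simp: S_def)
  then show ?thesis using that up by blast
qed

lemma set_encode_less_of_max_less:
  assumes "finite A" "finite B" "d \<in> B" "\<And>a. a \<in> A \<Longrightarrow> a < d"
  shows "set_encode A < set_encode B"
  by (rule set_encode_lessI[of A B d]) (use assms in force)+

lemma set_encode_swap_less:
  assumes "finite A" "u \<in> A" "a < u" "a \<notin> A"
  shows "set_encode (insert a (A - {u})) < set_encode A"
  by (rule set_encode_lessI[of _ _ u]) (use assms in auto)

lemma set_encode_insert_le_iff:
  assumes "finite A" "finite B" "v \<notin> A" "v \<notin> B"
  shows "set_encode (insert v A) \<le> set_encode (insert v B) \<longleftrightarrow> set_encode A \<le> set_encode B"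
  using assms by (simp add: set_encode_insert)

text \<open>The top difference \<open>d\<close> of the reduced sets is also the top difference of
  the full sets once both minima lie below \<open>d\<close>. For \<open>p\<close> this follows from
  the equal sizes: otherwise all of \<open>p - {Min p}\<close> would lie above \<open>d\<close>,
  hence inside \<open>p' - {Min p'}\<close> without \<open>d\<close>, which is too small.\<close>

lemma set_encode_remove_Min_mono:
  assumes "finite p" "finite p'" "p' \<noteq> {}" "card p = card p'"
    and "set_encode p' \<le> set_encode p"
  shows "set_encode (p' - {Min p'}) \<le> set_encode (p - {Min p})"
proof (rule ccontr)
  assume "\<not> ?thesis"
  then have less: "set_encode (p - {Min p}) < set_encode (p' - {Min p'})" by simp
  have ne: "p \<noteq> {}" using assms by auto
  obtain d where d: "d \<in> p' - {Min p'}" "d \<notin> p - {Min p}"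
      "\<And>e. e > d \<Longrightarrow> e \<in> p - {Min p} \<longleftrightarrow> e \<in> p' - {Min p'}"
    using set_encode_lessE[OF _ _ less] assms by auto
  have min': "Min p' < d" using d(1) assms(2)
    by (metis DiffE Min_le insertCI le_neq_implies_less)
  have "Min p < d"
  proof (rule ccontr)
    assume n: "\<not> Min p < d"
    have "p - {Min p} \<subseteq> p' - {Min p'} - {d}"
    proof
      fix e assume e: "e \<in> p - {Min p}"
      then have "Min p < e" using assms(1) by (metis DiffE Min_le insertCI le_neq_implies_less)
      then have "e > d" using n by simp
      then show "e \<in> p' - {Min p'} - {d}" using e d(3) by simp
    qed
    then have "card (p - {Min p}) \<le> card (p' - {Min p'} - {d})"
      using assms by (intro card_mono) auto
    also have "\<dots> < card (p' - {Min p'})"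
      using assms d(1) by (intro psubset_card_mono) auto
    also have "\<dots> = card (p - {Min p})" using assms ne by (simp add: card_Diff_singleton)
    finally show False by simp
  qed
  have "set_encode p < set_encode p'"
  proof (rule set_encode_lessI)
    show "d \<in> p'" using d by simp
    show "d \<notin> p" using d \<open>Min p < d\<close> by auto
    show "e \<in> p'" if "e > d" "e \<in> p" for e
      using that \<open>Min p < d\<close> min' d(3)[of e] by auto
  qed (use assms in auto)
  then show False using assms by simp
qed

text \<open>Since the comparison holds across all pairs, an arbitrary bijection between
  \<open>A - B\<close> and \<open>B - A\<close> does. The strict form makes initial segments
  minimise the sum of codes; the weak form below compares total weights.\<close>

lemma sum_less_of_swap:
  fixes f :: "'b \<Rightarrow> nat"
  assumes "finite A" "finite B" "card A = card B" "A \<noteq> B"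
    and "\<And>x y. x \<in> A - B \<Longrightarrow> y \<in> B - A \<Longrightarrow> f x < f y"
  shows "sum f A < sum f B"
proof -
  have c: "card (A - B) = card (B - A)"
    using assms by (simp add: card_Diff_subset_Int Int_commute)
  have ne: "A - B \<noteq> {}" using assms by (metis Diff_eq_empty_iff card_subset_eq)
  obtain g where g: "bij_betw g (A - B) (B - A)"
    using finite_same_card_bij[OF _ _ c] assms by auto
  have "sum f (A - B) < sum (\<lambda>x. f (g x)) (A - B)"
    by (rule sum_strict_mono) (use assms ne g in \<open>auto dest: bij_betwE\<close>)
  also have "\<dots> = sum f (B - A)" using g by (rule sum.reindex_bij_betw)
  finally have "sum f (A - B) < sum f (B - A)" .
  moreover have "sum f A = sum f (A - B) + sum f (A \<inter> B)"
    using assms by (metis add.commute sum.Int_Diff)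
  moreover have "sum f B = sum f (B - A) + sum f (A \<inter> B)"
    using assms by (metis Int_commute add.commute sum.Int_Diff)
  ultimately show ?thesis by simp
qed

lemma sum_le_of_swap:
  fixes f :: "'b \<Rightarrow> nat"
  assumes "finite A" "finite B" "card A = card B"
    and "\<And>x y. x \<in> A - B \<Longrightarrow> y \<in> B - A \<Longrightarrow> f x \<le> f y"
  shows "sum f A \<le> sum f B"
proof -
  have c: "card (A - B) = card (B - A)"
    using assms by (simp add: card_Diff_subset_Int Int_commute)
  obtain g where g: "bij_betw g (A - B) (B - A)"
    using finite_same_card_bij[OF _ _ c] assms by auto
  have "sum f (A - B) \<le> sum (\<lambda>x. f (g x)) (A - B)"
    by (rule sum_mono) (use assms g in \<open>auto dest: bij_betwE\<close>)
  also have "\<dots> = sum f (B - A)" using g by (rule sum.reindex_bij_betw)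
  finally have "sum f (A - B) \<le> sum f (B - A)" .
  moreover have "sum f A = sum f (A - B) + sum f (A \<inter> B)"
    using assms by (metis add.commute sum.Int_Diff)
  moreover have "sum f B = sum f (B - A) + sum f (A \<inter> B)"
    using assms by (metis Int_commute add.commute sum.Int_Diff)
  ultimately show ?thesis by simp
qed

section \<open>Rainbow sets\<close>

context
  fixes r :: nat
begin

abbreviation colours :: "nat set \<Rightarrow> nat set" where
  "colours z \<equiv> (\<lambda>v. v mod r) ` z"

definition rainbow :: "nat set \<Rightarrow> nat \<Rightarrow> nat set set" where
  "rainbow C k = {z. finite z \<and> card z = k \<and> colours z \<subseteq> C \<and> inj_on (\<lambda>v. v mod r) z}"

definition colex_initial :: "nat set \<Rightarrow> nat \<Rightarrow> nat set set \<Rightarrow> bool" where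
  "colex_initial C k A \<longleftrightarrow> A \<subseteq> rainbow C k \<and> finite A \<and>
     (\<forall>x\<in>rainbow C k. \<forall>y\<in>A. set_encode x \<le> set_encode y \<longrightarrow> x \<in> A)"

text \<open>The largest family of rainbow (k + 1)-sets whose shadow lies in \<open>A\<close>.
  Kruskal-Katona type bounds are often stated as minimising the shadow; maximising
  \<open>upper\<close> is the dual form, which applies directly to the (k + 1)-cliques over given
  k-cliques.\<close>

definition upper :: "nat set \<Rightarrow> nat \<Rightarrow> nat set set \<Rightarrow> nat set set" where
  "upper C k A = {p \<in> rainbow C (Suc k). \<forall>v\<in>p. p - {v} \<in> A}"

text \<open>If there are fewer than \<open>m\<close> rainbow k-sets, \<open>SOME\<close> returns an
  unspecified family; \<open>segment_initial\<close> gives the guarantee from any finite family with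
  at least \<open>m\<close> members.\<close>

definition segment :: "nat set \<Rightarrow> nat \<Rightarrow> nat \<Rightarrow> nat set set" where
  "segment C k m = (SOME A. colex_initial C k A \<and> card A = m)"

definition colex_bound :: "nat set \<Rightarrow> nat \<Rightarrow> nat \<Rightarrow> nat" where
  "colex_bound C k m = card (upper C k (segment C k m))"

lemma rainbow_finite: "z \<in> rainbow C k \<Longrightarrow> finite z"
  and rainbow_card: "z \<in> rainbow C k \<Longrightarrow> card z = k"
  by (auto simp: rainbow_def)

lemma rainbow_0: "rainbow C 0 = {{}}"
  by (auto simp: rainbow_def)

lemma rainbow_mono: "C \<subseteq> D \<Longrightarrow> rainbow C k \<subseteq> rainbow D k"
  by (auto simp: rainbow_def)

lemma rainbow_empty: "k > 0 \<Longrightarrow> rainbow {} k = {}"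
  by (auto simp: rainbow_def)

lemma rainbow_inj: "z \<in> rainbow C k \<Longrightarrow> u \<in> z \<Longrightarrow> v \<in> z \<Longrightarrow> u mod r = v mod r \<Longrightarrow> u = v"
  unfolding rainbow_def inj_on_def by blast

lemma rainbow_colour: "z \<in> rainbow C k \<Longrightarrow> u \<in> z \<Longrightarrow> u mod r \<in> C"
  unfolding rainbow_def by blast

lemma rainbow_card_colours: "z \<in> rainbow C k \<Longrightarrow> card (colours z) = k"
  by (simp add: rainbow_def card_image)

lemma rainbow_Diff_colour:
  assumes "z \<in> rainbow C (Suc k)" "v \<in> z"
  shows "z - {v} \<in> rainbow (C - {v mod r}) k"
proof -
  have "colours (z - {v}) \<subseteq> C - {v mod r}"
    using rainbow_colour[OF assms(1)] rainbow_inj[OF assms(1) _ assms(2)] by fast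
  then show ?thesis
    using assms inj_on_subset[of "\<lambda>v. v mod r" z "z - {v}"] by (simp add: rainbow_def)
qed

lemma rainbow_Diff: "z \<in> rainbow C (Suc k) \<Longrightarrow> v \<in> z \<Longrightarrow> z - {v} \<in> rainbow C k"
  using rainbow_Diff_colour rainbow_mono[of "C - {v mod r}" C k] by blast

lemma rainbow_insert:
  assumes "z \<in> rainbow C k" "v mod r \<in> C" "v mod r \<notin> colours z"
  shows "insert v z \<in> rainbow C (Suc k)"
proof -
  have "v \<notin> z" using assms(3) by blast
  then show ?thesis using assms by (simp add: rainbow_def inj_on_insert)
qed

lemma rainbow_insert_colour:
  assumes "z \<in> rainbow (C - {v mod r}) k" "v mod r \<in> C"
  shows "insert v z \<in> rainbow C (Suc k)" "v \<notin> z"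
proof -
  have "z \<in> rainbow C k" using assms(1) rainbow_mono[of "C - {v mod r}" C k] by blast
  moreover have "v mod r \<notin> colours z" using rainbow_colour[OF assms(1)] by force
  ultimately show "insert v z \<in> rainbow C (Suc k)" "v \<notin> z"
    using rainbow_insert assms(2) by auto
qed

lemma rainbow_swap:
  assumes "z \<in> rainbow C k" "u \<in> z" "a mod r \<in> C" "a mod r \<notin> colours (z - {u})"
  shows "insert a (z - {u}) \<in> rainbow C k"
proof -
  obtain j where "k = Suc j"
    using assms(1,2) by (cases k) (auto simp: rainbow_def)
  then show ?thesis
    using rainbow_insert[of "z - {u}" C j a] rainbow_Diff[of z C j u] assms by auto
qed

section \<open>Initial segments of the colexicographic order\<close>

lemma colex_initialD:
  assumes "colex_initial C k A"
  shows "A \<subseteq> rainbow C k" "finite A"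
    and "\<And>x y. x \<in> rainbow C k \<Longrightarrow> y \<in> A \<Longrightarrow> set_encode x \<le> set_encode y \<Longrightarrow> x \<in> A"
  using assms by (auto simp: colex_initial_def)

lemma colex_initial_nested:
  assumes "colex_initial C k A" "colex_initial C k B"
  shows "A \<subseteq> B \<or> B \<subseteq> A"
proof (rule ccontr)
  assume "\<not> ?thesis"
  then obtain a b where ab: "a \<in> A" "a \<notin> B" "b \<in> B" "b \<notin> A" by blast
  then have "a \<in> rainbow C k" "b \<in> rainbow C k" using assms colex_initialD(1) by blast+
  then show False
    using ab colex_initialD(3)[OF assms(1), of b a] colex_initialD(3)[OF assms(2), of a b] by linarith
qed

lemma colex_initial_subset_of_card:
  assumes "colex_initial C k A" "colex_initial C k B" "card A \<le> card B"
  shows "A \<subseteq> B"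
  using colex_initial_nested[OF assms(1,2)] card_seteq[OF colex_initialD(2)[OF assms(1)]] assms(3)
  by blast

lemma colex_initial_unique:
  assumes "colex_initial C k A" "colex_initial C k B" "card A = card B"
  shows "A = B"
  using colex_initial_subset_of_card[OF assms(1,2)] colex_initial_subset_of_card[OF assms(2,1)] assms(3)
  by simp

lemma colex_initial_Int:
  assumes "colex_initial C k A" "colex_initial C k B"
  shows "card (A \<inter> B) = min (card A) (card B)"
proof (cases "card A \<le> card B")
  case True
  then have "A \<inter> B = A" using colex_initial_subset_of_card[OF assms] by blast
  then show ?thesis using True by simp
next
  case False
  then have "A \<inter> B = B" using colex_initial_subset_of_card[OF assms(2,1)] by auto
  then show ?thesis using False by simp
qed

text \<open>\<open>B\<close> only witnesses that there are enough rainbow sets. The segment grows by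
  the set of least code outside it.\<close>

lemma ex_colex_initial:
  assumes "B \<subseteq> rainbow C k" "finite B"
  shows "\<exists>A. colex_initial C k A \<and> card A = card B"
  using assms(2,1)
proof (induction B rule: finite_induct)
  case empty
  show ?case by (rule exI[of _ "{}"]) (auto simp: colex_initial_def)
next
  case (insert b B)
  then obtain A where A: "colex_initial C k A" "card A = card B" by auto
  have fin: "finite A" using A by (simp add: colex_initial_def)
  have "\<not> insert b B \<subseteq> A"
    using card_mono[OF fin, of "insert b B"] A insert by auto
  then have ne: "\<exists>z. z \<in> rainbow C k - A" using insert by auto
  then obtain z where z: "z \<in> rainbow C k - A"
      "\<And>y. y \<in> rainbow C k - A \<Longrightarrow> set_encode z \<le> set_encode y"
    using ex_has_least_nat[of "\<lambda>z. z \<in> rainbow C k - A" _ set_encode] by metis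
  have "colex_initial C k (insert z A)"
    unfolding colex_initial_def
  proof (intro conjI ballI impI)
    show "insert z A \<subseteq> rainbow C k" using z A by (auto simp: colex_initial_def)
    show "finite (insert z A)" using fin by simp
    fix x y assume xy: "x \<in> rainbow C k" "y \<in> insert z A" "set_encode x \<le> set_encode y"
    show "x \<in> insert z A"
    proof (cases "y = z")
      case True
      show ?thesis
      proof (rule ccontr)
        assume "x \<notin> insert z A"
        then have "set_encode x = set_encode z" "x \<noteq> z" using z(2)[of x] xy True by auto
        then show False using set_encode_eq[of x z] xy(1) z(1) rainbow_finite by blast
      qed
    next
      case False
      then show ?thesis using xy A by (auto simp: colex_initial_def)
    qed
  qed
  moreover have "card (insert z A) = card (insert b B)"
    using z fin insert A by simp
  ultimately show ?case by blast
qed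

lemma segment_eqI: "colex_initial C k A \<Longrightarrow> segment C k (card A) = A"
  unfolding segment_def
  by (rule some_equality) (auto dest: colex_initial_unique)

lemma colex_bound_eq: "colex_initial C k A \<Longrightarrow> colex_bound C k (card A) = card (upper C k A)"
  by (simp add: colex_bound_def segment_eqI)

lemma segment_initial:
  assumes "B \<subseteq> rainbow C k" "finite B" "m \<le> card B"
  shows "colex_initial C k (segment C k m)" "card (segment C k m) = m"
proof -
  obtain B' where "B' \<subseteq> B" "card B' = m"
    using assms by (meson obtain_subset_with_card_n)
  then obtain A where "colex_initial C k A" "card A = m"
    using ex_colex_initial[of B' C k] assms by (metis finite_subset subset_trans)
  then show "colex_initial C k (segment C k m)" "card (segment C k m) = m"
    using segment_eqI by auto
qed

text \<open>Makes the sum of codes a potential for compression: replacing a family by the initial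
  segment of the same size lowers it, unless the family is that segment.\<close>

lemma colex_initial_sum_less:
  assumes "colex_initial C k A" "B \<subseteq> rainbow C k" "finite B" "card B = card A" "B \<noteq> A"
  shows "sum set_encode A < sum set_encode B"
proof (rule sum_less_of_swap)
  fix x y assume xy: "x \<in> A - B" "y \<in> B - A"
  then show "set_encode x < set_encode y"
    using colex_initialD(3)[OF assms(1), of y x] assms(2) by (auto simp: not_less[symmetric])
qed (use assms in \<open>auto simp: colex_initial_def\<close>)

section \<open>Upper families\<close>

lemma upper_mono: "A \<subseteq> B \<Longrightarrow> upper C k A \<subseteq> upper C k B"
  by (auto simp: upper_def)

lemma mem_upperD: "p \<in> upper C k A \<Longrightarrow> p \<in> rainbow C (Suc k)"
  "p \<in> upper C k A \<Longrightarrow> v \<in> p \<Longrightarrow> p - {v} \<in> A"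
  by (auto simp: upper_def)

lemma finite_upper:
  assumes "finite A" "A \<subseteq> rainbow C k" "k > 0"
  shows "finite (upper C k A)"
proof (rule finite_subset)
  show "finite (Pow (\<Union>A))" using assms rainbow_finite by (metis finite_Pow_iff finite_Union subsetD)
  show "upper C k A \<subseteq> Pow (\<Union>A)"
  proof
    fix p assume p: "p \<in> upper C k A"
    have "x \<in> \<Union>A" if "x \<in> p" for x
    proof -
      have "card p = Suc k" using p by (auto simp: upper_def rainbow_def)
      then have "card (p - {x}) \<noteq> 0" using that assms(3) by simp
      then obtain y where "y \<in> p" "y \<noteq> x" by (metis DiffE card.empty ex_in_conv singletonI)
      then have "x \<in> p - {y}" "p - {y} \<in> A" using p that by (auto simp: upper_def)
      then show ?thesis by blast
    qed
    then show "p \<in> Pow (\<Union>A)" by blast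
  qed
qed

text \<open>Among the sets \<open>p - {v}\<close> the one without the minimum has the largest code,
  so an initial segment that contains it contains all the others.\<close>

lemma upper_initial_iff:
  assumes "colex_initial C k A" "p \<in> rainbow C (Suc k)"
  shows "p \<in> upper C k A \<longleftrightarrow> p - {Min p} \<in> A"
proof
  have fin: "finite p" "p \<noteq> {}" using assms(2) by (auto simp: rainbow_def)
  show "p - {Min p} \<in> A" if "p \<in> upper C k A"
    using that fin mem_upperD(2) by (meson Min_in)
  assume A: "p - {Min p} \<in> A"
  show "p \<in> upper C k A"
    unfolding upper_def
  proof (intro CollectI conjI ballI)
    fix v assume v: "v \<in> p"
    have "set_encode (p - {v}) \<le> set_encode (p - {Min p})"
    proof -
      have "v \<noteq> Min p \<Longrightarrow> set_encode (p - {v}) < set_encode (p - {Min p})"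
        by (rule set_encode_lessI[of _ _ v]) (use fin v in \<open>auto simp: leD\<close>)
      then show ?thesis by force
    qed
    then show "p - {v} \<in> A"
      using colex_initialD(3)[OF assms(1) rainbow_Diff[OF assms(2) v] A] by simp
  qed (use assms in auto)
qed

lemma colex_initial_upper:
  assumes "colex_initial C k A" "k > 0"
  shows "colex_initial C (Suc k) (upper C k A)"
  unfolding colex_initial_def
proof (intro conjI ballI impI)
  show "upper C k A \<subseteq> rainbow C (Suc k)" by (auto simp: upper_def)
  show "finite (upper C k A)" using finite_upper assms by (auto simp: colex_initial_def)
  fix x y assume xy: "x \<in> rainbow C (Suc k)" "y \<in> upper C k A" "set_encode x \<le> set_encode y"
  have y: "y \<in> rainbow C (Suc k)" using xy by (simp add: upper_def)
  have "set_encode (x - {Min x}) \<le> set_encode (y - {Min y})"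
    using xy(1,3) y by (intro set_encode_remove_Min_mono) (auto simp: rainbow_def)
  moreover have "y - {Min y} \<in> A" using upper_initial_iff[OF assms(1) y] xy by simp
  moreover have "x - {Min x} \<in> rainbow C k"
    using xy(1) by (intro rainbow_Diff) (auto simp: rainbow_def intro!: Min_in)
  ultimately have "x - {Min x} \<in> A" using assms(1) by (auto simp: colex_initial_def)
  then show "x \<in> upper C k A" using upper_initial_iff[OF assms(1) xy(1)] by simp
qed

text \<open>A (k + 1)-set is counted at its colexicographically largest k-subset, the one without the
  minimum. The weight is the number of sets counted at a given k-set.\<close>

definition weight :: "nat set \<Rightarrow> nat set \<Rightarrow> nat" where
  "weight C z = card {a. a < Min z \<and> a mod r \<in> C - colours z}"

lemma upper_remove_Min:
  assumes "p \<in> upper C k A" "k > 0"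
  shows "Min p \<in> p" "p - {Min p} \<in> A" "Min p < Min (p - {Min p})"
    and "Min p mod r \<in> C - colours (p - {Min p})"
proof -
  have pr: "p \<in> rainbow C (Suc k)" using assms by (simp add: upper_def)
  then have fin: "finite p" "card p = Suc k" by (auto simp: rainbow_def)
  then have "p \<noteq> {}" by auto
  then show M: "Min p \<in> p" using fin by simp
  then have "card (p - {Min p}) = k" using fin by simp
  then have ne: "p - {Min p} \<noteq> {}" using assms(2) by (metis card.empty less_irrefl)
  show "p - {Min p} \<in> A" using mem_upperD(2)[OF assms(1) M] .
  have "Min (p - {Min p}) \<in> p - {Min p}" using fin ne by (intro Min_in) auto
  then show "Min p < Min (p - {Min p})" using fin by (simp add: order_less_le)
  show "Min p mod r \<in> C - colours (p - {Min p})"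
    using rainbow_colour[OF pr M] rainbow_inj[OF pr M] by fastforce
qed

lemma card_upper_le:
  assumes "A \<subseteq> rainbow C k" "finite A" "k > 0"
  shows "card (upper C k A) \<le> (\<Sum>z\<in>A. weight C z)"
proof -
  let ?S = "\<lambda>z. {a. a < Min z \<and> a mod r \<in> C - colours z}"
  have "card (upper C k A) \<le> card (Sigma A ?S)"
  proof (rule card_inj_on_le)
    show "inj_on (\<lambda>p. (p - {Min p}, Min p)) (upper C k A)"
    proof (rule inj_onI)
      fix p p' assume "p \<in> upper C k A" "p' \<in> upper C k A"
        "(p - {Min p}, Min p) = (p' - {Min p'}, Min p')"
      then show "p = p'"
        using upper_remove_Min(1)[OF _ assms(3)] by (metis insert_Diff prod.inject)
    qed
    show "(\<lambda>p. (p - {Min p}, Min p)) ` upper C k A \<subseteq> Sigma A ?S"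
      using upper_remove_Min[OF _ assms(3)] by blast
    show "finite (Sigma A ?S)" using assms by (intro finite_SigmaI) auto
  qed
  also have "\<dots> = (\<Sum>z\<in>A. weight C z)"
    unfolding weight_def by (rule card_SigmaI) (use assms in auto)
  finally show ?thesis .
qed

text \<open>In an initial segment every admissible pair (z, a) does give an upper set
  \<open>insert a z\<close>, so the bound by weights is attained. Hence it suffices to compare total
  weights with those of an initial segment.\<close>

lemma card_upper_initial:
  assumes "colex_initial C k A" "k > 0"
  shows "card (upper C k A) = (\<Sum>z\<in>A. weight C z)"
proof (rule antisym)
  have A: "A \<subseteq> rainbow C k" "finite A" using assms by (auto simp: colex_initial_def)
  show "card (upper C k A) \<le> (\<Sum>z\<in>A. weight C z)"
    using card_upper_le A assms(2) by blast
  let ?S = "\<lambda>z. {a. a < Min z \<and> a mod r \<in> C - colours z}"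
  have Min: "Min (insert a z) = a" "a \<notin> z" if "z \<in> A" "a \<in> ?S z" for z a
  proof -
    have "finite z" "z \<noteq> {}" using that A assms(2) by (auto simp: rainbow_def)
    then show "Min (insert a z) = a" using that by (intro Min_eqI) auto
    show "a \<notin> z" using that by auto
  qed
  have "(\<Sum>z\<in>A. weight C z) = card (Sigma A ?S)"
    unfolding weight_def by (rule card_SigmaI[symmetric]) (use A in auto)
  also have "\<dots> \<le> card (upper C k A)"
  proof (rule card_inj_on_le)
    show "inj_on (\<lambda>(z, a). insert a z) (Sigma A ?S)"
    proof (rule inj_onI, clarsimp simp del: Min_gr_iff)
      fix z a z' a'
      assume *: "z \<in> A" "a < Min z" "a mod r \<in> C" "a mod r \<notin> colours z"
        "z' \<in> A" "a' < Min z'" "a' mod r \<in> C" "a' mod r \<notin> colours z'" "insert a z = insert a' z'"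
      have "a = a'" using Min(1)[of z a] Min(1)[of z' a'] * by simp
      then show "z = z' \<and> a = a'" using Min(2)[of z a] Min(2)[of z' a'] *
        by (metis (no_types, lifting) DiffI Diff_insert_absorb mem_Collect_eq)
    qed
    show "(\<lambda>(z, a). insert a z) ` Sigma A ?S \<subseteq> upper C k A"
    proof clarify
      fix z a assume za: "z \<in> A" "a < Min z" "a mod r \<in> C" "a mod r \<notin> colours z"
      have p: "insert a z \<in> rainbow C (Suc k)" using rainbow_insert za A by blast
      have "Min (insert a z) = a" "a \<notin> z" using Min[of z a] za by auto
      then show "insert a z \<in> upper C k A"
        using upper_initial_iff[OF assms(1) p] za(1) by simp
    qed
    show "finite (upper C k A)" using finite_upper A assms(2) by blast
  qed
  finally show "(\<Sum>z\<in>A. weight C z) \<le> card (upper C k A)" .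
qed

end

section \<open>Compression\<close>

text \<open>Reassembles a family split along one colour class: \<open>S\<close> holds vertices of
  the class, \<open>X\<close> the sets avoiding the class, and \<open>Y v\<close> the link of
  \<open>v\<close>, which \<open>section_at\<close> extracts.\<close>

definition glue :: "nat set \<Rightarrow> nat set set \<Rightarrow> (nat \<Rightarrow> nat set set) \<Rightarrow> nat set set" where
  "glue S X Y = X \<union> (\<Union>v\<in>S. insert v ` Y v)"

definition section_at :: "nat \<Rightarrow> nat set set \<Rightarrow> nat set set" where
  "section_at v A = {u. v \<notin> u \<and> insert v u \<in> A}"

context
  fixes r :: nat
begin

definition colour_free :: "nat \<Rightarrow> nat set set \<Rightarrow> nat set set" where
  "colour_free c A = {z \<in> A. c \<notin> colours r z}"

definition colex_optimal :: "nat set \<Rightarrow> nat \<Rightarrow> bool" where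
  "colex_optimal C k \<longleftrightarrow> (\<forall>A. A \<subseteq> rainbow r C k \<longrightarrow> finite A \<longrightarrow>
     card (upper r C k A) \<le> colex_bound r C k (card A))"

definition compressed :: "nat set \<Rightarrow> nat \<Rightarrow> nat \<Rightarrow> nat set set \<Rightarrow> bool" where
  "compressed C j c A \<longleftrightarrow> colex_initial r (C - {c}) (Suc j) (colour_free c A) \<and>
     (\<forall>v. v mod r = c \<longrightarrow> colex_initial r (C - {c}) j (section_at v A))"

text \<open>The pieces are disjoint by colour: sets in \<open>X\<close> avoid \<open>c\<close>, and
  in \<open>insert v u\<close> the vertex \<open>v\<close> is the only one of colour
  \<open>c\<close>. It is applied to the constant 1 and to the codes.\<close>

lemma sum_glue:
  fixes f :: "nat set \<Rightarrow> nat"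
  assumes "finite S" "\<And>v. v \<in> S \<Longrightarrow> v mod r = c"
    and X: "X \<subseteq> rainbow r (C - {c}) k" "finite X"
    and Y: "\<And>v. v \<in> S \<Longrightarrow> Y v \<subseteq> rainbow r (C - {c}) j" "\<And>v. v \<in> S \<Longrightarrow> finite (Y v)"
  shows "sum f (glue S X Y) = sum f X + (\<Sum>v\<in>S. \<Sum>u\<in>Y v. f (insert v u))"
proof -
  have notin: "x mod r \<noteq> c" if "z \<in> rainbow r (C - {c}) i" "x \<in> z" for x z i
    using rainbow_colour[OF that] by blast
  have v: "insert v u \<notin> X" "v \<notin> u" "v' \<in> insert v u \<Longrightarrow> v' = v"
    if "v \<in> S" "v' \<in> S" "u \<in> Y v" for v v' u
    using that assms(2) X Y(1) notin by (metis insert_iff subsetD)+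
  have "sum f (glue S X Y) = sum f X + sum f (\<Union>v\<in>S. insert v ` Y v)"
    unfolding glue_def
  proof (rule sum.union_disjoint)
    show "X \<inter> (\<Union>v\<in>S. insert v ` Y v) = {}" using v(1) by blast
  qed (use X(2) Y(2) assms(1) in simp_all)
  also have "sum f (\<Union>v\<in>S. insert v ` Y v) = (\<Sum>v\<in>S. sum f (insert v ` Y v))"
  proof (rule sum.UNION_disjoint)
    have "insert v ` Y v \<inter> insert w ` Y w = {}" if "v \<in> S" "w \<in> S" "v \<noteq> w" for v w
    proof (rule ccontr)
      assume "insert v ` Y v \<inter> insert w ` Y w \<noteq> {}"
      then obtain u u' where u: "u \<in> Y v" "insert v u = insert w u'" by blast
      then have "w \<in> insert v u" by simp
      then show False using v(3)[OF that(1,2) u(1)] that(3) by simp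
    qed
    then show "\<forall>v\<in>S. \<forall>w\<in>S. v \<noteq> w \<longrightarrow> insert v ` Y v \<inter> insert w ` Y w = {}" by blast
  qed (use Y(2) assms(1) in simp_all)
  also have "\<dots> = (\<Sum>v\<in>S. \<Sum>u\<in>Y v. f (insert v u))"
  proof (rule sum.cong[OF refl])
    fix w assume w: "w \<in> S"
    have "inj_on (insert w) (Y w)"
      using v(2)[OF w w] by (intro inj_onI) (metis insert_ident)
    then show "sum f (insert w ` Y w) = (\<Sum>u\<in>Y w. f (insert w u))"
      by (simp add: sum.reindex)
  qed
  finally show ?thesis .
qed

lemma card_glue:
  assumes "finite S" "\<And>v. v \<in> S \<Longrightarrow> v mod r = c"
    and "X \<subseteq> rainbow r (C - {c}) k" "finite X"
    and "\<And>v. v \<in> S \<Longrightarrow> Y v \<subseteq> rainbow r (C - {c}) j" "\<And>v. v \<in> S \<Longrightarrow> finite (Y v)"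
  shows "card (glue S X Y) = card X + (\<Sum>v\<in>S. card (Y v))"
  using sum_glue[OF assms, where f = "\<lambda>_. 1"] by simp

lemma glue_rainbow:
  assumes "c \<in> C" "\<And>v. v \<in> S \<Longrightarrow> v mod r = c"
    and X: "X \<subseteq> rainbow r (C - {c}) (Suc j)"
    and Y: "\<And>v. v \<in> S \<Longrightarrow> Y v \<subseteq> rainbow r (C - {c}) j"
  shows "glue S X Y \<subseteq> rainbow r C (Suc j)"
proof -
  have "insert v u \<in> rainbow r C (Suc j)" if "v \<in> S" "u \<in> Y v" for v u
    using rainbow_insert_colour(1)[of u r C v j] Y assms(1,2) that by blast
  moreover have "X \<subseteq> rainbow r C (Suc j)"
    using X rainbow_mono[of "C - {c}" C r "Suc j"] by blast
  ultimately show ?thesis unfolding glue_def by blast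
qed

text \<open>Deleting \<open>v\<close> from \<open>insert v u\<close> leaves \<open>u\<close>, which
  has to be a member of \<open>X\<close>; deleting any other point leaves \<open>v\<close> together
  with a set that has to be a member of \<open>Y v\<close>. This is the origin of the intersection
  with \<open>X\<close>.\<close>

lemma upper_glue:
  assumes "c \<in> C" "\<And>v. v \<in> S \<Longrightarrow> v mod r = c"
  shows "glue S (upper r (C - {c}) (Suc j) X) (\<lambda>v. upper r (C - {c}) j (Y v) \<inter> X)
    \<subseteq> upper r C (Suc j) (glue S X Y)"
proof
  fix p assume "p \<in> glue S (upper r (C - {c}) (Suc j) X) (\<lambda>v. upper r (C - {c}) j (Y v) \<inter> X)"
  then consider "p \<in> upper r (C - {c}) (Suc j) X"
    | v u where "v \<in> S" "u \<in> upper r (C - {c}) j (Y v)" "u \<in> X" "p = insert v u"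
    unfolding glue_def by blast
  then show "p \<in> upper r C (Suc j) (glue S X Y)"
  proof cases
    case 1
    then show ?thesis
      using rainbow_mono[of "C - {c}" C] by (auto simp: upper_def glue_def)
  next
    case 2
    have u: "u \<in> rainbow r (C - {v mod r}) (Suc j)"
      using 2 assms(2) by (simp add: upper_def)
    have vu: "insert v u \<in> rainbow r C (Suc (Suc j))" "v \<notin> u"
      using rainbow_insert_colour[OF u] 2 assms by auto
    have "insert v u - {x} \<in> glue S X Y" if "x \<in> insert v u" for x
    proof (cases "x = v")
      case True
      then show ?thesis using vu 2 by (simp add: glue_def)
    next
      case False
      then have "insert v u - {x} = insert v (u - {x})" "u - {x} \<in> Y v"
        using that 2 by (auto simp: upper_def)
      then show ?thesis using 2 by (auto simp: glue_def)
    qed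
    then show ?thesis using 2 vu by (simp add: upper_def)
  qed
qed

lemma card_upper_glue:
  assumes "c \<in> C" "finite S" "\<And>v. v \<in> S \<Longrightarrow> v mod r = c"
    and X: "X \<subseteq> rainbow r (C - {c}) (Suc j)" "finite X"
    and Y: "\<And>v. v \<in> S \<Longrightarrow> Y v \<subseteq> rainbow r (C - {c}) j" "\<And>v. v \<in> S \<Longrightarrow> finite (Y v)"
  shows "card (upper r (C - {c}) (Suc j) X) + (\<Sum>v\<in>S. card (upper r (C - {c}) j (Y v) \<inter> X))
    \<le> card (upper r C (Suc j) (glue S X Y))"
proof -
  have "finite (glue S X Y)" using assms(2) X(2) Y(2) by (simp add: glue_def)
  then have "finite (upper r C (Suc j) (glue S X Y))"
    by (rule finite_upper[OF _ glue_rainbow[OF assms(1,3) X(1) Y(1)]]) simp_all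
  moreover have "card (glue S (upper r (C - {c}) (Suc j) X) (\<lambda>v. upper r (C - {c}) j (Y v) \<inter> X))
    = card (upper r (C - {c}) (Suc j) X) + (\<Sum>v\<in>S. card (upper r (C - {c}) j (Y v) \<inter> X))"
  proof (rule card_glue[OF assms(2,3)])
    show "upper r (C - {c}) (Suc j) X \<subseteq> rainbow r (C - {c}) (Suc (Suc j))"
      by (auto simp: upper_def)
    show "finite (upper r (C - {c}) (Suc j) X)" using finite_upper[OF X(2,1)] by simp
    show "upper r (C - {c}) j (Y v) \<inter> X \<subseteq> rainbow r (C - {c}) (Suc j)" for v
      using X(1) by blast
  qed (use X(2) in simp_all)
  ultimately show ?thesis
    using card_mono[OF _ upper_glue[OF assms(1,3), of S j X Y]] by simp
qed

section \<open>Splitting a family along a colour class\<close>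

lemma colour_free_rainbow:
  "A \<subseteq> rainbow r C k \<Longrightarrow> colour_free c A \<subseteq> rainbow r (C - {c}) k"
  unfolding colour_free_def rainbow_def by blast

lemma section_at_rainbow:
  assumes "A \<subseteq> rainbow r C (Suc j)" "v mod r = c"
  shows "section_at v A \<subseteq> rainbow r (C - {c}) j"
proof
  fix u assume "u \<in> section_at v A"
  then have u: "v \<notin> u" "insert v u \<in> rainbow r C (Suc j)" using assms by (auto simp: section_at_def)
  then show "u \<in> rainbow r (C - {c}) j"
    using rainbow_Diff_colour[OF u(2), of v] assms by simp
qed

lemma finite_section_at: "finite A \<Longrightarrow> finite (section_at v A)"
proof -
  assume "finite A"
  moreover have "section_at v A \<subseteq> (\<lambda>z. z - {v}) ` A"
  proof
    fix u assume "u \<in> section_at v A"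
    then have "u = insert v u - {v}" "insert v u \<in> A" by (auto simp: section_at_def)
    then show "u \<in> (\<lambda>z. z - {v}) ` A" by blast
  qed
  ultimately show ?thesis by (meson finite_imageI finite_subset)
qed

lemma glue_sections:
  assumes "\<And>z v. z \<in> A \<Longrightarrow> v \<in> z \<Longrightarrow> v mod r = c \<Longrightarrow> v \<in> S"
  shows "glue S (colour_free c A) (\<lambda>v. section_at v A) = A"
proof
  show "glue S (colour_free c A) (\<lambda>v. section_at v A) \<subseteq> A"
    by (auto simp: glue_def colour_free_def section_at_def)
  show "A \<subseteq> glue S (colour_free c A) (\<lambda>v. section_at v A)"
  proof
    fix z assume z: "z \<in> A"
    show "z \<in> glue S (colour_free c A) (\<lambda>v. section_at v A)"
    proof (cases "c \<in> colours r z")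
      case True
      then obtain v where v: "v \<in> z" "v mod r = c" by blast
      then have "v \<in> S" "z - {v} \<in> section_at v A" "z = insert v (z - {v})"
        using z assms by (auto simp: section_at_def insert_absorb)
      then show ?thesis unfolding glue_def by blast
    next
      case False
      then show ?thesis using z by (simp add: glue_def colour_free_def)
    qed
  qed
qed

lemma colour_free_upper:
  "colour_free c (upper r C (Suc j) A) \<subseteq> upper r (C - {c}) (Suc j) (colour_free c A)"
proof
  fix p assume p: "p \<in> colour_free c (upper r C (Suc j) A)"
  have "p \<in> rainbow r (C - {c}) (Suc (Suc j))"
    using p colour_free_rainbow[of "upper r C (Suc j) A" C "Suc (Suc j)"] by (auto simp: upper_def)
  then show "p \<in> upper r (C - {c}) (Suc j) (colour_free c A)"
    using p by (auto simp: upper_def colour_free_def)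
qed

lemma section_at_upper:
  assumes "v mod r = c"
  shows "section_at v (upper r C (Suc j) A) \<subseteq> upper r (C - {c}) j (section_at v A) \<inter> colour_free c A"
proof
  fix u assume u: "u \<in> section_at v (upper r C (Suc j) A)"
  then have vu: "v \<notin> u" "insert v u \<in> upper r C (Suc j) A" by (auto simp: section_at_def)
  have ur: "u \<in> rainbow r (C - {c}) (Suc j)"
    using section_at_rainbow[of "upper r C (Suc j) A" C "Suc j" v c] u assms by (auto simp: upper_def)
  have "u \<in> A" using mem_upperD(2)[OF vu(2), of v] vu(1) by simp
  moreover have "c \<notin> colours r u" using rainbow_colour[OF ur] by blast
  moreover have "u - {x} \<in> section_at v A" if "x \<in> u" for x
  proof -
    have "insert v u - {x} \<in> A" "x \<noteq> v" using mem_upperD(2)[OF vu(2), of x] vu(1) that by auto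
    then have "insert v (u - {x}) \<in> A" by (simp add: insert_Diff_if)
    then show ?thesis using vu(1) by (simp add: section_at_def)
  qed
  ultimately show "u \<in> upper r (C - {c}) j (section_at v A) \<inter> colour_free c A"
    using ur by (auto simp: upper_def colour_free_def)
qed

lemma card_upper_sections:
  assumes "A \<subseteq> rainbow r C (Suc j)" "finite A" "finite S" "\<And>v. v \<in> S \<Longrightarrow> v mod r = c"
    and S: "\<And>z v. z \<in> A \<Longrightarrow> v \<in> z \<Longrightarrow> v mod r = c \<Longrightarrow> v \<in> S"
  shows "card (upper r C (Suc j) A) \<le> card (upper r (C - {c}) (Suc j) (colour_free c A))
    + (\<Sum>v\<in>S. card (upper r (C - {c}) j (section_at v A) \<inter> colour_free c A))"
proof -
  let ?U = "upper r C (Suc j) A"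
  have fin: "finite ?U" using finite_upper assms by blast
  have U: "?U \<subseteq> rainbow r C (Suc (Suc j))" by (auto simp: upper_def)
  \<comment> \<open>\<open>p\<close> has at least two elements, so \<open>v\<close> survives in some
    \<open>p - {x}\<close>, a member of \<open>A\<close>. Thus \<open>S\<close> also covers the
    vertices of colour \<open>c\<close> in the upper family.\<close>
  have "v \<in> S" if "p \<in> ?U" "v \<in> p" "v mod r = c" for p v
  proof -
    have "finite p" "card p = Suc (Suc j)" using that(1) by (auto simp: upper_def rainbow_def)
    then have "card (p - {v}) = Suc j" using that(2) by simp
    then obtain x where "x \<in> p - {v}" by (metis card.empty ex_in_conv nat.distinct(1))
    then have "p - {x} \<in> A" "v \<in> p - {x}" using that mem_upperD(2)[OF that(1)] by auto
    then show ?thesis using S that(3) by blast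
  qed
  then have "card ?U = card (glue S (colour_free c ?U) (\<lambda>v. section_at v ?U))"
    by (subst glue_sections) auto
  also have "\<dots> = card (colour_free c ?U) + (\<Sum>v\<in>S. card (section_at v ?U))"
    by (rule card_glue[OF assms(3,4) colour_free_rainbow[OF U] _ section_at_rainbow[OF U]])
      (use fin finite_section_at assms in \<open>auto simp: colour_free_def\<close>)
  also have "\<dots> \<le> card (upper r (C - {c}) (Suc j) (colour_free c A))
    + (\<Sum>v\<in>S. card (upper r (C - {c}) j (section_at v A) \<inter> colour_free c A))"
  proof (intro add_mono sum_mono card_mono)
    have cf: "colour_free c A \<subseteq> rainbow r (C - {c}) (Suc j)" "finite (colour_free c A)"
      using colour_free_rainbow assms by (auto simp: colour_free_def)
    then show "finite (upper r (C - {c}) (Suc j) (colour_free c A))"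
      using finite_upper by blast
    show "finite (upper r (C - {c}) j (section_at v A) \<inter> colour_free c A)" for v
      using cf by blast
  qed (use colour_free_upper section_at_upper assms in blast)+
  finally show ?thesis .
qed

lemma colex_initial_0: "P \<subseteq> {{}} \<Longrightarrow> colex_initial r C 0 P"
  by (auto simp: colex_initial_def rainbow_0 finite_subset)

text \<open>For j = 0 the upper family of a nonempty family is infinite and its cardinality is 0, hence the
  intersection with a finite family.\<close>

lemma card_upper_Int_le_segment:
  assumes opt: "j > 0 \<Longrightarrow> colex_optimal C j"
    and P: "P \<subseteq> rainbow r C j" "finite P" and X: "X \<subseteq> rainbow r C (Suc j)" "finite X"
  shows "card (upper r C j P \<inter> X)
    \<le> card (upper r C j (segment r C j (card P)) \<inter> segment r C (Suc j) (card X))"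
proof -
  note sP = segment_initial[OF P order_refl]
  note sX = segment_initial[OF X order_refl]
  have le: "card (upper r C j P \<inter> X) \<le> card X"
    using X by (intro card_mono) auto
  show ?thesis
  proof (cases "j = 0")
    case True
    have "colex_initial r C 0 P" using P True by (intro colex_initial_0) (simp add: rainbow_0)
    then have seg: "segment r C j (card P) = P" using True segment_eqI by blast
    show ?thesis
    proof (cases "P = {}")
      case True
      then have "upper r C j P = {}" by (auto simp: upper_def rainbow_def)
      then show ?thesis by simp
    next
      case False
      then have "P = {{}}" using P True by (auto simp: rainbow_0)
      then have "upper r C j P = rainbow r C (Suc j)"
        unfolding upper_def using rainbow_Diff[of _ r C j] \<open>j = 0\<close> by (auto simp: rainbow_0)
      then have "upper r C j (segment r C j (card P)) \<inter> segment r C (Suc j) (card X)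
          = segment r C (Suc j) (card X)"
        using seg colex_initialD(1)[OF sX(1)] by auto
      then show ?thesis using le sX by simp
    qed
  next
    case False
    have "card (upper r C j P \<inter> X) \<le> card (upper r C j P)"
      using False by (intro card_mono finite_upper[OF P(2,1)]) auto
    also have "\<dots> \<le> card (upper r C j (segment r C j (card P)))"
      using opt P False by (auto simp: colex_optimal_def colex_bound_def)
    finally have "card (upper r C j P \<inter> X)
        \<le> min (card (upper r C j (segment r C j (card P)))) (card (segment r C (Suc j) (card X)))"
      using le sX by simp
    also have "\<dots> = card (upper r C j (segment r C j (card P)) \<inter> segment r C (Suc j) (card X))"
      using colex_initial_Int[OF colex_initial_upper[OF sP(1)] sX(1)] False by simp
    finally show ?thesis .
  qed
qed

text \<open>The sum of codes splits into the sum over the colour-free part and, for each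
  \<open>v\<close>, the sum over the link plus \<open>2 ^ v\<close> times its size. Replacing the
  pieces by initial segments keeps their sizes and hence the latter terms, so the total drops as
  soon as one piece was not initial.\<close>

lemma compression:
  assumes c: "c \<in> C" and opt: "colex_optimal (C - {c}) (Suc j)" "j > 0 \<Longrightarrow> colex_optimal (C - {c}) j"
    and A: "A \<subseteq> rainbow r C (Suc j)" "finite A"
    and nc: "\<not> compressed C j c A"
  obtains B where "B \<subseteq> rainbow r C (Suc j)" "finite B" "card B = card A"
    "card (upper r C (Suc j) A) \<le> card (upper r C (Suc j) B)"
    "sum set_encode B < sum set_encode A"
proof -
  let ?D = "C - {c}"
  define S where "S = {v \<in> \<Union>A. v mod r = c}"
  have "finite (\<Union>A)" using A rainbow_finite by (metis finite_Union subsetD)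
  then have S: "finite S" "\<And>v. v \<in> S \<Longrightarrow> v mod r = c"
      "\<And>z v. z \<in> A \<Longrightarrow> v \<in> z \<Longrightarrow> v mod r = c \<Longrightarrow> v \<in> S"
    unfolding S_def using finite_subset[of "{v \<in> \<Union>A. v mod r = c}" "\<Union>A"] by blast+
  let ?X = "colour_free c A"
  let ?Y = "\<lambda>v. section_at v A"
  have X: "?X \<subseteq> rainbow r ?D (Suc j)" "finite ?X"
    using colour_free_rainbow A by (auto simp: colour_free_def)
  have Y: "?Y v \<subseteq> rainbow r ?D j" "finite (?Y v)" if "v \<in> S" for v
    using section_at_rainbow finite_section_at A S that by auto
  define X' where "X' = segment r ?D (Suc j) (card ?X)"
  define Y' where "Y' = (\<lambda>v. segment r ?D j (card (?Y v)))"
  have X': "colex_initial r ?D (Suc j) X'" "card X' = card ?X"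
    unfolding X'_def using segment_initial[OF X order_refl] by auto
  have Y': "colex_initial r ?D j (Y' v)" "card (Y' v) = card (?Y v)" if "v \<in> S" for v
    unfolding Y'_def using segment_initial[OF Y[OF that] order_refl] by auto
  have X'': "X' \<subseteq> rainbow r ?D (Suc j)" "finite X'" using X' by (auto simp: colex_initial_def)
  have Y'': "Y' v \<subseteq> rainbow r ?D j" "finite (Y' v)" if "v \<in> S" for v
    using Y' that by (auto simp: colex_initial_def)
  define B where "B = glue S X' Y'"
  have Aeq: "A = glue S ?X ?Y" using glue_sections[of A c S] S(3) by blast
  have 1: "B \<subseteq> rainbow r C (Suc j)"
    unfolding B_def using glue_rainbow[OF c S(2) X''(1) Y''(1)] .
  have 2: "finite B" unfolding B_def glue_def using S X'' Y'' by auto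
  have 3: "card B = card A"
    using card_glue[where Y = Y', OF S(1,2) X'' Y''] card_glue[where Y = ?Y, OF S(1,2) X Y] Aeq X'(2) Y'(2)
    unfolding B_def by simp
  have "card (upper r C (Suc j) A) \<le> card (upper r ?D (Suc j) ?X)
    + (\<Sum>v\<in>S. card (upper r ?D j (?Y v) \<inter> ?X))"
    using card_upper_sections[OF A S] .
  also have "\<dots> \<le> card (upper r ?D (Suc j) X') + (\<Sum>v\<in>S. card (upper r ?D j (Y' v) \<inter> X'))"
  proof (intro add_mono sum_mono)
    show "card (upper r ?D (Suc j) ?X) \<le> card (upper r ?D (Suc j) X')"
      using opt(1) X by (auto simp: colex_optimal_def colex_bound_def X'_def)
    show "card (upper r ?D j (?Y v) \<inter> ?X) \<le> card (upper r ?D j (Y' v) \<inter> X')" if "v \<in> S" for v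
      unfolding X'_def Y'_def using card_upper_Int_le_segment[OF opt(2) Y[OF that] X] by simp
  qed
  also have "\<dots> \<le> card (upper r C (Suc j) B)"
    unfolding B_def using card_upper_glue[OF c S(1,2) X'' Y''] by simp
  finally have 4: "card (upper r C (Suc j) A) \<le> card (upper r C (Suc j) B)" .
  have enc: "(\<Sum>u\<in>Z. set_encode (insert v u)) = card Z * 2 ^ v + sum set_encode Z"
    if "Z \<subseteq> rainbow r ?D j" "v \<in> S" for Z v
  proof -
    have "set_encode (insert v u) = 2 ^ v + set_encode u" if "u \<in> Z" for u
    proof -
      have "v \<notin> u" using rainbow_colour[of u r ?D j v] \<open>Z \<subseteq> _\<close> S(2)[OF \<open>v \<in> S\<close>] that by auto
      then show ?thesis using rainbow_finite[of u r ?D j] \<open>Z \<subseteq> _\<close> that by (auto simp: set_encode_insert)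
    qed
    then show ?thesis by (simp add: sum.distrib)
  qed
  have sumA: "sum set_encode A = sum set_encode ?X + (\<Sum>v\<in>S. card (?Y v) * 2 ^ v + sum set_encode (?Y v))"
    using sum_glue[where f = set_encode and Y = ?Y, OF S(1,2) X Y] Aeq enc[OF Y(1)] by simp
  have sumB: "sum set_encode B = sum set_encode X' + (\<Sum>v\<in>S. card (?Y v) * 2 ^ v + sum set_encode (Y' v))"
    unfolding B_def using sum_glue[where f = set_encode and Y = Y', OF S(1,2) X'' Y''] enc[OF Y''(1)] Y'(2) by simp
  have leX: "sum set_encode X' \<le> sum set_encode ?X"
    using colex_initial_sum_less[OF X'(1) X X'(2)[symmetric]] by (metis less_imp_le order_refl)
  have leY: "sum set_encode (Y' v) \<le> sum set_encode (?Y v)" if "v \<in> S" for v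
    using colex_initial_sum_less[OF Y'(1) Y Y'(2)[symmetric]] that by (metis less_imp_le order_refl)
  have 5: "sum set_encode B < sum set_encode A"
  proof (cases "?X = X'")
    case False
    then have "sum set_encode X' < sum set_encode ?X"
      using colex_initial_sum_less[OF X'(1) X X'(2)[symmetric]] by simp
    then show ?thesis unfolding sumA sumB by (intro add_less_le_mono sum_mono) (use leY in auto)
  next
    case True
    then obtain v where v: "v mod r = c" "\<not> colex_initial r ?D j (?Y v)"
      using nc X'(1) unfolding compressed_def by metis
    \<comment> \<open>A vertex outside \<open>S\<close> has an empty section, which is
      initial.\<close>
    have "v \<in> S"
    proof (rule ccontr)
      assume "v \<notin> S"
      then have "?Y v = {}" using S(3) v(1) by (auto simp: section_at_def)
      then show False using v(2) by (simp add: colex_initial_def)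
    qed
    moreover have "sum set_encode (Y' v) < sum set_encode (?Y v)"
      using colex_initial_sum_less[OF Y'(1) Y Y'(2)[symmetric]] Y'(1) v(2) \<open>v \<in> S\<close> by metis
    ultimately have "(\<Sum>v\<in>S. card (?Y v) * 2 ^ v + sum set_encode (Y' v))
        < (\<Sum>v\<in>S. card (?Y v) * 2 ^ v + sum set_encode (?Y v))"
      by (intro sum_strict_mono_ex1 S(1)) (use leY in auto)
    then show ?thesis unfolding sumA sumB using leX by linarith
  qed
  show ?thesis using that 1 2 3 4 5 by blast
qed

end

section \<open>Compressed families of sets with at least two elements\<close>

lemma add_le_of_cong_less:
  fixes u v r :: nat
  assumes "u < v" "u mod r = v mod r"
  shows "u + r \<le> v"
proof -
  have "r dvd v - u" using assms mod_eq_dvd_iff_nat[of u v r] by simp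
  then show ?thesis using assms(1) dvd_imp_le[of r "v - u"] by linarith
qed

context
  fixes r :: nat
begin

text \<open>In disjoint sets the largest element of all is the top difference, so it belongs to the
  later set. Consequently every set containing \<open>Max y\<close> comes after
  \<open>x\<close>.\<close>

lemma disjoint_Max_less:
  assumes "finite x" "finite y" "x \<inter> y = {}" "set_encode x < set_encode y" "u \<in> x"
  shows "u < Max y"
proof -
  obtain d where d: "d \<in> y" "d \<notin> x" "\<And>e. e > d \<Longrightarrow> e \<in> x \<longleftrightarrow> e \<in> y"
    using set_encode_lessE[OF assms(1,2,4)] by blast
  have "\<not> u > d" using d(3)[of u] assms(3,5) by blast
  moreover have "u \<noteq> d" using d assms(5) by blast
  ultimately have "u < d" by simp
  also have "d \<le> Max y" using d(1) assms(2) by simp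
  finally show ?thesis .
qed

text \<open>The hypotheses hold if y belongs to a compressed family, x does not, and x precedes y. If y has
  positive weight, exchanging one element of y for a smaller one shows that x misses only the colour
  of the maximum of y, and then residue classes can be compared block by block.\<close>

lemma weight_le_of_incomparable:
  assumes r: "r > 0" and x: "x \<in> rainbow r C k" and y: "y \<in> rainbow r C k" and k: "k \<ge> 2"
    and disj: "x \<inter> y = {}" and cover: "C \<subseteq> colours r x \<union> colours r y"
    and key: "\<And>w. w \<in> rainbow r C k \<Longrightarrow> Max y \<in> w \<Longrightarrow> set_encode w < set_encode y \<Longrightarrow>
      x \<inter> w = {} \<and> C \<subseteq> colours r x \<union> colours r w"
  shows "weight r C y \<le> weight r C x"
proof (cases "weight r C y = 0")
  case False
  then have "{a. a < Min y \<and> a mod r \<in> C - colours r y} \<noteq> {}"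
    unfolding weight_def by (metis card.empty)
  then obtain a where a: "a < Min y" "a mod r \<in> C" "a mod r \<notin> colours r y" by blast
  have fin: "finite x" "finite y" and cd: "card x = k" "card y = k"
    using x y by (auto simp: rainbow_def)
  have ne: "x \<noteq> {}" "y \<noteq> {}" using cd k by auto
  have Yy: "Max y \<in> y" using fin ne by simp
  define g where "g = Max y mod r"
  have gC: "g \<in> C" using rainbow_colour[OF y Yy] by (simp add: g_def)
  have gy: "g \<in> colours r y" using Yy g_def by blast
  \<comment> \<open>If \<open>x\<close> missed another colour \<open>c\<close>, then
    \<open>y\<close> would have it, at some \<open>u\<close>. Replacing \<open>u\<close> by the
    smaller \<open>a\<close>, whose colour is new to \<open>y\<close>, gives an earlier set that
    still contains \<open>Max y\<close> but has lost \<open>c\<close>; then neither it nor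
    \<open>x\<close> has \<open>c\<close>, against \<open>key\<close>.\<close>
  have step1: "c = g" if c: "c \<in> C - colours r x" for c
  proof (rule ccontr)
    assume "c \<noteq> g"
    obtain u where u: "u \<in> y" "u mod r = c" using cover c by blast
    have uY: "u \<noteq> Max y" using u \<open>c \<noteq> g\<close> by (auto simp: g_def)
    let ?w = "insert a (y - {u})"
    have "?w \<in> rainbow r C k" using rainbow_swap[OF y u(1) a(2)] a(3) by blast
    moreover have "Max y \<in> ?w" using Yy uY by blast
    moreover have "set_encode ?w < set_encode y"
    proof (rule set_encode_swap_less[OF fin(2) u(1)])
      show "a < u" using a(1) u(1) fin(2) by (meson Min_le less_le_trans)
      show "a \<notin> y" using a(3) by blast
    qed
    ultimately have "c \<in> colours r ?w" using key[of ?w] c by blast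
    then obtain v where v: "v \<in> ?w" "v mod r = c" by blast
    have "c \<in> colours r y" using u by blast
    then have "v \<noteq> a" using v(2) a(3) by metis
    then have "v \<in> y" "v \<noteq> u" using v(1) by auto
    then show False using rainbow_inj[OF y _ u(1), of v] v(2) u(2) by simp
  qed
  define c' where "c' = a mod r"
  have c': "c' \<in> C" "c' \<notin> colours r y" using a by (auto simp: c'_def)
  have Csub: "C \<subseteq> insert g (colours r x)" using step1 by blast
  have yC: "colours r y \<subseteq> C" using rainbow_colour[OF y] by blast
  have cx: "card (colours r x) = k" "card (colours r y) = k"
    using rainbow_card_colours x y by blast+
  have finc: "finite (colours r x)" "finite (colours r y)" using fin by auto
  have gx: "g \<notin> colours r x"
  proof
    assume "g \<in> colours r x"
    then have "insert c' (colours r y) \<subseteq> colours r x" using Csub c' yC by blast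
    then have "card (insert c' (colours r y)) \<le> card (colours r x)"
      by (rule card_mono[OF finc(1)])
    then show False using cx c' finc by simp
  qed
  \<comment> \<open>\<open>x\<close> has \<open>k\<close> colours and misses only \<open>g\<close>,
    so \<open>C\<close> has \<open>k + 1\<close> colours and \<open>y\<close> misses exactly
    one.\<close>
  have Cy: "C - colours r y = {c'}"
  proof -
    have "c'' = c'" if "c'' \<in> C - colours r y" for c''
    proof (rule ccontr)
      assume "c'' \<noteq> c'"
      have "insert c'' (insert c' (colours r y)) \<subseteq> insert g (colours r x)"
        using Csub c' yC that by blast
      then have "card (insert c'' (insert c' (colours r y))) \<le> card (insert g (colours r x))"
        by (rule card_mono[rotated]) (use finc in simp)
      then show False using cx c' finc that \<open>c'' \<noteq> c'\<close> gx by simp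
    qed
    then show ?thesis using c' by blast
  qed
  have Cx: "C - colours r x = {g}" using step1 gC gx by blast
  define v where "v = Min x"
  have vx: "v \<in> x" using fin ne by (simp add: v_def)
  have vC: "v mod r \<in> C" using rainbow_colour[OF x vx] .
  \<comment> \<open>Moving \<open>Min x\<close> into \<open>y\<close> in place of a larger element
    other than \<open>Max y\<close> would create an earlier set that meets \<open>x\<close>.\<close>
  have nsw: "\<not> v < u" if u: "u \<in> y" "u \<noteq> Max y" "v mod r \<notin> colours r (y - {u})" for u
  proof
    assume "v < u"
    have "v \<notin> y" using disj vx by blast
    have "insert v (y - {u}) \<in> rainbow r C k" using rainbow_swap[OF y u(1) vC u(3)] .
    moreover have "Max y \<in> insert v (y - {u})" using Yy u by blast
    moreover have "set_encode (insert v (y - {u})) < set_encode y"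
      using set_encode_swap_less[OF fin(2) u(1) \<open>v < u\<close> \<open>v \<notin> y\<close>] .
    ultimately show False using key vx by blast
  qed
  have vg: "v mod r \<noteq> g" using gx vx by blast
  have grlt: "g < r" using r by (simp add: g_def)
  \<comment> \<open>The image of \<open>b\<close> is the number of colour \<open>g\<close> in the
    same block of length \<open>r\<close>. If it reached \<open>v = Min x\<close>, then either
    \<open>y\<close> would contain an element of the colour of \<open>v\<close> at least
    \<open>r\<close> below \<open>v\<close>, hence below the block of \<open>b\<close> and below
    \<open>Min y\<close>; or \<open>v\<close> would have the colour of \<open>b\<close> and lie at
    least \<open>r\<close> above \<open>b\<close>, outside the block.\<close>
  have main: "g + (b div r) * r < v" if b: "b < Min y" "b mod r = c'" for b
  proof (rule ccontr)
    assume "\<not> ?thesis"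
    then have vle: "v \<le> g + (b div r) * r" by simp
    have bd: "(b div r) * r \<le> b" by (simp add: div_times_less_eq_dividend)
    show False
    proof (cases "v mod r \<in> colours r y")
      case True
      then obtain u where u: "u \<in> y" "u mod r = v mod r" by force
      have "u \<noteq> Max y" using u vg by (auto simp: g_def)
      moreover have "v mod r \<notin> colours r (y - {u})"
      proof
        assume "v mod r \<in> colours r (y - {u})"
        then obtain t where "t \<in> y" "t \<noteq> u" "t mod r = v mod r" by force
        then show False using rainbow_inj[OF y _ u(1), of t] u(2) by simp
      qed
      ultimately have "\<not> v < u" using nsw u(1) by blast
      moreover have "u \<noteq> v" using u(1) vx disj by blast
      ultimately have "u + r \<le> v" using add_le_of_cong_less[of u v r] u(2) by simp
      then have "u < (b div r) * r" using vle grlt by linarith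
      moreover have "Min y \<le> u" using fin u by simp
      ultimately show False using b bd by linarith
    next
      case False
      then have vc: "v mod r = c'" using Cy vC by blast
      \<comment> \<open>Here \<open>k \<ge> 2\<close> enters: \<open>nsw\<close> may be applied to
        \<open>Min y\<close> only if that is not the maximum.\<close>
      have "Min y \<noteq> Max y"
      proof
        assume eq: "Min y = Max y"
        have "t = Max y" if "t \<in> y" for t
          using Min_le[OF fin(2) that] Max_ge[OF fin(2) that] eq by linarith
        then have "y \<subseteq> {Max y}" by blast
        then have "card y \<le> 1" using card_mono[of "{Max y}" y] by simp
        then show False using cd k by simp
      qed
      moreover have Miny: "Min y \<in> y" using fin ne by simp
      ultimately have "\<not> v < Min y" using nsw False by blast
      moreover have "Min y \<noteq> v" using Miny vx disj by (metis disjoint_iff)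
      ultimately have "b < v" using b by linarith
      then have "b + r \<le> v" using add_le_of_cong_less[of b v r] b vc by simp
      then show False using vle grlt bd by linarith
    qed
  qed
  have "card {b. b < Min y \<and> b mod r \<in> C - colours r y}
      \<le> card {b. b < Min x \<and> b mod r \<in> C - colours r x}"
  proof (rule card_inj_on_le)
    show "inj_on (\<lambda>b. g + (b div r) * r) {b. b < Min y \<and> b mod r \<in> C - colours r y}"
    proof (rule inj_onI)
      fix b b' assume *: "b \<in> {b. b < Min y \<and> b mod r \<in> C - colours r y}"
        "b' \<in> {b. b < Min y \<and> b mod r \<in> C - colours r y}"
        "g + (b div r) * r = g + (b' div r) * r"
      have "b div r = b' div r" using *(3) r by simp
      moreover have "b mod r = b' mod r" using *(1,2) unfolding Cy by simp
      ultimately show "b = b'" by (metis div_mult_mod_eq)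
    qed
    show "(\<lambda>b. g + (b div r) * r) ` {b. b < Min y \<and> b mod r \<in> C - colours r y}
        \<subseteq> {b. b < Min x \<and> b mod r \<in> C - colours r x}"
      unfolding Cx Cy using main grlt by (auto simp: v_def simp del: Min_gr_iff)
  qed simp
  then show ?thesis unfolding weight_def .
qed simp

text \<open>A missing predecessor must be invisible in every piece. A common vertex would put both
  sets into one link, and a colour absent from both would put them into one colour-free part; these
  parts are initial and would contain \<open>x\<close> as well.\<close>

lemma compressed_incomparable:
  assumes comp: "\<And>c. c \<in> C \<Longrightarrow> compressed r C j c B"
    and x: "x \<in> rainbow r C (Suc j)" "x \<notin> B" and y: "y \<in> rainbow r C (Suc j)" "y \<in> B"
    and less: "set_encode x \<le> set_encode y"
  shows "x \<inter> y = {}" "C \<subseteq> colours r x \<union> colours r y"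
proof -
  show "x \<inter> y = {}"
  proof (rule ccontr)
    assume "x \<inter> y \<noteq> {}"
    then obtain v where v: "v \<in> x" "v \<in> y" by blast
    define c where "c = v mod r"
    have "c \<in> C" using rainbow_colour[OF x(1) v(1)] by (simp add: c_def)
    then have init: "colex_initial r (C - {c}) j (section_at v B)"
      using comp by (auto simp: compressed_def c_def)
    have "x - {v} \<in> rainbow r (C - {c}) j" using rainbow_Diff_colour[OF x(1) v(1)] by (simp add: c_def)
    moreover have "y - {v} \<in> section_at v B" using y v by (simp add: section_at_def insert_absorb)
    moreover have "set_encode (x - {v}) \<le> set_encode (y - {v})"
      using set_encode_insert_le_iff[of "x - {v}" "y - {v}" v] less v rainbow_finite[OF x(1)]
        rainbow_finite[OF y(1)] by (simp add: insert_absorb)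
    ultimately have "x - {v} \<in> section_at v B" using colex_initialD(3)[OF init] by blast
    then show False using x v by (simp add: section_at_def insert_absorb)
  qed
  show "C \<subseteq> colours r x \<union> colours r y"
  proof
    fix c assume c: "c \<in> C"
    show "c \<in> colours r x \<union> colours r y"
    proof (rule ccontr)
      assume n: "c \<notin> colours r x \<union> colours r y"
      have init: "colex_initial r (C - {c}) (Suc j) (colour_free r c B)"
        using comp[OF c] by (simp add: compressed_def)
      have "x \<in> rainbow r (C - {c}) (Suc j)" using x n unfolding rainbow_def by blast
      moreover have "y \<in> colour_free r c B" using y n by (simp add: colour_free_def)
      ultimately have "x \<in> colour_free r c B" using colex_initialD(3)[OF init] less by blast
      then show False using x by (simp add: colour_free_def)
    qed
  qed
qed

text \<open>Replaces an iteration of compressions: applied to \<open>B\<close>, a further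
  compression would give a family of the same size, with no fewer upper sets and a smaller sum of
  codes.\<close>

lemma obtain_encode_minimal:
  assumes "A \<subseteq> rainbow r C k" "finite A"
  obtains B where "B \<subseteq> rainbow r C k" "finite B" "card B = card A"
    "card (upper r C k A) \<le> card (upper r C k B)"
    "\<And>B'. B' \<subseteq> rainbow r C k \<Longrightarrow> finite B' \<Longrightarrow> card B' = card B \<Longrightarrow>
      card (upper r C k B) \<le> card (upper r C k B') \<Longrightarrow> sum set_encode B \<le> sum set_encode B'"
proof -
  let ?P = "\<lambda>B. B \<subseteq> rainbow r C k \<and> finite B \<and> card B = card A \<and>
    card (upper r C k A) \<le> card (upper r C k B)"
  obtain B where B: "?P B" "\<And>B'. ?P B' \<Longrightarrow> sum set_encode B \<le> sum set_encode B'"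
    using ex_has_least_nat[of ?P A "sum set_encode"] assms by blast
  show ?thesis
    by (rule that[of B]) (use B(1) in \<open>auto intro!: B(2)\<close>)
qed

text \<open>The minimal family \<open>B\<close> is compressed for every colour. To compare it with
  the initial segment \<open>I\<close>, each pair from \<open>B - I\<close> and \<open>I - B\<close>
  is a member with a missing predecessor, so its weights are ordered; \<open>I\<close> attains its
  total weight, while \<open>B\<close> is bounded by its own.\<close>

lemma colex_optimal_Suc_Suc:
  assumes r: "r > 0"
    and opt: "\<And>c i. c \<in> C \<Longrightarrow> i > 0 \<Longrightarrow> colex_optimal r (C - {c}) i"
    and j: "j > 0"
  shows "colex_optimal r C (Suc j)"
  unfolding colex_optimal_def
proof (intro allI impI)
  fix A assume A: "A \<subseteq> rainbow r C (Suc j)" "finite A"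
  obtain B where B: "B \<subseteq> rainbow r C (Suc j)" "finite B" "card B = card A"
    "card (upper r C (Suc j) A) \<le> card (upper r C (Suc j) B)"
    "\<And>B'. B' \<subseteq> rainbow r C (Suc j) \<Longrightarrow> finite B' \<Longrightarrow> card B' = card B \<Longrightarrow>
      card (upper r C (Suc j) B) \<le> card (upper r C (Suc j) B') \<Longrightarrow> sum set_encode B \<le> sum set_encode B'"
    using obtain_encode_minimal[OF A] by metis
  have comp: "compressed r C j c B" if c: "c \<in> C" for c
  proof (rule ccontr)
    assume "\<not> compressed r C j c B"
    then obtain B' where "B' \<subseteq> rainbow r C (Suc j)" "finite B'" "card B' = card B"
      "card (upper r C (Suc j) B) \<le> card (upper r C (Suc j) B')"
      "sum set_encode B' < sum set_encode B"
      using compression[OF c opt[OF c, of "Suc j"] opt[OF c, of j] B(1,2)] by blast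
    then show False using B(5)[of B'] by simp
  qed
  define I where "I = segment r C (Suc j) (card A)"
  have I: "colex_initial r C (Suc j) I" "card I = card A"
    unfolding I_def using segment_initial[OF A order_refl] by auto
  have I': "I \<subseteq> rainbow r C (Suc j)" "finite I" using I by (auto simp: colex_initial_def)
  have "(\<Sum>z\<in>B. weight r C z) \<le> (\<Sum>z\<in>I. weight r C z)"
  proof (rule sum_le_of_swap[OF B(2) I'(2)])
    show "card B = card I" using B I by simp
    fix y x assume yx: "y \<in> B - I" "x \<in> I - B"
    have xr: "x \<in> rainbow r C (Suc j)" "x \<notin> B" using yx I' by auto
    have yr: "y \<in> rainbow r C (Suc j)" "y \<in> B" using yx B by auto
    have less: "set_encode x < set_encode y"
      using colex_initialD(3)[OF I(1) yr(1), of x] yx by (meson DiffE not_less)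
    note inc = compressed_incomparable[OF comp xr yr less_imp_le[OF less]]
    have fin: "finite x" "finite y" using rainbow_finite xr yr by blast+
    have ny: "y \<noteq> {}" using yr by (auto simp: rainbow_def)
    show "weight r C y \<le> weight r C x"
    proof (rule weight_le_of_incomparable[OF r xr(1) yr(1) _ inc])
      fix w assume w: "w \<in> rainbow r C (Suc j)" "Max y \<in> w" "set_encode w < set_encode y"
      \<comment> \<open>Otherwise \<open>w\<close> would be a missing predecessor of
        \<open>y\<close>, although the two share \<open>Max y\<close>.\<close>
      have "w \<in> B"
      proof (rule ccontr)
        assume "w \<notin> B"
        then have "w \<inter> y = {}"
          using compressed_incomparable(1)[OF comp w(1) _ yr] w(3) by simp
        then show False using w(2) fin ny by (meson Max_in disjoint_iff)
      qed
      \<comment> \<open>All elements of \<open>x\<close> lie below \<open>Max y\<close>, which is in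
        \<open>w\<close>. So \<open>x\<close> is a missing predecessor of the member
        \<open>w\<close> too.\<close>
      moreover have "set_encode x < set_encode w"
        using set_encode_less_of_max_less[OF fin(1) rainbow_finite[OF w(1)] w(2)]
          disjoint_Max_less[OF fin inc(1) less] by blast
      ultimately show "x \<inter> w = {} \<and> C \<subseteq> colours r x \<union> colours r w"
        using compressed_incomparable[OF comp xr w(1)] by simp
    qed (use j in simp)
  qed
  then have "card (upper r C (Suc j) A) \<le> (\<Sum>z\<in>I. weight r C z)"
    using card_upper_le[OF B(1,2)] B(4) by simp
  also have "\<dots> = card (upper r C (Suc j) I)"
    using card_upper_initial[OF I(1)] by simp
  finally show "card (upper r C (Suc j) A) \<le> colex_bound r C (Suc j) (card A)"
    by (simp add: colex_bound_def I_def)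
qed

text \<open>For one-element sets a family is a vertex set of a complete multipartite graph and
  \<open>upper\<close> is its edge set; a new vertex contributes its degree.\<close>

lemma card_upper_insert_singleton:
  assumes D: "D \<subseteq> rainbow r C (Suc 0)" "finite D" and y: "y mod r \<in> C" "{y} \<notin> D"
  shows "card (upper r C (Suc 0) (insert {y} D))
    = card (upper r C (Suc 0) D) + card {u. {u} \<in> D \<and> u mod r \<noteq> y mod r}"
proof -
  let ?N = "{u. {u} \<in> D \<and> u mod r \<noteq> y mod r}"
  have "upper r C (Suc 0) (insert {y} D) = upper r C (Suc 0) D \<union> (\<lambda>u. {u, y}) ` ?N"
  proof (rule set_eqI, rule iffI)
    fix p assume p: "p \<in> upper r C (Suc 0) (insert {y} D)"
    have pr: "p \<in> rainbow r C (Suc (Suc 0))" using mem_upperD(1)[OF p] .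
    show "p \<in> upper r C (Suc 0) D \<union> (\<lambda>u. {u, y}) ` ?N"
    proof (cases "y \<in> p")
      case True
      have "card (p - {y}) = 1" using pr True by (simp add: rainbow_def)
      then obtain u where u: "p - {y} = {u}" by (meson card_1_singletonE)
      then have uy: "u \<in> p" "u \<noteq> y" by auto
      have "{u} \<in> D" using mem_upperD(2)[OF p True] u uy by simp
      moreover have "u mod r \<noteq> y mod r" using rainbow_inj[OF pr uy(1) True] uy(2) by blast
      moreover have "p = {u, y}" using u True by blast
      ultimately show ?thesis by blast
    next
      case False
      then have "p - {v} \<noteq> {y}" for v by blast
      then have "p \<in> upper r C (Suc 0) D"
        using mem_upperD(2)[OF p] pr by (simp add: upper_def)
      then show ?thesis by blast
    qed
  next
    fix p assume "p \<in> upper r C (Suc 0) D \<union> (\<lambda>u. {u, y}) ` ?N"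
    then show "p \<in> upper r C (Suc 0) (insert {y} D)"
    proof
      assume "p \<in> upper r C (Suc 0) D"
      then show ?thesis using upper_mono[of D "insert {y} D" r C "Suc 0"] by blast
    next
      assume "p \<in> (\<lambda>u. {u, y}) ` ?N"
      then obtain u where u: "{u} \<in> D" "u mod r \<noteq> y mod r" "p = {u, y}" by blast
      have "u \<noteq> y" using u by blast
      have "insert y {u} \<in> rainbow r C (Suc (Suc 0))"
        by (rule rainbow_insert) (use D u y in auto)
      then have "p \<in> rainbow r C (Suc (Suc 0))" using u(3) by (simp add: insert_commute)
      moreover have "p - {u} = {y}" "p - {y} = {u}" using u(3) \<open>u \<noteq> y\<close> by auto
      ultimately show ?thesis using u by (auto simp: upper_def)
    qed
  qed
  moreover have "upper r C (Suc 0) D \<inter> (\<lambda>u. {u, y}) ` ?N = {}"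
  proof (rule ccontr)
    assume "upper r C (Suc 0) D \<inter> (\<lambda>u. {u, y}) ` ?N \<noteq> {}"
    then obtain u where u: "u mod r \<noteq> y mod r" "{u, y} \<in> upper r C (Suc 0) D" by blast
    then have "{u, y} - {u} \<in> D" "u \<noteq> y" using mem_upperD(2)[OF u(2), of u] by auto
    then show False using y(2) by (simp add: insert_Diff_if)
  qed
  moreover have "inj_on (\<lambda>u. {u, y}) ?N"
    by (rule inj_onI) (metis doubleton_eq_iff)
  moreover have "finite (upper r C (Suc 0) D)" using finite_upper[OF D(2,1)] by simp
  moreover have "finite ?N"
  proof (rule finite_imageD[of "\<lambda>u. {u}"])
    show "finite ((\<lambda>u. {u}) ` ?N)" by (rule finite_subset[OF _ D(2)]) auto
  qed (auto intro: inj_onI)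
  ultimately show ?thesis by (simp add: card_Un_disjoint card_image)
qed

text \<open>The comparison of weights requires sets with two elements, so this case is settled by
  degrees in a complete multipartite graph: here the minimal family itself turns out to be
  initial.\<close>

lemma colex_optimal_1:
  assumes r: "r > 0"
  shows "colex_optimal r C (Suc 0)"
  unfolding colex_optimal_def
proof (intro allI impI)
  fix A assume A: "A \<subseteq> rainbow r C (Suc 0)" "finite A"
  obtain B where B: "B \<subseteq> rainbow r C (Suc 0)" "finite B" "card B = card A"
    "card (upper r C (Suc 0) A) \<le> card (upper r C (Suc 0) B)"
    "\<And>B'. B' \<subseteq> rainbow r C (Suc 0) \<Longrightarrow> finite B' \<Longrightarrow> card B' = card B \<Longrightarrow>
      card (upper r C (Suc 0) B) \<le> card (upper r C (Suc 0) B') \<Longrightarrow> sum set_encode B \<le> sum set_encode B'"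
    using obtain_encode_minimal[OF A] by metis
  let ?n = "\<lambda>y c. {u. {u} \<in> B - {{y}} \<and> u mod r = c}"
  have finV: "finite {u. {u} \<in> B}"
  proof (rule finite_imageD[of "\<lambda>u. {u}"])
    show "finite ((\<lambda>u. {u}) ` {u. {u} \<in> B})" by (rule finite_subset[OF _ B(2)]) auto
  qed (auto intro: inj_onI)
  \<comment> \<open>If exchanging \<open>y\<close> for the smaller \<open>x\<close> did not lose
    edges, it would contradict minimality. So \<open>x\<close> has smaller degree over
    \<open>B - {{y}}\<close>, that is, more members of its own colour. For \<open>x\<close> and
    \<open>y\<close> of equal colour this is impossible: within a colour the members are
    initial.\<close>
  have swap: "card (?n y (x mod r)) > card (?n y (y mod r))"
    if x: "x mod r \<in> C" "{x} \<notin> B" and y: "{y} \<in> B" and xy: "x < y" for x y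
  proof (rule ccontr)
    assume "\<not> ?thesis"
    then have le: "card (?n y (x mod r)) \<le> card (?n y (y mod r))" by simp
    let ?D = "B - {{y}}"
    have D: "?D \<subseteq> rainbow r C (Suc 0)" "finite ?D" using B by auto
    have yC: "y mod r \<in> C" using rainbow_colour[of "{y}" r C "Suc 0" y] B(1) y by auto
    have cmp: "card {u. {u} \<in> ?D \<and> u mod r \<noteq> c} = card {u. {u} \<in> ?D} - card (?n y c)" for c
    proof -
      have "{u. {u} \<in> ?D \<and> u mod r \<noteq> c} = {u. {u} \<in> ?D} - ?n y c" by blast
      moreover have "finite (?n y c)" by (rule finite_subset[OF _ finV]) blast
      ultimately show ?thesis by (simp add: card_Diff_subset Collect_mono)
    qed
    have "card (upper r C (Suc 0) (insert {y} ?D)) \<le> card (upper r C (Suc 0) (insert {x} ?D))"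
      using card_upper_insert_singleton[OF D, of y] card_upper_insert_singleton[OF D, of x] x yC le
      unfolding cmp by simp
    then have "card (upper r C (Suc 0) B) \<le> card (upper r C (Suc 0) (insert {x} ?D))"
      using y by (simp add: insert_absorb)
    moreover have "insert {x} ?D \<subseteq> rainbow r C (Suc 0)"
      using D(1) x by (simp add: rainbow_def)
    moreover have "card (insert {x} ?D) = card B"
      using card_Suc_Diff1[OF B(2) y] B(2) x by simp
    moreover have "sum set_encode (insert {x} ?D) < sum set_encode B"
    proof -
      have "sum set_encode (insert {x} ?D) = set_encode {x} + sum set_encode ?D"
        using B(2) x by simp
      moreover have "sum set_encode B = set_encode {y} + sum set_encode ?D"
        using sum.remove[OF B(2) y, of set_encode] .
      moreover have "set_encode {x} < set_encode {y}"
        using set_encode_less_of_max_less[of "{x}" "{y}" y] xy by simp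
      ultimately show ?thesis by simp
    qed
    ultimately show False using B(5)[of "insert {x} ?D"] D(2) by simp
  qed
  have "colex_initial r C (Suc 0) B"
    unfolding colex_initial_def
  proof (intro conjI ballI impI B(1,2))
    fix x' y' assume x': "x' \<in> rainbow r C (Suc 0)" and y': "y' \<in> B" and le: "set_encode x' \<le> set_encode y'"
    obtain x where x: "x' = {x}" using x' by (auto simp: rainbow_def card_1_singleton_iff)
    obtain y where y: "y' = {y}" using y' B(1) by (auto simp: rainbow_def card_1_singleton_iff)
    show "x' \<in> B"
    proof (rule ccontr)
      assume n: "x' \<notin> B"
      have xC: "x mod r \<in> C" using rainbow_colour[OF x'] x by simp
      have "x \<noteq> y" using n y' x y by auto
      moreover have "\<not> y < x" using set_encode_less_of_max_less[of "{y}" "{x}" x] le x y by auto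
      ultimately have xy: "x < y" by simp
      have yC: "y mod r \<in> C" using rainbow_colour[of "{y}" r C "Suc 0" y] B(1) y y' by auto
      \<comment> \<open>A member \<open>u\<close> of the colour of \<open>x\<close> lies below
        \<open>x\<close>, hence in an earlier block than \<open>y\<close>. Its block also contains a
        number of the colour of \<open>y\<close>; it is below \<open>y\<close> and therefore a
        member. The resulting injection contradicts \<open>swap\<close>.\<close>
      have "card (?n y (x mod r)) \<le> card (?n y (y mod r))"
      proof (rule card_inj_on_le)
        let ?f = "\<lambda>u. y mod r + (u div r) * r"
        show "inj_on ?f (?n y (x mod r))"
        proof (rule inj_onI)
          fix u u' assume *: "u \<in> ?n y (x mod r)" "u' \<in> ?n y (x mod r)" "?f u = ?f u'"
          have "u div r = u' div r" using *(3) r by simp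
          moreover have "u mod r = u' mod r" using *(1,2) by simp
          ultimately show "u = u'" by (metis div_mult_mod_eq)
        qed
        show "?f ` ?n y (x mod r) \<subseteq> ?n y (y mod r)"
        proof
          fix w assume "w \<in> ?f ` ?n y (x mod r)"
          then obtain u where u: "{u} \<in> B" "u \<noteq> y" "u mod r = x mod r" "w = ?f u" by blast
          have "\<not> x < u" using swap[of x u] xC n x u by auto
          moreover have "u \<noteq> x" using u n x by blast
          ultimately have "u + r \<le> x" using add_le_of_cong_less[of u x r] u(3) by simp
          then have "u + r < y" using xy by simp
          then have "(u + r) div r \<le> y div r" by (intro div_le_mono) simp
          then have dl: "u div r < y div r" using r by simp
          have "w < y"
          proof -
            have "w < (u div r) * r + r" using u(4) r by simp
            also have "\<dots> = (Suc (u div r)) * r" by simp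
            also have "\<dots> \<le> (y div r) * r" using dl by (intro mult_le_mono1) simp
            also have "\<dots> \<le> y" by (simp add: div_times_less_eq_dividend)
            finally show ?thesis .
          qed
          moreover have wm: "w mod r = y mod r" using u(4) by simp
          ultimately have "{w} \<in> B"
            using swap[of w y] yC y y' by auto
          then show "w \<in> ?n y (y mod r)" using \<open>w < y\<close> wm by auto
        qed
        show "finite (?n y (y mod r))" by (rule finite_subset[OF _ finV]) blast
      qed
      then show False using swap[of x y] xC n x y y' xy by simp
    qed
  qed
  then have "colex_bound r C (Suc 0) (card A) = card (upper r C (Suc 0) B)"
    using colex_bound_eq[of r C "Suc 0" B] B(3) by simp
  then show "card (upper r C (Suc 0) A) \<le> colex_bound r C (Suc 0) (card A)"
    using B(4) by simp
qed

lemma colex_optimal: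
  assumes "r > 0" "finite C" "k > 0"
  shows "colex_optimal r C k"
  using assms(2,3)
proof (induction "card C" arbitrary: C k)
  case 0
  then have C: "C = {}" by simp
  have "card (upper r C k A) \<le> colex_bound r C k (card A)" if "A \<subseteq> rainbow r C k" for A
  proof -
    have "upper r C k A = {}" using rainbow_empty[of "Suc k" r] C by (auto simp: upper_def)
    then show ?thesis by simp
  qed
  then show ?case by (simp add: colex_optimal_def)
next
  case (Suc n)
  show ?case
  proof (cases "k = 1")
    case True
    then show ?thesis using colex_optimal_1[OF assms(1)] by simp
  next
    case False
    then obtain j where "k = Suc j" "j > 0" using Suc.prems by (cases k) auto
    moreover have "colex_optimal r (C - {c}) i" if "c \<in> C" "i > 0" for c i
      using Suc.hyps(1)[of "C - {c}" i] Suc.hyps(2) Suc.prems that by simp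
    ultimately show ?thesis using colex_optimal_Suc_Suc[OF assms(1)] by blast
  qed
qed

lemma card_upper_le_colex_bound:
  assumes "r > 0" "finite C" "k > 0" "A \<subseteq> rainbow r C k" "finite A"
  shows "card (upper r C k A) \<le> colex_bound r C k (card A)"
  using colex_optimal[OF assms(1-3)] assms(4,5) by (simp add: colex_optimal_def)

end

section \<open>From graphs to rainbow families\<close>

definition neighbours :: "'a set set \<Rightarrow> 'a set \<Rightarrow> 'a \<Rightarrow> 'a set" where
  "neighbours E V v = {u \<in> V. u \<noteq> v \<and> {u, v} \<in> E}"

lemma neighbours_subset: "neighbours E V v \<subseteq> V"
  by (auto simp: neighbours_def)

section \<open>Counting cliques by removing vertices\<close>

lemma num_cliques_0: "num_cliques V E 0 = 1"
proof -
  have "{K \<in> [V]\<^bsup>0\<^esup>. clique K E} = {{}}" by (auto simp: nsets_def clique_def)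
  then show ?thesis by (simp add: num_cliques_def)
qed

lemma finite_cliques: "finite V \<Longrightarrow> finite {K \<in> [V]\<^bsup>k\<^esup>. clique K E}"
  by (rule finite_subset[of _ "Pow V"]) (auto simp: nsets_def)

lemma num_cliques_mono:
  assumes "finite W" "V \<subseteq> W"
  shows "num_cliques V E k \<le> num_cliques W E k"
  unfolding num_cliques_def
  by (rule card_mono[OF finite_cliques[OF assms(1)]]) (use assms(2) in \<open>auto simp: nsets_def\<close>)

lemma num_cliques_clique:
  assumes "finite K" "clique K E"
  shows "num_cliques K E k = card K choose k"
proof -
  have "{L \<in> [K]\<^bsup>k\<^esup>. clique L E} = {L. L \<subseteq> K \<and> card L = k}"
    using assms finite_subset[of _ K] by (auto simp: nsets_def clique_def)
  then show ?thesis using n_subsets[OF assms(1), of k] by (simp add: num_cliques_def)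
qed

lemma num_cliques_eq_0:
  assumes "\<And>K. K \<subseteq> V \<Longrightarrow> finite K \<Longrightarrow> card K = k \<Longrightarrow> \<not> clique K E"
  shows "num_cliques V E k = 0"
proof -
  have "{K \<in> [V]\<^bsup>k\<^esup>. clique K E} = {}" using assms by (auto simp: nsets_def)
  then show ?thesis by (simp only: num_cliques_def card.empty)
qed

lemma num_cliques_le_binomial:
  assumes "finite V"
  shows "num_cliques V E k \<le> card V choose k"
proof -
  have "card {K \<in> [V]\<^bsup>k\<^esup>. clique K E} \<le> card {K. K \<subseteq> V \<and> card K = k}"
    using assms by (intro card_mono) (auto simp: nsets_def)
  then show ?thesis using n_subsets[OF assms, of k] by (simp add: num_cliques_def)
qed

lemma num_cliques_insert:
  assumes "finite V" "v \<notin> V"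
  shows "num_cliques (insert v V) E (Suc j) = num_cliques V E (Suc j) + num_cliques (neighbours E V v) E j"
proof -
  let ?N = "neighbours E V v"
  let ?P = "{K \<in> [V]\<^bsup>Suc j\<^esup>. clique K E}" and ?Q = "{K \<in> [?N]\<^bsup>j\<^esup>. clique K E}"
  have "{K \<in> [insert v V]\<^bsup>Suc j\<^esup>. clique K E} = ?P \<union> insert v ` ?Q"
  proof (rule set_eqI, rule iffI)
    fix K assume K: "K \<in> {K \<in> [insert v V]\<^bsup>Suc j\<^esup>. clique K E}"
    show "K \<in> ?P \<union> insert v ` ?Q"
    proof (cases "v \<in> K")
      case True
      have "K - {v} \<subseteq> ?N" using K True by (auto simp: nsets_def clique_def neighbours_def)
      then have "K - {v} \<in> ?Q" using K True by (auto simp: nsets_def clique_def)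
      moreover have "K = insert v (K - {v})" using True by blast
      ultimately show ?thesis by blast
    next
      case False
      then have "K \<in> ?P" using K by (auto simp: nsets_def)
      then show ?thesis by blast
    qed
  next
    fix K assume "K \<in> ?P \<union> insert v ` ?Q"
    then show "K \<in> {K \<in> [insert v V]\<^bsup>Suc j\<^esup>. clique K E}"
    proof
      assume "K \<in> insert v ` ?Q"
      then obtain L where L: "K = insert v L" "L \<subseteq> ?N" "finite L" "card L = j" "clique L E"
        by (auto simp: nsets_def)
      have "v \<notin> L" using L(2) by (auto simp: neighbours_def)
      moreover have "clique K E"
        unfolding clique_def L(1)
      proof (intro ballI impI)
        fix a b assume ab: "a \<in> insert v L" "b \<in> insert v L" "a \<noteq> b"
        show "{a, b} \<in> E"
        proof (cases "a = v \<or> b = v")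
          case True
          then show ?thesis using ab L(2) by (auto simp: neighbours_def insert_commute)
        next
          case False
          then show ?thesis using ab L(5) by (auto simp: clique_def)
        qed
      qed
      moreover have "L \<subseteq> V" using L(2) by (auto simp: neighbours_def)
      ultimately show ?thesis using L by (auto simp: nsets_def)
    qed (auto simp: nsets_def)
  qed
  moreover have "?P \<inter> insert v ` ?Q = {}" using assms(2) by (auto simp: nsets_def)
  moreover have "inj_on (insert v) ?Q"
  proof (rule inj_onI)
    fix K L assume "K \<in> ?Q" "L \<in> ?Q" "insert v K = insert v L"
    moreover from this have "v \<notin> K" "v \<notin> L" by (auto simp: nsets_def neighbours_def)
    ultimately show "K = L" by (metis insert_ident)
  qed
  moreover have "finite ?P" "finite ?Q"
    using finite_cliques[OF assms(1)] finite_cliques[OF finite_subset[OF neighbours_subset assms(1)]] by auto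
  ultimately show ?thesis unfolding num_cliques_def
    by (simp add: card_Un_disjoint card_image)
qed

text \<open>\<open>N a\<close> is the neighbourhood of \<open>a\<close> in what is left when the
  vertices of \<open>A\<close> are removed one at a time, so each clique not inside \<open>B\<close>
  is counted at its first removed vertex. One choice of \<open>N\<close> serves all
  \<open>j\<close>, because counts at consecutive levels are compared.\<close>

lemma num_cliques_decompose:
  assumes "finite A" "finite B" "A \<inter> B = {}"
  shows "\<exists>N. (\<forall>a\<in>A. N a \<subseteq> neighbours E (A \<union> B) a) \<and>
    (\<forall>j. num_cliques (A \<union> B) E (Suc j) = num_cliques B E (Suc j) + (\<Sum>a\<in>A. num_cliques (N a) E j))"
  using assms(1,3)
proof (induction A rule: finite_induct)
  case empty
  then show ?case by simp
next
  case (insert x A)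
  then obtain N where N: "\<And>a. a \<in> A \<Longrightarrow> N a \<subseteq> neighbours E (A \<union> B) a"
    "\<And>j. num_cliques (A \<union> B) E (Suc j) = num_cliques B E (Suc j) + (\<Sum>a\<in>A. num_cliques (N a) E j)"
    by auto
  define N' where "N' = N(x := neighbours E (A \<union> B) x)"
  have "N' a \<subseteq> neighbours E (insert x A \<union> B) a" if "a \<in> insert x A" for a
    using N(1)[of a] that insert.hyps by (auto simp: N'_def neighbours_def)
  moreover have "num_cliques (insert x A \<union> B) E (Suc j)
      = num_cliques B E (Suc j) + (\<Sum>a\<in>insert x A. num_cliques (N' a) E j)" for j
  proof -
    have "x \<notin> A \<union> B" "finite (A \<union> B)" using insert assms(2) by auto
    then have "num_cliques (insert x (A \<union> B)) E (Suc j)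
        = num_cliques (A \<union> B) E (Suc j) + num_cliques (neighbours E (A \<union> B) x) E j"
      using num_cliques_insert by metis
    moreover have "(\<Sum>a\<in>A. num_cliques (N' a) E j) = (\<Sum>a\<in>A. num_cliques (N a) E j)"
      by (rule sum.cong) (use insert.hyps in \<open>auto simp: N'_def\<close>)
    ultimately show ?thesis using N(2)[of j] insert.hyps by (simp add: N'_def)
  qed
  ultimately show ?case by blast
qed

lemma clique_insert_neighbours:
  assumes "K \<subseteq> neighbours E V v" "finite K" "clique K E" "v \<in> V"
  shows "clique (insert v K) E" "card (insert v K) = Suc (card K)" "insert v K \<subseteq> V"
proof -
  have K: "{u, v} \<in> E" "{v, u} \<in> E" "u \<noteq> v" "u \<in> V" if "u \<in> K" for u
    using assms(1) that by (auto simp: neighbours_def insert_commute)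
  then show "clique (insert v K) E" using assms(3) unfolding clique_def by blast
  show "card (insert v K) = Suc (card K)" using K assms(2) by (metis card_insert_disjoint)
  show "insert v K \<subseteq> V" using K assms(4) by blast
qed

text \<open>Neighbourhoods have smaller cliques, so they fit into one colour less. Replacing the
  families found there by initial segments makes them nested: the cone over \<open>Y a\<close> then
  contributes the smaller of \<open>card (upper r D j (Y a))\<close> and \<open>card X\<close>, and
  the choice of \<open>v\<close> makes \<open>X\<close> large enough for all vertices at
  once.\<close>

theorem rainbow_family_of_graph:
  assumes r: "r > 0" and "C \<subseteq> {..<r}" "finite V" "k > 0"
    and "\<And>K. K \<subseteq> V \<Longrightarrow> clique K E \<Longrightarrow> card K \<le> card C"
  shows "\<exists>A. A \<subseteq> rainbow r C k \<and> finite A \<and> card A = num_cliques V E k \<and>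
    num_cliques V E (Suc k) \<le> card (upper r C k A)"
  using assms(2-)
proof (induction "card C" arbitrary: C V k)
  case 0
  have "V = {}"
  proof (rule ccontr)
    assume "V \<noteq> {}"
    then obtain v where "v \<in> V" by blast
    then have "card {v} \<le> card C" using "0.prems"(4)[of "{v}"] by (auto simp: clique_def)
    then show False using 0 by simp
  qed
  then have "num_cliques V E i = 0" if "i > 0" for i
    by (intro num_cliques_eq_0) (use that in auto)
  then show ?case using 0 by (intro exI[of _ "{}"]) simp
next
  case (Suc n)
  obtain j where j: "k = Suc j" using Suc.prems by (cases k) auto
  show ?case
  proof (cases "V = {}")
    case True
    then have "num_cliques V E i = 0" if "i > 0" for i
      by (intro num_cliques_eq_0) (use that in auto)
    then show ?thesis using Suc.prems by (intro exI[of _ "{}"]) simp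
  next
    case False
    \<comment> \<open>The k-cliques in the neighbourhood of \<open>v\<close> correspond to the (k +
      1)-cliques through \<open>v\<close>.\<close>
    let ?f = "\<lambda>v. num_cliques (neighbours E V v) E k"
    obtain v where v: "v \<in> V" "\<And>u. u \<in> V \<Longrightarrow> ?f u \<le> ?f v"
    proof -
      have "\<exists>v\<in>V. ?f v = Max (?f ` V)"
        using Max_in[of "?f ` V"] False Suc.prems(2) by fastforce
      then show ?thesis using that Suc.prems(2) by (metis Max_ge finite_imageI imageI)
    qed
    have finC: "finite C" using Suc.prems(1) finite_subset by blast
    define B where "B = neighbours E V v"
    define A where "A = V - B"
    have V: "V = A \<union> B" "A \<inter> B = {}" using neighbours_subset[of E V v] by (auto simp: A_def B_def)
    have fin: "finite A" "finite B" using V(1) Suc.prems(2) by auto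
    obtain N where N: "\<And>a. a \<in> A \<Longrightarrow> N a \<subseteq> neighbours E V a"
      "\<And>j. num_cliques V E (Suc j) = num_cliques B E (Suc j) + (\<Sum>a\<in>A. num_cliques (N a) E j)"
      using num_cliques_decompose[OF fin V(2)] V(1) by metis
    obtain c where c: "c \<in> C" using Suc.hyps(2) by fastforce
    define D where "D = C - {c}"
    have D: "card D = n" "D \<subseteq> {..<r}" "finite D" using Suc c finC by (auto simp: D_def)
    have small: "card K \<le> card D" if "u \<in> V" "K \<subseteq> neighbours E V u" "clique K E" for u K
    proof -
      have fK: "finite K" using that(2) neighbours_subset Suc.prems(2) by (meson finite_subset)
      show ?thesis
        using Suc.prems(4)[of "insert u K"] clique_insert_neighbours[OF that(2) fK that(3,1)] Suc.hyps(2) D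
        by simp
    qed
    have IH: "\<exists>A. A \<subseteq> rainbow r D i \<and> finite A \<and> card A = num_cliques W E i \<and>
        num_cliques W E (Suc i) \<le> card (upper r D i A)"
      if "u \<in> V" "W \<subseteq> neighbours E V u" "i > 0" for u W i
    proof (rule Suc.hyps(1))
      show "n = card D" "D \<subseteq> {..<r}" "i > 0" using D that by auto
      show "finite W" using that(2) finite_subset[OF neighbours_subset Suc.prems(2)] finite_subset by blast
      show "card K \<le> card D" if "K \<subseteq> W" "clique K E" for K
        using small[OF \<open>u \<in> V\<close>, of K] that \<open>W \<subseteq> neighbours E V u\<close> by blast
    qed
    have init: "\<exists>A. colex_initial r D i A \<and> card A = num_cliques W E i \<and>
        num_cliques W E (Suc i) \<le> card (upper r D i A)"
      if u: "u \<in> V" "W \<subseteq> neighbours E V u" "i > 0" for u W i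
    proof -
      obtain A where A: "A \<subseteq> rainbow r D i" "finite A" "card A = num_cliques W E i"
        "num_cliques W E (Suc i) \<le> card (upper r D i A)" using IH[OF u] by blast
      have "num_cliques W E (Suc i) \<le> card (upper r D i (segment r D i (card A)))"
        using card_upper_le_colex_bound[OF r D(3) u(3) A(1,2)] A(4) by (simp add: colex_bound_def)
      then show ?thesis using segment_initial[OF A(1,2) order_refl] A(3) by metis
    qed
    obtain X where X: "colex_initial r D k X" "card X = num_cliques B E k"
      "num_cliques B E (Suc k) \<le> card (upper r D k X)"
      using init[OF v(1), of B k] Suc.prems(3) B_def by blast
    have X': "X \<subseteq> rainbow r D (Suc j)" "finite X" using X(1) j by (auto simp: colex_initial_def)
    have "\<exists>Y. Y \<subseteq> rainbow r D j \<and> finite Y \<and> card Y = num_cliques (N a) E j \<and>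
        num_cliques (N a) E (Suc j) \<le> card (upper r D j Y \<inter> X)" if a: "a \<in> A" for a
    proof -
      have aV: "a \<in> V" using a V by blast
      have "num_cliques (N a) E k \<le> ?f a"
        by (rule num_cliques_mono) (use N(1)[OF a] finite_subset[OF neighbours_subset Suc.prems(2)] in auto)
      also have "\<dots> \<le> card X" using v(2)[OF aV] X(2) B_def by simp
      finally have le: "num_cliques (N a) E (Suc j) \<le> card X" using j by simp
      show ?thesis
      \<comment> \<open>There is one 0-clique, and the upper family of \<open>{{}}\<close> contains
        every rainbow singleton, in particular all of \<open>X\<close>.\<close>
      proof (cases "j = 0")
        case True
        have "X \<subseteq> upper r D j {{}}"
          using X' True rainbow_Diff[of _ r D j] by (auto simp: upper_def rainbow_0)
        then have "upper r D j {{}} \<inter> X = X" by blast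
        then show ?thesis using le True num_cliques_0[of "N a" E]
          by (intro exI[of _ "{{}}"]) (simp add: rainbow_0)
      next
        case False
        then obtain Y where Y: "colex_initial r D j Y" "card Y = num_cliques (N a) E j"
          "num_cliques (N a) E (Suc j) \<le> card (upper r D j Y)"
          using init[OF aV N(1)[OF a], of j] by blast
        have "card (upper r D j Y \<inter> X) = min (card (upper r D j Y)) (card X)"
          using colex_initial_Int[OF colex_initial_upper[OF Y(1)]] X(1) j False by simp
        then show ?thesis using Y le by (intro exI[of _ Y]) (auto simp: colex_initial_def)
      qed
    qed
    then obtain Y where Y: "\<And>a. a \<in> A \<Longrightarrow> Y a \<subseteq> rainbow r D j" "\<And>a. a \<in> A \<Longrightarrow> finite (Y a)"
      "\<And>a. a \<in> A \<Longrightarrow> card (Y a) = num_cliques (N a) E j"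
      "\<And>a. a \<in> A \<Longrightarrow> num_cliques (N a) E (Suc j) \<le> card (upper r D j (Y a) \<inter> X)"
      by metis
    obtain g :: "'a \<Rightarrow> nat" where g: "inj_on g A"
      using finite_imp_inj_to_nat_seg[OF fin(1)] by blast
    \<comment> \<open>Distinct vertices of the new colour \<open>c\<close>, one for each member of
      \<open>A\<close>.\<close>
    define h where "h = (\<lambda>a. c + g a * r)"
    have inj: "inj_on h A" using g r by (auto simp: inj_on_def h_def)
    have cr: "c < r" using c Suc.prems(1) by blast
    define S where "S = h ` A"
    define Z where "Z = (\<lambda>s. Y (inv_into A h s))"
    have Zh: "Z (h a) = Y a" if "a \<in> A" for a using inj that by (simp add: Z_def)
    have S: "finite S" "\<And>s. s \<in> S \<Longrightarrow> s mod r = c" using fin cr by (auto simp: S_def h_def)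
    have Z: "Z s \<subseteq> rainbow r (C - {c}) j" "finite (Z s)" if "s \<in> S" for s
      using that Zh Y unfolding S_def D_def by auto
    note X'' = X'[unfolded D_def]
    show ?thesis
    proof (intro exI[of _ "glue S X Z"] conjI)
      show "glue S X Z \<subseteq> rainbow r C k" using glue_rainbow[where Y = Z, OF c S(2) X''(1) Z(1)] j by simp
      show "finite (glue S X Z)" using S X'' Z by (simp add: glue_def)
      have "card (glue S X Z) = card X + (\<Sum>s\<in>S. card (Z s))"
        using card_glue[where Y = Z, OF S(1,2) X'' Z] by simp
      also have "(\<Sum>s\<in>S. card (Z s)) = (\<Sum>a\<in>A. num_cliques (N a) E j)"
        unfolding S_def using Zh Y(3) by (simp add: sum.reindex[OF inj])
      finally show "card (glue S X Z) = num_cliques V E k" using N(2)[of j] X(2) j by simp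
      have "num_cliques V E (Suc k) \<le> card (upper r D k X) + (\<Sum>a\<in>A. card (upper r D j (Y a) \<inter> X))"
        unfolding N(2)[of k] using X(3) Y(4) j by (intro add_mono sum_mono) auto
      also have "(\<Sum>a\<in>A. card (upper r D j (Y a) \<inter> X)) = (\<Sum>s\<in>S. card (upper r D j (Z s) \<inter> X))"
        unfolding S_def using Zh by (simp add: sum.reindex[OF inj])
      also have "card (upper r D k X) + \<dots> \<le> card (upper r C k (glue S X Z))"
        using card_upper_glue[where Y = Z, OF c S(1,2) X'' Z] j by (simp add: D_def)
      finally show "num_cliques V E (Suc k) \<le> card (upper r C k (glue S X Z))" .
    qed
  qed
qed

corollary num_cliques_le_colex_bound:
  assumes "r > 0" "C \<subseteq> {..<r}" "finite V" "k > 0"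
    and "\<And>K. K \<subseteq> V \<Longrightarrow> clique K E \<Longrightarrow> card K \<le> card C"
  shows "num_cliques V E (Suc k) \<le> colex_bound r C k (num_cliques V E k)"
proof -
  obtain A where A: "A \<subseteq> rainbow r C k" "finite A" "card A = num_cliques V E k"
    "num_cliques V E (Suc k) \<le> card (upper r C k A)"
    using rainbow_family_of_graph[OF assms] by blast
  then show ?thesis
    using card_upper_le_colex_bound[OF assms(1) _ assms(4) A(1,2)] finite_subset[OF assms(2)] by simp
qed

section \<open>Turan numbers\<close>

text \<open>Renumbers the vertices with colour in \<open>C\<close> consecutively. They run through
  \<open>C\<close> cyclically, so for \<open>C\<close> inside \<open>{..<r}\<close> positions modulo
  \<open>card C\<close> separate exactly the colours.\<close>

definition position :: "nat \<Rightarrow> nat set \<Rightarrow> nat \<Rightarrow> nat" where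
  "position r C v = card {u. u < v \<and> u mod r \<in> C}"

definition below :: "nat \<Rightarrow> nat set \<Rightarrow> nat \<Rightarrow> nat \<Rightarrow> nat set set" where
  "below r C k v = {z \<in> rainbow r C k. z \<subseteq> {..<v}}"

context
  fixes r :: nat
  assumes r: "r > 0"
begin

lemma position_0: "position r C 0 = 0"
  by (simp add: position_def)

lemma position_Suc: "position r C (Suc v) = position r C v + (if v mod r \<in> C then 1 else 0)"
proof -
  have "{u. u < Suc v \<and> u mod r \<in> C}
      = {u. u < v \<and> u mod r \<in> C} \<union> (if v mod r \<in> C then {v} else {})"
    by (auto simp: less_Suc_eq)
  then show ?thesis unfolding position_def by (simp add: card_insert_if)
qed

lemma position_mono: "u \<le> v \<Longrightarrow> position r C u \<le> position r C v"
  unfolding position_def by (rule card_mono) auto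

lemma position_less:
  assumes "u < v" "u mod r \<in> C"
  shows "position r C u < position r C v"
  using position_Suc[of C u] position_mono[of "Suc u" v C] assms by simp

lemma position_modulus:
  assumes "C \<subseteq> {..<r}"
  shows "position r C r = card C"
proof -
  have "{u. u < r \<and> u mod r \<in> C} = C" using assms by auto
  then show ?thesis by (simp add: position_def)
qed

lemma position_add: "position r C (v + r) = position r C v + position r C r"
proof (induction v)
  case (Suc v)
  then show ?case by (simp add: position_Suc)
qed (simp add: position_0)

lemma position_div_mod:
  assumes "C \<subseteq> {..<r}"
  shows "position r C v = (v div r) * card C + position r C (v mod r)"
proof (induction v rule: less_induct)
  case (less v)
  show ?case
  proof (cases "v < r")
    case False
    then have "position r C v = position r C (v - r) + card C"
      using position_add[of C "v - r"] position_modulus[OF assms] by simp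
    then show ?thesis using less[of "v - r"] False r le_div_geq[of r v] le_mod_geq[of r v] by simp
  qed simp
qed

lemma position_residue:
  assumes "C \<subseteq> {..<r}" "v mod r \<in> C"
  shows "position r C (v mod r) < card C"
    and "position r C v div card C = v div r" "position r C v mod card C = position r C (v mod r)"
proof -
  show *: "position r C (v mod r) < card C"
    using position_less[of "v mod r" r C] position_modulus[OF assms(1)] assms(2) r by simp
  show "position r C v div card C = v div r" "position r C v mod card C = position r C (v mod r)"
    unfolding position_div_mod[OF assms(1), of v] using * by auto
qed

lemma position_colour: "v mod r = c \<Longrightarrow> position r {c} v = v div r"
proof -
  assume c: "v mod r = c"
  have "{u. u < c \<and> u mod r \<in> {c}} = {}"
  proof -
    have "u mod r \<noteq> c" if "u < c" for u using that by (metis mod_less_eq_dividend not_less)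
    then show ?thesis by auto
  qed
  then have "position r {c} c = 0" unfolding position_def by (metis card.empty)
  then show ?thesis using position_div_mod[of "{c}" v] c r by auto
qed

text \<open>Of the first \<open>p\<close> vertices coloured in \<open>C\<close>, exactly
  \<open>p div card C\<close> share the colour of the next one. This is the origin of
  \<open>b - b div q\<close> in \<open>turan_rep\<close>.\<close>

lemma position_remove:
  assumes "C \<subseteq> {..<r}" "v mod r \<in> C"
  shows "position r (C - {v mod r}) v = position r C v - position r C v div card C"
proof -
  let ?c = "v mod r"
  have "{u. u < v \<and> u mod r \<in> C} = {u. u < v \<and> u mod r \<in> C - {?c}} \<union> {u. u < v \<and> u mod r \<in> {?c}}"
    using assms(2) by auto
  moreover have "card ({u. u < v \<and> u mod r \<in> C - {?c}} \<union> {u. u < v \<and> u mod r \<in> {?c}})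
      = position r (C - {?c}) v + position r {?c} v"
    unfolding position_def by (rule card_Un_disjoint) auto
  ultimately have "position r C v = position r (C - {?c}) v + position r {?c} v"
    unfolding position_def[of r C] by simp
  then show ?thesis using position_colour[of v ?c] position_residue(2)[OF assms] by simp
qed

lemma ex_position:
  assumes "C \<subseteq> {..<r}" "C \<noteq> {}"
  obtains v where "v mod r \<in> C" "position r C v = n"
proof -
  have "card C > 0" using assms finite_subset[OF assms(1)] by (simp add: card_gt_0_iff)
  \<comment> \<open>Every block of \<open>r\<close> numbers contributes \<open>card C > 0\<close>
    positions, so all positions occur.\<close>
  then have "position r C (Suc n * r) \<ge> Suc n"
    using position_div_mod[OF assms(1), of "Suc n * r"] mult_le_mono2[of 1 "card C" "Suc n"] \<open>card C > 0\<close> r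
    by simp
  then have ex: "\<exists>w. position r C w \<ge> Suc n" by blast
  define w where "w = (LEAST w. position r C w \<ge> Suc n)"
  have w: "position r C w \<ge> Suc n" unfolding w_def by (rule LeastI_ex[OF ex])
  then have "w \<noteq> 0" by (metis position_0 Suc_n_not_le_n le0 le_trans not_less_eq_eq)
  then obtain v where v: "w = Suc v" by (cases w) auto
  have "\<not> position r C v \<ge> Suc n" using not_less_Least[of v "\<lambda>w. position r C w \<ge> Suc n"] v unfolding w_def by simp
  then show ?thesis using that[of v] w v position_Suc[of C v] by (auto split: if_splits)
qed

lemma position_all: "position r {..<r} v = v"
  unfolding position_def using r by simp

end

lemma turan_binom_alt:
  "turan_binom q n k = card {K. K \<subseteq> {..<n} \<and> card K = k \<and> inj_on (\<lambda>v. v mod q) K}"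
proof -
  have "clique K (turan_edges n q) \<longleftrightarrow> inj_on (\<lambda>v. v mod q) K" if "K \<subseteq> {..<n}" for K
  proof -
    have "{u, v} \<in> turan_edges n q \<longleftrightarrow> u mod q \<noteq> v mod q" if "u \<in> K" "v \<in> K" for u v
    proof -
      have "u < n" "v < n" using that \<open>K \<subseteq> _\<close> by auto
      then show ?thesis unfolding turan_edges_def by (auto simp: doubleton_eq_iff)
    qed
    then show ?thesis unfolding clique_def inj_on_def by blast
  qed
  then have "{K \<in> [{..<n}]\<^bsup>k\<^esup>. clique K (turan_edges n q)}
      = {K. K \<subseteq> {..<n} \<and> card K = k \<and> inj_on (\<lambda>v. v mod q) K}"
    using finite_subset[of _ "{..<n}"] by (auto simp: nsets_def)
  then show ?thesis by (simp add: turan_binom_def num_cliques_def)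
qed

text \<open>\<open>position r C\<close> maps the vertices below \<open>v\<close> coloured in
  \<open>C\<close> onto an interval and turns colours into residues modulo \<open>card C\<close>;
  rainbow sets become cliques of the Turan graph.\<close>

lemma card_below:
  assumes r: "r > 0" and C: "C \<subseteq> {..<r}"
  shows "card (below r C k v) = turan_binom (card C) (position r C v) k"
proof -
  let ?W = "{u. u < v \<and> u mod r \<in> C}"
  let ?p = "position r C"
  have inj: "inj_on ?p ?W"
  proof (rule inj_onI)
    fix u u' assume "u \<in> ?W" "u' \<in> ?W" "?p u = ?p u'"
    then show "u = u'"
      using position_less[OF r, of u u' C] position_less[OF r, of u' u C] by (metis (mono_tags) less_irrefl mem_Collect_eq nat_neq_iff)
  qed
  have "?p ` ?W \<subseteq> {..<?p v}" using position_less[OF r] by blast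
  moreover have "card (?p ` ?W) = card {..<?p v}" using card_image[OF inj] by (simp add: position_def)
  ultimately have img: "?p ` ?W = {..<?p v}" by (simp add: card_subset_eq)
  have res: "?p u mod card C = ?p u' mod card C \<longleftrightarrow> u mod r = u' mod r"
    if "u mod r \<in> C" "u' mod r \<in> C" for u u'
  proof
    assume "?p u mod card C = ?p u' mod card C"
    then have "?p (u mod r) = ?p (u' mod r)" using position_residue(3)[OF r C] that by simp
    then show "u mod r = u' mod r"
      using position_less[OF r, of "u mod r" "u' mod r" C] position_less[OF r, of "u' mod r" "u mod r" C] that
      by (metis less_irrefl mod_mod_trivial nat_neq_iff)
  next
    assume "u mod r = u' mod r"
    then show "?p u mod card C = ?p u' mod card C" using position_residue(3)[OF r C] that by simp
  qed
  let ?T = "{K. K \<subseteq> {..<?p v} \<and> card K = k \<and> inj_on (\<lambda>v. v mod card C) K}"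
  have sub: "z \<subseteq> ?W" if "z \<in> below r C k v" for z
    using that rainbow_colour[of z r C k] by (auto simp: below_def)
  have iff: "inj_on (\<lambda>v. v mod card C) (?p ` z) \<longleftrightarrow> inj_on (\<lambda>v. v mod r) z" if z: "z \<subseteq> ?W" for z
  proof -
    have "inj_on ?p z" using inj z inj_on_subset by blast
    then have "inj_on (\<lambda>v. v mod card C) (?p ` z) \<longleftrightarrow> inj_on (\<lambda>u. ?p u mod card C) z"
      using comp_inj_on_iff[of ?p z "\<lambda>v. v mod card C"] by (simp add: comp_def)
    also have "\<dots> \<longleftrightarrow> inj_on (\<lambda>v. v mod r) z"
      unfolding inj_on_def using res z by blast
    finally show ?thesis .
  qed
  have "bij_betw (image ?p) (below r C k v) ?T"
    unfolding bij_betw_def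
  proof
    show "inj_on (image ?p) (below r C k v)"
    proof (rule inj_onI)
      fix z z' assume "z \<in> below r C k v" "z' \<in> below r C k v" "?p ` z = ?p ` z'"
      then show "z = z'" using inj_on_image_eq_iff[OF inj, of z z'] sub by blast
    qed
    show "image ?p ` below r C k v = ?T"
    proof (rule set_eqI, rule iffI)
      fix K assume "K \<in> image ?p ` below r C k v"
      then obtain z where z: "z \<in> below r C k v" "K = ?p ` z" by blast
      have zW: "z \<subseteq> ?W" using sub z by blast
      have "card K = k" using z card_image[OF inj_on_subset[OF inj zW]]
        by (simp add: below_def rainbow_def)
      moreover have "K \<subseteq> {..<?p v}" using img zW z(2) by blast
      moreover have "inj_on (\<lambda>v. v mod card C) K" using iff[OF zW] z by (simp add: below_def rainbow_def)
      ultimately show "K \<in> ?T" by blast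
    next
      fix K assume K: "K \<in> ?T"
      then have "K \<subseteq> ?p ` ?W" using img by simp
      then obtain z where z: "z \<subseteq> ?W" "K = ?p ` z" by (meson subset_imageE)
      have "card z = k" using K z card_image[OF inj_on_subset[OF inj z(1)]] by simp
      moreover have "finite z" using z(1) finite_subset[of z ?W] by simp
      moreover have "inj_on (\<lambda>v. v mod r) z" using iff[OF z(1)] K z(2) by simp
      ultimately have "z \<in> below r C k v" using z(1) by (auto simp: below_def rainbow_def)
      then show "K \<in> image ?p ` below r C k v" using z(2) by blast
    qed
  qed
  then have "card (below r C k v) = card ?T" by (rule bij_betw_same_card)
  then show ?thesis unfolding turan_binom_alt .
qed

context
  fixes r :: nat
  assumes r: "r > 0"
begin

section \<open>Initial segments determined by a largest vertex\<close>

lemma finite_below: "finite (below r C k v)"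
  by (rule finite_subset[of _ "Pow {..<v}"]) (auto simp: below_def)

lemma colex_initial_below: "colex_initial r C k (below r C k v)"
  unfolding colex_initial_def
proof (intro conjI ballI impI finite_below)
  fix x y assume x: "x \<in> rainbow r C k" and y: "y \<in> below r C k v" and le: "set_encode x \<le> set_encode y"
  have "u < v" if u: "u \<in> x" for u
  proof (rule ccontr)
    assume "\<not> u < v"
    then have "set_encode y < set_encode x"
      using set_encode_less_of_max_less[of y x u] y x u rainbow_finite by (force simp: below_def)
    then show False using le by simp
  qed
  then show "x \<in> below r C k v" using x by (auto simp: below_def)
qed (auto simp: below_def)

lemma upper_below: "k > 0 \<Longrightarrow> upper r C k (below r C k v) = below r C (Suc k) v"
proof (rule set_eqI, rule iffI)
  fix p assume k: "k > 0" and p: "p \<in> upper r C k (below r C k v)"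
  have pr: "p \<in> rainbow r C (Suc k)" using mem_upperD(1)[OF p] .
  have "u < v" if u: "u \<in> p" for u
  proof -
    have "card (p - {u}) = k" using pr u by (simp add: rainbow_def)
    then obtain w where w: "w \<in> p - {u}" using k by (metis card.empty ex_in_conv less_irrefl)
    then have "p - {w} \<in> below r C k v" "u \<in> p - {w}" using mem_upperD(2)[OF p] u by auto
    then show ?thesis by (auto simp: below_def)
  qed
  then show "p \<in> below r C (Suc k) v" using pr by (auto simp: below_def)
next
  fix p assume "p \<in> below r C (Suc k) v"
  then show "p \<in> upper r C k (below r C k v)"
    using rainbow_Diff[of p r C k] by (auto simp: below_def upper_def)
qed

lemma colex_bound_below: "k > 0 \<Longrightarrow> colex_bound r C k (card (below r C k v)) = card (below r C (Suc k) v)"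
  using colex_bound_eq[OF colex_initial_below] upper_below by simp

lemma below_Suc:
  assumes "v mod r \<in> C"
  shows "below r C (Suc k) (Suc v) = below r C (Suc k) v \<union> insert v ` below r (C - {v mod r}) k v"
proof (rule set_eqI, rule iffI)
  fix z assume z: "z \<in> below r C (Suc k) (Suc v)"
  show "z \<in> below r C (Suc k) v \<union> insert v ` below r (C - {v mod r}) k v"
  proof (cases "v \<in> z")
    case True
    then have "z - {v} \<in> below r (C - {v mod r}) k v"
      using z rainbow_Diff_colour[of z r C k v] by (auto simp: below_def less_Suc_eq)
    moreover have "z = insert v (z - {v})" using True by blast
    ultimately show ?thesis by blast
  next
    case False
    then have "u < v" if "u \<in> z" for u
      using z that by (metis (mono_tags, lifting) below_def lessThan_iff less_antisym mem_Collect_eq subsetD)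
    then show ?thesis using z by (auto simp: below_def)
  qed
next
  fix z assume "z \<in> below r C (Suc k) v \<union> insert v ` below r (C - {v mod r}) k v"
  then show "z \<in> below r C (Suc k) (Suc v)"
    using rainbow_insert_colour(1)[OF _ assms, of _ k] by (force simp: below_def)
qed

lemma below_insert_disjoint:
  "below r C k v \<inter> insert v ` X = {}"
  by (auto simp: below_def)

lemma inj_on_insert_below:
  "X \<subseteq> below r C k v \<Longrightarrow> inj_on (insert v) X"
proof (rule inj_onI)
  fix z z' assume "X \<subseteq> below r C k v" "z \<in> X" "z' \<in> X" "insert v z = insert v z'"
  moreover from this have "v \<notin> z" "v \<notin> z'" by (auto simp: below_def)
  ultimately show "z = z'" by (metis insert_ident)
qed

lemma card_below_insert:
  assumes "X \<subseteq> below r D k v"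
  shows "card (below r C j v \<union> insert v ` X) = card (below r C j v) + card X"
proof -
  have "finite X" using assms finite_below finite_subset by blast
  then show ?thesis
    using card_Un_disjoint[OF finite_below _ below_insert_disjoint] card_image[OF inj_on_insert_below[OF assms]]
    by simp
qed

text \<open>After the sets below \<open>v\<close> the order continues with the sets whose maximum is
  \<open>v\<close>, arranged as their links in one colour less. This recursion is what Turan
  representations record.\<close>

lemma colex_initial_below_insert:
  assumes v: "v mod r \<in> C" and X: "colex_initial r (C - {v mod r}) k X" "X \<subseteq> below r (C - {v mod r}) k v"
  shows "colex_initial r C (Suc k) (below r C (Suc k) v \<union> insert v ` X)"
  unfolding colex_initial_def
proof (intro conjI ballI impI)
  have sub: "below r C (Suc k) v \<union> insert v ` X \<subseteq> below r C (Suc k) (Suc v)"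
    using below_Suc[OF v] X(2) by blast
  then show "below r C (Suc k) v \<union> insert v ` X \<subseteq> rainbow r C (Suc k)"
    by (auto simp: below_def)
  show "finite (below r C (Suc k) v \<union> insert v ` X)"
    using finite_below X(1) by (auto simp: colex_initial_def)
  fix x y assume x: "x \<in> rainbow r C (Suc k)" and y: "y \<in> below r C (Suc k) v \<union> insert v ` X"
    and le: "set_encode x \<le> set_encode y"
  have "x \<in> below r C (Suc k) (Suc v)"
    using colex_initialD(3)[OF colex_initial_below x _ le] y sub by blast
  then consider "x \<in> below r C (Suc k) v"
    | x' where "x = insert v x'" "x' \<in> below r (C - {v mod r}) k v"
    using below_Suc[OF v] by blast
  then show "x \<in> below r C (Suc k) v \<union> insert v ` X"
  proof cases
    case 2
    have vx: "v \<notin> x'" using 2 by (auto simp: below_def)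
    have "y \<notin> below r C (Suc k) v"
    proof
      assume "y \<in> below r C (Suc k) v"
      then have "x \<in> below r C (Suc k) v" using colex_initialD(3)[OF colex_initial_below x _ le] by blast
      then show False using 2 by (auto simp: below_def)
    qed
    then obtain y' where y': "y' \<in> X" "y = insert v y'" using y by blast
    have vy: "v \<notin> y'" using y' X(2) by (auto simp: below_def)
    have "finite x'" "finite y'" using 2 y' X(2) rainbow_finite by (auto simp: below_def)
    then have "set_encode x' \<le> set_encode y'"
      using le set_encode_insert_le_iff[OF _ _ vx vy] 2 y' by simp
    moreover have "x' \<in> rainbow r (C - {v mod r}) k" using 2 by (simp add: below_def)
    ultimately have "x' \<in> X" using colex_initialD(3)[OF X(1)] y' by blast
    then show ?thesis using 2 by blast
  qed blast
qed

lemma upper_below_insert: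
  assumes v: "v mod r \<in> C" and X: "X \<subseteq> below r (C - {v mod r}) k v" "colex_initial r (C - {v mod r}) k X"
    and k: "k > 0"
  shows "card (upper r C (Suc k) (below r C (Suc k) v \<union> insert v ` X))
    = card (below r C (Suc (Suc k)) v) + card (upper r (C - {v mod r}) k X)"
proof -
  let ?D = "C - {v mod r}"
  have sub: "upper r ?D k X \<subseteq> below r ?D (Suc k) v"
    using upper_mono[OF X(1), of r ?D k] upper_below[OF k, of ?D v] by simp
  have "upper r C (Suc k) (below r C (Suc k) v \<union> insert v ` X)
      = below r C (Suc (Suc k)) v \<union> insert v ` upper r ?D k X"
  proof (rule set_eqI, rule iffI)
    fix p assume p: "p \<in> upper r C (Suc k) (below r C (Suc k) v \<union> insert v ` X)"
    have "below r C (Suc k) v \<union> insert v ` X \<subseteq> below r C (Suc k) (Suc v)"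
      using below_Suc[OF v] X(1) by blast
    then have pS: "p \<in> below r C (Suc (Suc k)) (Suc v)"
      using upper_mono[of "below r C (Suc k) v \<union> insert v ` X" "below r C (Suc k) (Suc v)" r C "Suc k"]
        upper_below[of "Suc k" C "Suc v"] p by blast
    then consider "p \<in> below r C (Suc (Suc k)) v"
      | q where "p = insert v q" "q \<in> below r ?D (Suc k) v"
      using below_Suc[OF v] by blast
    then show "p \<in> below r C (Suc (Suc k)) v \<union> insert v ` upper r ?D k X"
    proof cases
      case 2
      have vq: "v \<notin> q" using 2 by (auto simp: below_def)
      have "q - {u} \<in> X" if u: "u \<in> q" for u
      proof -
        have "p - {u} \<in> below r C (Suc k) v \<union> insert v ` X"
          using mem_upperD(2)[OF p, of u] 2 u by blast
        moreover have e: "p - {u} = insert v (q - {u})" using 2 u vq by blast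
        moreover have "p - {u} \<notin> below r C (Suc k) v" unfolding e by (auto simp: below_def)
        ultimately obtain w where w: "w \<in> X" "insert v (q - {u}) = insert v w" by auto
        have "v \<notin> w" using w X(1) by (auto simp: below_def)
        then have "q - {u} = w" using w(2) vq by (metis Diff_iff insert_ident)
        then show ?thesis using w by simp
      qed
      then have "q \<in> upper r ?D k X" using 2 by (auto simp: upper_def below_def)
      then show ?thesis using 2 by blast
    qed blast
  next
    fix p assume "p \<in> below r C (Suc (Suc k)) v \<union> insert v ` upper r ?D k X"
    then show "p \<in> upper r C (Suc k) (below r C (Suc k) v \<union> insert v ` X)"
    proof
      assume "p \<in> below r C (Suc (Suc k)) v"
      then show ?thesis using upper_below[of "Suc k" C v]
          upper_mono[of "below r C (Suc k) v" "below r C (Suc k) v \<union> insert v ` X" r C "Suc k"] by blast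
    next
      assume "p \<in> insert v ` upper r ?D k X"
      then obtain q where q: "q \<in> upper r ?D k X" "p = insert v q" by blast
      have qb: "q \<in> below r ?D (Suc k) v" using q sub by blast
      then have vq: "v \<notin> q" and qr: "q \<in> rainbow r ?D (Suc k)" by (auto simp: below_def)
      have "q \<in> below r C (Suc k) v" using qb rainbow_mono[of ?D C r "Suc k"] by (auto simp: below_def)
      moreover have "p - {u} \<in> insert v ` X" if "u \<in> q" for u
      proof -
        have "p - {u} = insert v (q - {u})" using q vq that by blast
        then show ?thesis using mem_upperD(2)[OF q(1) that] by blast
      qed
      moreover have "p - {v} = q" using q vq by simp
      moreover have "p \<in> rainbow r C (Suc (Suc k))" using rainbow_insert_colour(1)[OF qr v] q by simp
      ultimately show ?thesis using q by (auto simp: upper_def)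
    qed
  qed
  then show ?thesis using card_below_insert[OF sub, of C "Suc (Suc k)"] by simp
qed

text \<open>Peels off one term of a Turan representation: the first summand is the leading Turan
  number one level up, and \<open>m\<close> is the tail, living in the link of
  \<open>v\<close>.\<close>

lemma colex_bound_step:
  assumes v: "v mod r \<in> C" and k: "k > 0" and m: "m \<le> card (below r (C - {v mod r}) k v)"
  shows "colex_bound r C (Suc k) (card (below r C (Suc k) v) + m)
    = card (below r C (Suc (Suc k)) v) + colex_bound r (C - {v mod r}) k m"
proof -
  let ?D = "C - {v mod r}"
  have B: "colex_initial r ?D k (below r ?D k v)" by (rule colex_initial_below)
  define X where "X = segment r ?D k m"
  have X: "colex_initial r ?D k X" "card X = m"
    unfolding X_def using segment_initial[OF colex_initialD(1,2)[OF B] m] by auto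
  have sub: "X \<subseteq> below r ?D k v" using colex_initial_subset_of_card[OF X(1) B] X(2) m by simp
  have "colex_bound r C (Suc k) (card (below r C (Suc k) v) + m)
      = card (upper r C (Suc k) (below r C (Suc k) v \<union> insert v ` X))"
    using colex_bound_eq[OF colex_initial_below_insert[OF v X(1) sub]] card_below_insert[OF sub, of C "Suc k"] X(2)
    by simp
  also have "\<dots> = card (below r C (Suc (Suc k)) v) + colex_bound r ?D k m"
    using upper_below_insert[OF v sub X(1) k] by (simp add: colex_bound_def X_def)
  finally show ?thesis .
qed

end

text \<open>The new vertex \<open>n\<close> is adjacent to all earlier vertices but the
  \<open>n div q\<close> of its own class, and these neighbours span a Turan graph with
  \<open>q - 1\<close> parts.\<close>

lemma turan_binom_Suc:
  assumes "q > 0"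
  shows "turan_binom q (Suc n) (Suc k) = turan_binom q n (Suc k) + turan_binom (q - 1) (n - n div q) k"
proof -
  have n: "n mod q \<in> {..<q}" using assms by simp
  have p: "position q {..<q} m = m" for m using position_all[OF assms] .
  have D: "{..<q} - {n mod q} \<subseteq> {..<q}" by blast
  have "card (below q {..<q} (Suc k) (Suc n))
      = card (below q {..<q} (Suc k) n) + card (below q ({..<q} - {n mod q}) k n)"
    using below_Suc[OF assms n, of k] card_below_insert[OF assms order_refl, of "{..<q}" "Suc k" n] by simp
  then show ?thesis
    using position_remove[OF assms order_refl n] n
    by (simp add: card_below[OF assms] p D)
qed

lemma turan_binom_mono:
  assumes "n \<le> n'"
  shows "turan_binom q n k \<le> turan_binom q n' k"
  unfolding turan_binom_alt
proof (rule card_mono)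
  show "finite {K. K \<subseteq> {..<n'} \<and> card K = k \<and> inj_on (\<lambda>v. v mod q) K}"
    by (rule finite_subset[of _ "Pow {..<n'}"]) auto
qed (use assms in auto)

lemma turan_binom_eq_binomial:
  assumes "n \<le> q"
  shows "turan_binom q n k = n choose k"
proof -
  have "{K. K \<subseteq> {..<n} \<and> card K = k \<and> inj_on (\<lambda>v. v mod q) K} = {K. K \<subseteq> {..<n} \<and> card K = k}"
  proof -
    have "inj_on (\<lambda>v. v mod q) K" if "K \<subseteq> {..<n}" for K
    proof (rule inj_onI)
      fix x y assume "x \<in> K" "y \<in> K" "x mod q = y mod q"
      moreover have "x < q" "y < q" using that \<open>x \<in> K\<close> \<open>y \<in> K\<close> assms by auto
      ultimately show "x = y" by simp
    qed
    then show ?thesis by blast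
  qed
  then show ?thesis unfolding turan_binom_alt using n_subsets[of "{..<n}" k] by simp
qed

lemma turan_binom_pos: "k \<le> q \<Longrightarrow> k \<le> n \<Longrightarrow> turan_binom q n k > 0"
  using turan_binom_mono[of k n q k] turan_binom_eq_binomial[of k q k] by simp

lemma diff_div_mono:
  fixes n n' q :: nat
  assumes "n \<le> n'" "q > 0"
  shows "n - n div q \<le> n' - n' div q"
proof -
  have "Suc m - Suc m div q \<ge> m - m div q" for m
    using div_Suc[of m q] by (auto split: if_splits)
  then show ?thesis using lift_Suc_mono_le[of "\<lambda>m. m - m div q" n n'] assms by simp
qed

lemma turan_binom_strict:
  assumes "k > 0" "k \<le> q" "k \<le> n"
  shows "turan_binom q n k < turan_binom q (Suc n) k"
proof -
  obtain j where j: "k = Suc j" using assms by (cases k) auto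
  have "k - k div q \<le> n - n div q" by (rule diff_div_mono) (use assms in auto)
  moreover have "k div q \<le> 1" using assms div_le_mono[of k q q] by simp
  ultimately have "turan_binom (q - 1) (n - n div q) j > 0"
    using assms j by (intro turan_binom_pos) linarith+
  then show ?thesis using turan_binom_Suc[of q n j] assms j by simp
qed

text \<open>The gap condition in \<open>turan_rep\<close> keeps the tail below the increment of the
  leading term in Pascal's rule, so the leading entry is the greedy one.\<close>

lemma turan_rep_less:
  assumes "turan_rep q k m s b" "k \<le> q"
  shows "m < turan_binom q (Suc (b k)) k" "turan_binom q (b k) k \<le> m"
proof -
  show "turan_binom q (b k) k \<le> m"
    using assms(1) by (auto simp: turan_rep_def sum.atLeast_Suc_atMost)
  show "m < turan_binom q (Suc (b k)) k"
    using assms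
  proof (induction s arbitrary: q k m)
    case 0
    then show ?case using turan_binom_strict[of k q "b k"] by (auto simp: turan_rep_def)
  next
    case (Suc s)
    obtain j where j: "k = Suc j" "j > 0" using Suc.prems by (cases k) (auto simp: turan_rep_def)
    define m' where "m' = (\<Sum>i=0..s. turan_binom (q - 1 - i) (b (j - i)) (j - i))"
    have m: "m = turan_binom q (b k) k + m'"
      using Suc.prems j by (simp add: turan_rep_def m'_def sum.atLeast0_atMost_Suc_shift del: sum.cl_ivl_Suc)
    have "turan_rep (q - 1) j m' s b"
      using Suc.prems(1) j unfolding turan_rep_def m'_def
      by (metis (no_types, lifting) Suc_less_eq diff_Suc_Suc diff_diff_left plus_1_eq_Suc)
    then have "m' < turan_binom (q - 1) (Suc (b j)) j" using Suc.IH Suc.prems(2) j by simp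
    also have "\<dots> \<le> turan_binom (q - 1) (b k - b k div q) j"
    proof (rule turan_binom_mono)
      have "b (k - 0) - b (k - 0) div (q - 0) > b (k - 0 - 1)"
        using Suc.prems(1) unfolding turan_rep_def by blast
      then show "Suc (b j) \<le> b k - b k div q" using j by simp
    qed
    finally show ?case using m turan_binom_Suc[of q "b k" j] j Suc.prems(2) by simp
  qed
qed

text \<open>The left-hand side does not mention the representation. So all representations of
  \<open>m\<close> give the same value, which makes the \<open>THE\<close> in \<open>SM\<close> well
  defined without proving that representations are unique.\<close>

lemma turan_rep_colex_bound:
  assumes "turan_rep (card C) k m s b" "k \<le> card C" "r > 0" "C \<subseteq> {..<r}"
  shows "colex_bound r C k m = (\<Sum>i=0..s. turan_binom (card C - i) (b (k - i)) (k - i + 1))"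
  using assms(1,2,4)
proof (induction s arbitrary: C k m)
  case 0
  have "C \<noteq> {}" using 0 by (auto simp: turan_rep_def)
  then obtain v where v: "v mod r \<in> C" "position r C v = b k" using ex_position[OF assms(3) 0(3)] by blast
  have k: "k > 0" using 0 by (simp add: turan_rep_def)
  have "card (below r C k v) = m" using card_below[OF assms(3) 0(3)] v 0(1) by (simp add: turan_rep_def)
  then show ?case using colex_bound_below[OF assms(3) k, of C v] card_below[OF assms(3) 0(3)] v by simp
next
  case (Suc s)
  let ?q = "card C"
  obtain j where j: "k = Suc j" "j > 0" using Suc.prems by (cases k) (auto simp: turan_rep_def)
  define m' where "m' = (\<Sum>i=0..s. turan_binom (?q - 1 - i) (b (j - i)) (j - i))"
  have m: "m = turan_binom ?q (b k) k + m'"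
    using Suc.prems j by (simp add: turan_rep_def m'_def sum.atLeast0_atMost_Suc_shift del: sum.cl_ivl_Suc)
  have rep: "turan_rep (?q - 1) j m' s b"
    using Suc.prems(1) j unfolding turan_rep_def m'_def
    by (metis (no_types, lifting) Suc_less_eq diff_Suc_Suc diff_diff_left plus_1_eq_Suc)
  have "C \<noteq> {}" using Suc.prems j by auto
  then obtain v where v: "v mod r \<in> C" "position r C v = b k" using ex_position[OF assms(3) Suc.prems(3)] by blast
  let ?D = "C - {v mod r}"
  have D: "card ?D = ?q - 1" "?D \<subseteq> {..<r}" using v(1) Suc.prems(3) by auto
  have pD: "position r ?D v = b k - b k div ?q" using position_remove[OF assms(3) Suc.prems(3) v(1)] v(2) by simp
  have "b (k - 0) - b (k - 0) div (?q - 0) > b (k - 0 - 1)"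
    using Suc.prems(1) unfolding turan_rep_def by blast
  then have "Suc (b j) \<le> b k - b k div ?q" using j by simp
  then have "turan_binom (?q - 1) (Suc (b j)) j \<le> turan_binom (?q - 1) (b k - b k div ?q) j"
    by (rule turan_binom_mono)
  moreover have "m' < turan_binom (?q - 1) (Suc (b j)) j"
    using turan_rep_less(1)[OF rep] Suc.prems(2) j by simp
  moreover have "card (below r ?D j v) = turan_binom (?q - 1) (b k - b k div ?q) j"
    unfolding card_below[OF assms(3) D(2)] D(1) pD ..
  ultimately have le: "m' \<le> card (below r ?D j v)" by linarith
  have IH: "colex_bound r ?D j m' = (\<Sum>i=0..s. turan_binom (?q - 1 - i) (b (j - i)) (j - i + 1))"
    using Suc.IH[of ?D j m'] rep D Suc.prems(2) j by simp
  have "colex_bound r C k m = turan_binom ?q (b k) (Suc k) + colex_bound r ?D j m'"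
    using colex_bound_step[OF assms(3) v(1) j(2) le] m j card_below[OF assms(3) Suc.prems(3)] v(2) by simp
  then show ?case
    unfolding IH using j by (simp add: sum.atLeast0_atMost_Suc_shift del: sum.cl_ivl_Suc)
qed

lemma ex_turan_rep:
  assumes "m > 0" "k > 0" "k \<le> q"
  shows "\<exists>s b. turan_rep q k m s b"
  using assms
proof (induction k arbitrary: q m)
  case (Suc j)
  let ?k = "Suc j"
  \<comment> \<open>A crude growth bound; it bounds the candidates for the leading entry, as
    \<open>GREATEST\<close> requires.\<close>
  have grow: "m' < turan_binom q (?k + m') ?k" for m'
  proof (induction m')
    case 0
    then show ?case using turan_binom_pos[of ?k q ?k] Suc.prems by simp
  next
    case (Suc m')
    then show ?case using turan_binom_strict[of ?k q "?k + m'"] Suc.prems \<open>?k \<le> q\<close> by simp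
  qed
  define b where "b = (GREATEST b. turan_binom q b ?k \<le> m)"
  have bnd: "x \<le> ?k + m" if "turan_binom q x ?k \<le> m" for x
    using grow[of m] turan_binom_mono[of "?k + m" x q ?k] that by (meson le_trans not_le nat_le_linear)
  have "turan_binom q ?k ?k \<le> m" using turan_binom_eq_binomial[of ?k q ?k] Suc.prems by simp
  then have b: "turan_binom q b ?k \<le> m" "?k \<le> b" "\<And>x. turan_binom q x ?k \<le> m \<Longrightarrow> x \<le> b"
    unfolding b_def
    using GreatestI_nat[of "\<lambda>b. turan_binom q b ?k \<le> m" ?k "?k + m"]
      Greatest_le_nat[of "\<lambda>b. turan_binom q b ?k \<le> m" _ "?k + m"] bnd by auto
  have less: "m < turan_binom q (Suc b) ?k" using b(3)[of "Suc b"] by force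
  define m' where "m' = m - turan_binom q b ?k"
  have m': "m' < turan_binom (q - 1) (b - b div q) j"
    using turan_binom_Suc[of q b j] less b(1) Suc.prems by (simp add: m'_def)
  show ?case
  proof (cases "m' = 0")
    case True
    then have "turan_rep q ?k m 0 (\<lambda>_. b)" using b by (simp add: turan_rep_def m'_def)
    then show ?thesis by blast
  next
    case False
    \<comment> \<open>For \<open>j = 0\<close> the increment in Pascal's rule is 1 and leaves no
      remainder.\<close>
    have "j > 0"
    proof (rule ccontr)
      assume "\<not> j > 0"
      then have "m' < 1" using m' by (simp add: turan_binom_def num_cliques_0)
      then show False using False by simp
    qed
    moreover have jq: "j \<le> q - 1" using Suc.prems(3) by linarith
    ultimately obtain s c where c: "turan_rep (q - 1) j m' s c"
      using Suc.IH[of m' "q - 1"] False by auto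
    define c' where "c' = c(?k := b)"
    have cj: "c j < b - b div q"
    proof (rule ccontr)
      assume "\<not> c j < b - b div q"
      then have "turan_binom (q - 1) (b - b div q) j \<le> turan_binom (q - 1) (c j) j"
        by (intro turan_binom_mono) simp
      also have "\<dots> \<le> m'" using turan_rep_less(2)[OF c jq] .
      finally show False using m' by simp
    qed
    have ck: "c' ?k = b" by (simp add: c'_def)
    have eq: "c' (j - i) = c (j - i)" for i
    proof -
      have "j - i \<noteq> ?k" by linarith
      then show ?thesis by (simp add: c'_def)
    qed
    have "turan_rep q ?k m (Suc s) c'"
      unfolding turan_rep_def
    proof (intro conjI allI impI)
      show "Suc s < ?k" using c by (simp add: turan_rep_def)
      show "?k - Suc s \<le> c' (?k - Suc s)" using c eq[of s] by (simp add: turan_rep_def)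
      fix i assume i: "i < Suc s"
      show "c' (?k - i - 1) < c' (?k - i) - c' (?k - i) div (q - i)"
      proof (cases i)
        case 0
        then show ?thesis using cj ck eq[of 0] by simp
      next
        case (Suc i')
        then have "c (j - i' - 1) < c (j - i') - c (j - i') div (q - 1 - i')"
          using c i unfolding turan_rep_def by blast
        then show ?thesis using Suc eq[of i'] eq[of "Suc i'"] by simp
      qed
    next
      have "(\<Sum>i=0..Suc s. turan_binom (q - i) (c' (?k - i)) (?k - i))
          = turan_binom q b ?k + (\<Sum>i=0..s. turan_binom (q - 1 - i) (c (j - i)) (j - i))"
        by (simp add: sum.atLeast0_atMost_Suc_shift ck eq del: sum.cl_ivl_Suc)
      also have "\<dots> = m"
      proof -
        have "m' = (\<Sum>i=0..s. turan_binom (q - 1 - i) (c (j - i)) (j - i))"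
          using c unfolding turan_rep_def by blast
        then show ?thesis using b(1) unfolding m'_def by linarith
      qed
      finally show "m = (\<Sum>i=0..Suc s. turan_binom (q - i) (c' (?k - i)) (?k - i))" by simp
    qed
    then show ?thesis by blast
  qed
qed simp

section \<open>Binomial representations as the case of many colours\<close>

lemma decreasing_add_le:
  fixes n :: "nat \<Rightarrow> nat"
  assumes "\<And>i. i < s \<Longrightarrow> n (k - i) > n (k - i - 1)" "i \<le> s"
  shows "n (k - i) + i \<le> n k"
  using assms(2)
proof (induction i)
  case (Suc i)
  then have "n (k - i) > n (k - i - 1)" using assms(1) by simp
  then show ?case using Suc by simp
qed simp

text \<open>With more than \<open>n k\<close> parts every entry stays below the number of parts at
  its level, so the quotients vanish and Turan numbers are binomial coefficients. Existence and
  bounds carry over from Turan representations.\<close>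

lemma canonical_rep_iff_turan_rep:
  assumes "n k < q"
  shows "canonical_rep k m s n \<longleftrightarrow> turan_rep q k m s n"
proof -
  let ?P = "\<forall>i<s. n (k - i) > n (k - i - 1)" and ?Q = "\<forall>i<s. n (k - i) - n (k - i) div (q - i) > n (k - i - 1)"
  have small: "n (k - i) < q - i" if "?P" "i \<le> s" for i
    using decreasing_add_le[of s n k i] that assms by simp
  have "?P \<longleftrightarrow> ?Q"
  proof
    assume P: ?P
    then show ?Q using small[OF P] by (metis diff_zero div_less less_imp_le)
  next
    assume ?Q
    then show ?P by (meson diff_le_self less_le_trans)
  qed
  moreover have "(\<Sum>i=0..s. turan_binom (q - i) (n (k - i)) (k - i)) = (\<Sum>i=0..s. n (k - i) choose (k - i))" if ?P
    by (rule sum.cong[OF refl]) (use small[OF that] in \<open>auto intro!: turan_binom_eq_binomial less_imp_le\<close>)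
  ultimately show ?thesis unfolding canonical_rep_def turan_rep_def by (smt (verit))
qed

lemma canonical_rep_colex_bound:
  assumes "canonical_rep k m s n" "n k < q" "k \<le> q"
  shows "colex_bound q {..<q} k m = (\<Sum>i=0..s. n (k - i) choose (k - i + 1))"
proof -
  have rep: "turan_rep q k m s n" using canonical_rep_iff_turan_rep[of n k q m s] assms(1,2) by blast
  have "colex_bound q {..<q} k m = (\<Sum>i=0..s. turan_binom (q - i) (n (k - i)) (k - i + 1))"
    using turan_rep_colex_bound[of "{..<q}" k m s n q] rep assms by simp
  also have "\<dots> = (\<Sum>i=0..s. n (k - i) choose (k - i + 1))"
  proof (rule sum.cong[OF refl])
    fix i assume "i \<in> {0..s}"
    then have "n (k - i) + i \<le> n k"
      using decreasing_add_le[of s n k i] assms(1) by (simp add: canonical_rep_def)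
    then show "turan_binom (q - i) (n (k - i)) (k - i + 1) = n (k - i) choose (k - i + 1)"
      using assms(2) by (intro turan_binom_eq_binomial) simp
  qed
  finally show ?thesis .
qed

lemma canonical_rep_bounds:
  assumes "canonical_rep k m s n"
  shows "n k choose k \<le> m" "m < Suc (n k) choose k"
proof -
  define q where "q = Suc (n k + k)"
  have rep: "turan_rep q k m s n" using canonical_rep_iff_turan_rep[of n k q m s] assms by (simp add: q_def)
  show "n k choose k \<le> m" "m < Suc (n k) choose k"
    using turan_rep_less[OF rep] turan_binom_eq_binomial[of "n k" q k] turan_binom_eq_binomial[of "Suc (n k)" q k]
    by (simp_all add: q_def)
qed

lemma less_binomial_add: "k > 0 \<Longrightarrow> m < (k + m) choose k"
proof (induction m)
  case (Suc m)
  obtain j where "k = Suc j" using Suc.prems by (cases k) auto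
  then have "(k + Suc m) choose k = ((k + m) choose k) + ((k + m) choose j)" by simp
  moreover have "(k + m) choose j > 0" using \<open>k = Suc j\<close> by (simp add: zero_less_binomial)
  ultimately show ?case using Suc by linarith
qed simp

lemma binomial_le_bound: "k > 0 \<Longrightarrow> n choose k \<le> m \<Longrightarrow> n < k + m"
  using less_binomial_add[of k m] binomial_right_mono[of "k + m" n k] by linarith

lemma ex_canonical_rep:
  assumes "m > 0" "k > 0"
  shows "\<exists>s n. canonical_rep k m s n"
proof -
  \<comment> \<open>Large enough that \<open>q choose k\<close> exceeds \<open>m\<close>, which
    forces the leading entry below \<open>q\<close>.\<close>
  define q where "q = k + m"
  obtain s n where rep: "turan_rep q k m s n" using ex_turan_rep[of m k q] assms by (auto simp: q_def)
  have "n k < q"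
  proof (rule ccontr)
    assume "\<not> n k < q"
    then have "turan_binom q q k \<le> turan_binom q (n k) k" by (intro turan_binom_mono) simp
    also have "\<dots> \<le> m" using turan_rep_less(2)[OF rep] by (simp add: q_def)
    finally show False using turan_binom_eq_binomial[of q q k] less_binomial_add[OF assms(2), of m] by (simp add: q_def)
  qed
  then show ?thesis using canonical_rep_iff_turan_rep[of n k q m s] rep by blast
qed

text \<open>The leading entry is pinned down by two consecutive binomial coefficients around
  \<open>m\<close>, which justifies the \<open>THE\<close> in \<open>canonical_lead\<close> and is
  all that is used of it later.\<close>

lemma canonical_lead_bounds:
  assumes "m > 0" "k > 0"
  shows "canonical_lead k m choose k \<le> m" "m < Suc (canonical_lead k m) choose k"
proof -
  obtain s n where n: "canonical_rep k m s n" using ex_canonical_rep[OF assms] by blast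
  have uniq: "x = n k" if x: "\<exists>s n. canonical_rep k m s n \<and> x = n k" for x
  proof -
    obtain s' n' where n': "canonical_rep k m s' n'" "x = n' k" using x by blast
    have "\<not> n k < x"
    proof
      assume "n k < x"
      then have "Suc (n k) choose k \<le> x choose k" by (intro binomial_right_mono) simp
      then show False using canonical_rep_bounds[OF n] canonical_rep_bounds[OF n'(1)] n'(2) by simp
    qed
    moreover have "\<not> x < n k"
    proof
      assume "x < n k"
      then have "Suc x choose k \<le> n k choose k" by (intro binomial_right_mono) simp
      then show False using canonical_rep_bounds[OF n] canonical_rep_bounds[OF n'(1)] n'(2) by simp
    qed
    ultimately show ?thesis by simp
  qed
  have "canonical_lead k m = n k"
    unfolding canonical_lead_def by (rule the_equality) (use n uniq in auto)
  then show "canonical_lead k m choose k \<le> m" "m < Suc (canonical_lead k m) choose k"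
    using canonical_rep_bounds[OF n] by simp_all
qed

lemma SM_eq:
  assumes "m > 0" "k > 0" "canonical_lead k m > k"
  defines "q \<equiv> canonical_lead k m - 1"
  shows "SM k m = Some (colex_bound q {..<q} k m)"
proof -
  have q: "q > 0" "k \<le> q" using assms by auto
  obtain s b where sb: "turan_rep q k m s b" using ex_turan_rep[OF assms(1,2) q(2)] by blast
  have val: "colex_bound q {..<q} k m = (\<Sum>i=0..s. turan_binom (q - i) (b (k - i)) (k - i + 1))"
    if "turan_rep q k m s b" for s b
    using turan_rep_colex_bound[of "{..<q}" k m s b q] that q by simp
  have "(THE v. \<exists>s b. turan_rep q k m s b \<and> v = (\<Sum>i=0..s. turan_binom (q - i) (b (k - i)) (k - i + 1)))
      = colex_bound q {..<q} k m"
    by (rule the_equality) (use sb val in \<open>metis, metis\<close>)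
  then show ?thesis using assms(3) by (simp add: SM_def Let_def q_def)
qed

section \<open>Kruskal-Katona inequalities\<close>

context
  fixes q :: nat
  assumes q: "q > 0"
begin

lemma below_eq_subsets:
  assumes "n \<le> q"
  shows "below q {..<q} j n = {K. K \<subseteq> {..<n} \<and> card K = j}"
proof -
  have "K \<in> rainbow q {..<q} (card K)" if "K \<subseteq> {..<n}" for K
  proof -
    have "inj_on (\<lambda>v. v mod q) K"
    proof (rule inj_onI)
      fix x y assume "x \<in> K" "y \<in> K" "x mod q = y mod q"
      moreover have "x < q" "y < q" using that \<open>x \<in> K\<close> \<open>y \<in> K\<close> assms by auto
      ultimately show "x = y" by simp
    qed
    then show ?thesis using that q finite_subset[of K "{..<n}"] by (auto simp: rainbow_def)
  qed
  then show ?thesis by (auto simp: below_def rainbow_card)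
qed

lemma card_below_subsets: "n \<le> q \<Longrightarrow> card (below q {..<q} j n) = n choose j"
  using below_eq_subsets[of n j] n_subsets[of "{..<n}" j] by simp

lemma segment_below:
  assumes "n \<le> q" "a \<le> n choose j"
  shows "colex_initial q {..<q} j (segment q {..<q} j a)" "card (segment q {..<q} j a) = a"
    "segment q {..<q} j a \<subseteq> below q {..<q} j n"
proof -
  let ?B = "below q {..<q} j n"
  have B: "colex_initial q {..<q} j ?B" using colex_initial_below[OF q] .
  show *: "colex_initial q {..<q} j (segment q {..<q} j a)" "card (segment q {..<q} j a) = a"
    using segment_initial[OF colex_initialD(1,2)[OF B], of a] card_below_subsets[OF assms(1)] assms(2) by auto
  show "segment q {..<q} j a \<subseteq> ?B"
    using colex_initial_subset_of_card[OF *(1) B] *(2) card_below_subsets[OF assms(1)] assms(2) by simp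
qed

lemma colex_bound_0: "colex_bound q C k 0 = 0"
proof -
  have "colex_initial q C k {}" by (simp add: colex_initial_def)
  moreover have "upper q C k {} = {}" by (auto simp: upper_def rainbow_def)
  ultimately show ?thesis using colex_bound_eq[of q C k "{}"] by simp
qed

lemma colex_bound_binomial:
  assumes "n \<le> q" "j > 0"
  shows "colex_bound q {..<q} j (n choose j) = n choose Suc j"
  using colex_bound_below[OF q assms(2), of "{..<q}" n] card_below_subsets[OF assms(1)] by simp

lemma card_upper_subsets_le:
  assumes "n \<le> q" "j > 0" "A \<subseteq> below q {..<q} j n"
  shows "card (upper q {..<q} j A) \<le> colex_bound q {..<q} j (card A)" "finite A"
    "finite (upper q {..<q} j A)" "upper q {..<q} j A \<subseteq> below q {..<q} (Suc j) n"
proof -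
  have A: "A \<subseteq> rainbow q {..<q} j" using assms(3) by (auto simp: below_def)
  show fin: "finite A" using assms(3) finite_below[OF q] finite_subset by blast
  show "card (upper q {..<q} j A) \<le> colex_bound q {..<q} j (card A)"
    using card_upper_le_colex_bound[OF q _ assms(2) A fin] by simp
  show "finite (upper q {..<q} j A)" using finite_upper[OF fin A assms(2)] .
  show "upper q {..<q} j A \<subseteq> below q {..<q} (Suc j) n"
    using upper_mono[OF assms(3), of q "{..<q}" j] upper_below[OF q assms(2), of "{..<q}" n] by simp
qed

text \<open>Below the modulus every set is rainbow, so the ground set may be permuted freely, a
  freedom the coloured setting does not offer.\<close>

lemma card_upper_image_ge:
  assumes n: "n \<le> q" and j: "j > 0" and B: "B \<subseteq> below q {..<q} j n"
    and s: "inj_on s {..<n}" "s ` {..<n} \<subseteq> {..<n}"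
  shows "image s ` B \<subseteq> below q {..<q} j n" "card (image s ` B) = card B"
    "card (upper q {..<q} j B) \<le> card (upper q {..<q} j (image s ` B))"
proof -
  have inj: "inj_on (image s) {K. K \<subseteq> {..<n}}"
    using s(1) by (simp add: inj_on_image Pow_def[symmetric] inj_on_image_Pow)
  have im: "s ` K \<subseteq> {..<n}" "card (s ` K) = card K" if "K \<subseteq> {..<n}" for K
    using that s card_image[OF inj_on_subset[OF s(1) that]] by auto
  have sub: "K \<subseteq> {..<n}" if "K \<in> below q {..<q} i n" for K i using that by (simp add: below_def)
  show B': "image s ` B \<subseteq> below q {..<q} j n"
    using B im unfolding below_eq_subsets[OF n] by blast
  show "card (image s ` B) = card B"
    by (rule card_image, rule inj_on_subset[OF inj]) (use B sub in blast)
  have up: "upper q {..<q} j B \<subseteq> below q {..<q} (Suc j) n" using card_upper_subsets_le(4)[OF n j B] .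
  show "card (upper q {..<q} j B) \<le> card (upper q {..<q} j (image s ` B))"
  proof (rule card_inj_on_le)
    show "inj_on (image s) (upper q {..<q} j B)"
      by (rule inj_on_subset[OF inj]) (use up sub in blast)
    show "finite (upper q {..<q} j (image s ` B))" using card_upper_subsets_le(3)[OF n j B'] .
    show "image s ` upper q {..<q} j B \<subseteq> upper q {..<q} j (image s ` B)"
    proof
      fix P assume "P \<in> image s ` upper q {..<q} j B"
      then obtain p where p: "p \<in> upper q {..<q} j B" "P = s ` p" by blast
      have pb: "p \<in> below q {..<q} (Suc j) n" using p up by blast
      have pn: "p \<subseteq> {..<n}" "card p = Suc j" using pb unfolding below_eq_subsets[OF n] by auto
      have "s ` p \<in> below q {..<q} (Suc j) n" unfolding below_eq_subsets[OF n] using im[OF pn(1)] pn(2) by simp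
      then have "P \<in> rainbow q {..<q} (Suc j)" using p by (simp add: below_def)
      moreover have "P - {w} \<in> image s ` B" if w: "w \<in> P" for w
      proof -
        obtain v where v: "v \<in> p" "w = s v" using w p(2) by blast
        have "P - {w} = s ` (p - {v})"
          using inj_on_image_set_diff[OF s(1), of p "{v}"] pn(1) v p(2) by auto
        then show ?thesis using mem_upperD(2)[OF p(1) v(1)] by blast
      qed
      ultimately show "P \<in> upper q {..<q} j (image s ` B)" by (simp add: upper_def)
    qed
  qed
qed

lemma ex_permutation_mapping:
  fixes n :: nat
  assumes "z \<subseteq> {..<n}" "z' \<subseteq> {..<n}" "card z = card z'"
  shows "\<exists>s. inj_on s {..<n} \<and> s ` {..<n} \<subseteq> {..<n} \<and> s ` z' = z"
proof -
  have fin: "finite z" "finite z'" using finite_subset[OF assms(1)] finite_subset[OF assms(2)] by simp_all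
  obtain g where g: "bij_betw g z' z" using finite_same_card_bij[OF fin(2,1)] assms by metis
  have "card ({..<n} - z') = card ({..<n} - z)" using assms fin by (simp add: card_Diff_subset)
  then obtain h where h: "bij_betw h ({..<n} - z') ({..<n} - z)"
    using finite_same_card_bij[of "{..<n} - z'" "{..<n} - z"] by blast
  define s where "s = (\<lambda>x. if x \<in> z' then g x else h x)"
  have "bij_betw s z' z" using g by (rule bij_betw_cong[THEN iffD1, rotated]) (simp add: s_def)
  moreover have "bij_betw s ({..<n} - z') ({..<n} - z)"
    using h by (rule bij_betw_cong[THEN iffD1, rotated]) (simp add: s_def)
  ultimately have "bij_betw s (z' \<union> ({..<n} - z')) (z \<union> ({..<n} - z))"
    by (rule bij_betw_combine) blast
  then have "bij_betw s {..<n} {..<n}" using assms by (simp add: Un_absorb1)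
  moreover have "s ` z' = z" using \<open>bij_betw s z' z\<close> by (simp add: bij_betw_def)
  ultimately show ?thesis by (auto simp: bij_betw_def)
qed

text \<open>Intersection and union of one optimal family with a permuted copy of the other one spread the
  two sizes apart; this can be repeated until the smaller family is empty or the larger one is complete.\<close>

lemma colex_bound_spread:
  assumes n: "n \<le> q" and j: "j > 0" and a: "a \<le> n choose j" and b: "b \<le> n choose j"
  shows "colex_bound q {..<q} j a + colex_bound q {..<q} j b
    \<le> colex_bound q {..<q} j (min (a + b) (n choose j))
      + colex_bound q {..<q} j (a + b - min (a + b) (n choose j))"
  using a b
proof (induction a arbitrary: b rule: less_induct)
  case (less a)
  let ?M = "n choose j" and ?F = "colex_bound q {..<q} j" and ?U = "upper q {..<q} j"
    and ?B = "below q {..<q} j n"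
  consider "a = 0" | "b = ?M" | "a > 0" "b < ?M" using less.prems by linarith
  then show ?case
  proof cases
    case 1
    then show ?thesis using less.prems by (simp add: colex_bound_0)
  next
    case 2
    then show ?thesis by simp
  next
    case 3
    define A where "A = segment q {..<q} j a"
    define B where "B = segment q {..<q} j b"
    note A = segment_below[OF n less.prems(1), folded A_def]
    note B = segment_below[OF n less.prems(2), folded B_def]
    have FA: "?F a = card (?U A)" and FB: "?F b = card (?U B)"
      by (simp_all add: colex_bound_def A_def B_def)
    obtain z where z: "z \<in> A" using A(2) 3(1) by (metis card.empty ex_in_conv less_irrefl)
    have "card B < card ?B" using B(2) 3(2) card_below_subsets[OF n] by simp
    then obtain z' where z': "z' \<in> ?B" "z' \<notin> B" by (metis B(3) less_irrefl subset_antisym subsetI)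
    have zz: "z \<subseteq> {..<n}" "z' \<subseteq> {..<n}" "card z = card z'"
      using z z' A(3) unfolding below_eq_subsets[OF n] by auto
    \<comment> \<open>Sending the non-member \<open>z'\<close> of \<open>B\<close> to the member
      \<open>z\<close> of \<open>A\<close> keeps \<open>z\<close> out of the copy of
      \<open>B\<close>. The intersection is then strictly smaller than \<open>A\<close>, and the
      induction on \<open>a\<close> applies.\<close>
    obtain s where s: "inj_on s {..<n}" "s ` {..<n} \<subseteq> {..<n}" "s ` z' = z"
      using ex_permutation_mapping[OF zz] by blast
    define D where "D = image s ` B"
    note D = card_upper_image_ge[OF n j B(3) s(1,2), folded D_def]
    have "z \<notin> D"
    proof
      assume "z \<in> D"
      then obtain y where y: "y \<in> B" "s ` y = s ` z'" using s(3) by (auto simp: D_def)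
      have "y \<subseteq> {..<n}" using y B(3) by (auto simp: below_def)
      then have "y = z'" using inj_on_image_eq_iff[OF s(1)] y(2) zz(2) by blast
      then show False using y z' by blast
    qed
    have sub: "A \<inter> D \<subseteq> ?B" "A \<union> D \<subseteq> ?B" using A(3) D(1) by auto
    note fI = card_upper_subsets_le[OF n j sub(1)]
    note fU = card_upper_subsets_le[OF n j sub(2)]
    have finA: "finite A" "finite D" using fU(2) by auto
    define a' where "a' = card (A \<inter> D)"
    define b' where "b' = card (A \<union> D)"
    have "A \<inter> D \<subset> A" using z \<open>z \<notin> D\<close> by blast
    then have "a' < a" using psubset_card_mono[OF finA(1)] A(2) by (simp add: a'_def)
    moreover have ab: "a' + b' = a + b"
      using card_Un_Int[OF finA] A(2) B(2) D(2) by (simp add: a'_def b'_def)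
    moreover have "b' \<le> ?M"
      unfolding b'_def card_below_subsets[OF n, symmetric] by (rule card_mono[OF finite_below[OF q] sub(2)])
    ultimately have IH: "?F a' + ?F b' \<le> ?F (min (a + b) ?M) + ?F (a + b - min (a + b) ?M)"
      using less.IH[of a' b'] less.prems by simp
    have fUA: "finite (?U A)" "finite (?U D)"
      using fU(3) upper_mono[of _ "A \<union> D" q "{..<q}" j] finite_subset by (metis Un_upper1, metis Un_upper2)
    \<comment> \<open>Supermodularity of \<open>upper\<close>: its values at \<open>A\<close> and
      \<open>D\<close> have their union inside the value at the union and their intersection inside
      the value at the intersection.\<close>
    have "?F a + ?F b \<le> card (?U A) + card (?U D)" using FA FB D(3) by simp
    also have "\<dots> = card (?U A \<union> ?U D) + card (?U A \<inter> ?U D)" using card_Un_Int[OF fUA] .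
    also have "\<dots> \<le> card (?U (A \<union> D)) + card (?U (A \<inter> D))"
      by (intro add_mono card_mono fU(3) fI(3)) (auto simp: upper_def)
    also have "\<dots> \<le> ?F b' + ?F a'" using fU(1) fI(1) by (simp add: a'_def b'_def)
    finally show ?thesis using IH by simp
  qed
qed

lemma colex_bound_superadditive:
  assumes "n \<le> q" "j > 0" "a + b \<le> n choose j"
  shows "colex_bound q {..<q} j a + colex_bound q {..<q} j b \<le> colex_bound q {..<q} j (a + b)"
  using colex_bound_spread[OF assms(1,2), of a b] assms(3) by (simp add: colex_bound_0 min_def)

lemma sum_colex_bound_le:
  assumes "finite A" "n \<le> q" "j > 0" "sum y A \<le> n choose j"
  shows "(\<Sum>a\<in>A. colex_bound q {..<q} j (y a)) \<le> colex_bound q {..<q} j (sum y A)"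
  using assms(1,4)
proof (induction A rule: finite_induct)
  case (insert x A)
  have "(\<Sum>a\<in>insert x A. colex_bound q {..<q} j (y a))
      \<le> colex_bound q {..<q} j (y x) + colex_bound q {..<q} j (sum y A)"
    using insert by simp
  also have "\<dots> \<le> colex_bound q {..<q} j (y x + sum y A)"
    using colex_bound_superadditive[OF assms(2,3), of "y x" "sum y A"] insert by simp
  finally show ?case using insert by simp
qed simp

text \<open>While the accumulated sum is at most \<open>p choose j\<close>, spreading on
  \<open>p\<close> points fills one family up to that cap. The overflow may exceed the cap, so it is
  collected by superadditivity on the larger ground set of \<open>n\<close> points.\<close>

lemma sum_colex_bound_capped_le:
  assumes "finite A" "n \<le> q" "p \<le> q" "j > 0" "sum y A \<le> n choose j"
    and "\<And>a. a \<in> A \<Longrightarrow> y a \<le> p choose j"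
  shows "(\<Sum>a\<in>A. colex_bound q {..<q} j (y a))
    \<le> colex_bound q {..<q} j (min (sum y A) (p choose j)) + colex_bound q {..<q} j (sum y A - (p choose j))"
  using assms(1,5,6)
proof (induction A rule: finite_induct)
  case empty
  then show ?case by simp
next
  case (insert x A)
  let ?M = "p choose j" and ?F = "colex_bound q {..<q} j" and ?S = "sum y A"
  have "(\<Sum>a\<in>A. ?F (y a)) \<le> ?F (min ?S ?M) + ?F (?S - ?M)" using insert by simp
  then have le: "(\<Sum>a\<in>insert x A. ?F (y a)) \<le> ?F (y x) + (?F (min ?S ?M) + ?F (?S - ?M))"
    using insert.hyps by simp
  have sum: "sum y (insert x A) = y x + ?S" using insert.hyps by simp
  show ?case
  proof (cases "?S \<le> ?M")
    case True
    have "?F (y x) + ?F ?S \<le> ?F (min (y x + ?S) ?M) + ?F (y x + ?S - min (y x + ?S) ?M)"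
      using colex_bound_spread[OF assms(3,4), of "y x" ?S] insert.prems True by simp
    moreover have "y x + ?S - min (y x + ?S) ?M = y x + ?S - ?M" by simp
    ultimately show ?thesis using le True unfolding sum by (simp add: colex_bound_0)
  next
    case False
    have "?F (y x) + ?F (?S - ?M) \<le> ?F (y x + (?S - ?M))"
      using colex_bound_superadditive[OF assms(2,4), of "y x" "?S - ?M"] insert.prems(1) sum by simp
    then show ?thesis using le False unfolding sum by (simp add: min_def)
  qed
qed

section \<open>Cones over families\<close>

lemma below_avoids_colour:
  assumes "n < q"
  shows "below q {..<q} k n \<subseteq> rainbow q ({..<q} - {n}) k"
proof
  fix z assume z: "z \<in> below q {..<q} k n"
  have "colours q z \<subseteq> {..<q} - {n}"
  proof
    fix c assume "c \<in> colours q z"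
    then obtain v where v: "v \<in> z" "c = v mod q" by blast
    have "v < n" using z v by (auto simp: below_def)
    then show "c \<in> {..<q} - {n}" using v assms by simp
  qed
  then show "z \<in> rainbow q ({..<q} - {n}) k" using z by (auto simp: below_def rainbow_def)
qed

lemma upper_avoid_colour:
  assumes "n < q" "k > 0" "A \<subseteq> below q {..<q} k n"
  shows "upper q ({..<q} - {n}) k A = upper q {..<q} k A"
proof
  show "upper q ({..<q} - {n}) k A \<subseteq> upper q {..<q} k A"
    using rainbow_mono[of "{..<q} - {n}" "{..<q}" q "Suc k"] by (auto simp: upper_def)
  have "upper q {..<q} k A \<subseteq> rainbow q ({..<q} - {n}) (Suc k)"
    using card_upper_subsets_le(4)[OF _ assms(2,3)] below_avoids_colour[OF assms(1), of "Suc k"] assms(1) by simp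
  then show "upper q {..<q} k A \<subseteq> upper q ({..<q} - {n}) k A" by (auto simp: upper_def)
qed

text \<open>The family consists of h sets avoiding n together with the cone with apex n over g sets.\<close>

lemma colex_bound_cone:
  assumes j: "j > 0" and n: "n < q" and h: "h \<le> n choose Suc j" and g: "g \<le> n choose j"
  shows "colex_bound q {..<q} (Suc j) h + min h (colex_bound q {..<q} j g) \<le> colex_bound q {..<q} (Suc j) (h + g)"
proof -
  let ?C = "{..<q}"
  have nq: "n \<le> q" using n by simp
  define X where "X = segment q ?C (Suc j) h"
  define Y where "Y = segment q ?C j g"
  note X = segment_below[OF nq h, folded X_def]
  note Y = segment_below[OF nq g, folded Y_def]
  have X': "X \<subseteq> rainbow q (?C - {n}) (Suc j)" "finite X"
    using X below_avoids_colour[OF n, of "Suc j"] by (auto simp: colex_initial_def)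
  have Y': "Y \<subseteq> rainbow q (?C - {n}) j" "finite Y"
    using Y below_avoids_colour[OF n, of j] by (auto simp: colex_initial_def)
  have nC: "n \<in> ?C" "\<And>v. v \<in> {n} \<Longrightarrow> v mod q = n" using n by auto
  have Y2: "(\<lambda>_. Y) v \<subseteq> rainbow q (?C - {n}) j" "finite ((\<lambda>_. Y) v)" for v :: nat using Y' by auto
  let ?G = "glue {n} X (\<lambda>_. Y)"
  \<comment> \<open>The upper family of \<open>Y\<close> and the family \<open>X\<close> are initial
    segments of the same sets, hence nested; the \<open>min\<close> is the size of their
    intersection, the contribution of the apex.\<close>
  have "colex_bound q ?C (Suc j) h + min h (colex_bound q ?C j g)
      = card (upper q ?C (Suc j) X) + card (upper q ?C j Y \<inter> X)"
    using colex_initial_Int[OF colex_initial_upper[OF Y(1) j] X(1)] X(2)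
    by (simp add: colex_bound_def X_def Y_def min.commute)
  also have "\<dots> = card (upper q (?C - {n}) (Suc j) X) + (\<Sum>v\<in>{n}. card (upper q (?C - {n}) j Y \<inter> X))"
    using upper_avoid_colour[OF n _ X(3)] upper_avoid_colour[OF n j Y(3)] by simp
  also have "\<dots> \<le> card (upper q ?C (Suc j) ?G)"
    using card_upper_glue[where Y = "\<lambda>_. Y" and S = "{n}", OF nC(1) _ nC(2) X' Y2] by simp
  also have "\<dots> \<le> colex_bound q ?C (Suc j) (card ?G)"
  proof (rule card_upper_le_colex_bound[OF q])
    show "?G \<subseteq> rainbow q ?C (Suc j)" by (rule glue_rainbow[where Y = "\<lambda>_. Y", OF nC X'(1) Y2(1)])
    show "finite ?G" using X'(2) Y'(2) by (simp add: glue_def)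
  qed simp_all
  also have "card ?G = h + g"
    using card_glue[where Y = "\<lambda>_. Y" and S = "{n}", OF _ nC(2) X' Y2] X(2) Y(2) by simp
  finally show ?thesis .
qed

text \<open>An initial segment of this size consists of all sets below \<open>n\<close> and a cone
  with apex \<open>n\<close> over \<open>g\<close> sets. The link has lost colour \<open>n\<close>,
  which is absorbed by the bound for all colours.\<close>

lemma colex_bound_binomial_add_le:
  assumes j: "j > 0" and n: "n < q" and g: "g \<le> n choose j"
  shows "colex_bound q {..<q} (Suc j) ((n choose Suc j) + g)
    \<le> (n choose Suc (Suc j)) + colex_bound q {..<q} j g"
proof -
  let ?C = "{..<q}"
  have nC: "n mod q \<in> ?C" and nm: "n mod q = n" using n by auto
  have "below q ?C j n \<subseteq> below q (?C - {n}) j n"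
    using below_avoids_colour[OF n, of j] by (auto simp: below_def)
  then have "card (below q ?C j n) \<le> card (below q (?C - {n}) j n)"
    by (rule card_mono[OF finite_below[OF q]])
  then have gle: "g \<le> card (below q (?C - {n}) j n)" using card_below_subsets[of n j] n g by simp
  have "colex_bound q ?C (Suc j) ((n choose Suc j) + g)
      = (n choose Suc (Suc j)) + colex_bound q (?C - {n}) j g"
    using colex_bound_step[OF q nC j, of g] gle card_below_subsets[of n] n nm by simp
  moreover have "colex_bound q (?C - {n}) j g \<le> colex_bound q ?C j g"
  proof -
    define X where "X = segment q (?C - {n}) j g"
    have X: "colex_initial q (?C - {n}) j X" "card X = g"
      unfolding X_def using segment_initial[OF _ finite_below[OF q] gle] by (auto simp: below_def)
    have Xr: "X \<subseteq> rainbow q ?C j" "finite X"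
      using X(1) rainbow_mono[of "?C - {n}" ?C q j] by (auto simp: colex_initial_def)
    have "upper q (?C - {n}) j X \<subseteq> upper q ?C j X"
      using rainbow_mono[of "?C - {n}" ?C q "Suc j"] by (auto simp: upper_def)
    then have "card (upper q (?C - {n}) j X) \<le> card (upper q ?C j X)"
      by (rule card_mono[OF finite_upper[OF Xr(2,1) j]])
    also have "\<dots> \<le> colex_bound q ?C j g"
      using card_upper_le_colex_bound[OF q _ j Xr] X(2) by simp
    finally show ?thesis by (simp add: colex_bound_def X_def)
  qed
  ultimately show ?thesis by simp
qed

end

section \<open>Graphs with a large clique\<close>

text \<open>Here \<open>k = j + 1\<close>, and \<open>p\<close> and \<open>f\<close> are the second
  entry and the sum of the remaining terms in the representation behind \<open>LG\<close>. The
  number \<open>q\<close> of colours exceeds every size in sight, so that the rainbow condition is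
  void and \<open>q - 1\<close> can serve as a fresh apex.\<close>

lemma num_cliques_large_clique:
  fixes E :: "'a set set"
  assumes V: "finite V" and K: "K \<subseteq> V" "clique K E" "card K = n" and j: "j > 0"
    and m: "num_cliques V E (Suc j) = (n choose Suc j) + (p choose j) + f"
    and f: "f < p choose (j - 1)"
    and big: "card V + p + f + j + (p choose j) + 2 \<le> q"
  shows "num_cliques V E (Suc (Suc j)) \<le> (n choose Suc (Suc j)) + (p choose Suc j) + colex_bound q {..<q} j f"
proof -
  let ?F = "colex_bound q {..<q}" and ?M = "p choose j"
  have q: "q > 0" and pq: "p < q - 1" "p < q" "p \<le> q" "q - 1 < q" "q - 1 \<le> q" using big by auto
  have finK: "finite K" using K(1) V finite_subset by blast
  have nK: "num_cliques K E i = n choose i" for i using num_cliques_clique[OF finK K(2)] K(3) by simp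
  have sizes: "x \<le> (q - 1) choose i" if "x \<le> ?M + f" "0 < i" "i \<le> j" for x i
  proof -
    have "x < (i + (?M + f)) choose i" using less_binomial_add[OF that(2), of "?M + f"] that(1) by linarith
    also have "\<dots> \<le> (q - 1) choose i" by (rule binomial_right_mono) (use big that in linarith)
    finally show ?thesis by simp
  qed
  have KK: "num_cliques W E (Suc j) \<le> ?F j (num_cliques W E j)" if W: "W \<subseteq> V" for W
  proof (rule num_cliques_le_colex_bound[OF q order_refl _ j])
    show "finite W" using W V finite_subset by blast
    show "card L \<le> card {..<q}" if "L \<subseteq> W" for L
    proof -
      have "card L \<le> card V" by (rule card_mono[OF V]) (use that W in blast)
      then show ?thesis using big by simp
    qed
  qed
  have fM: "?M + f < Suc p choose j" using f j by (cases j) simp_all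
  show ?thesis
  proof (cases "\<exists>u\<in>V - K. num_cliques (neighbours E (V - {u}) u) E j \<ge> ?M")
    case True
    then obtain u where u: "u \<in> V - K" "num_cliques (neighbours E (V - {u}) u) E j \<ge> ?M" by blast
    define V' where "V' = V - {u}"
    define N where "N = neighbours E V' u"
    have V': "finite V'" "u \<notin> V'" "V = insert u V'" "K \<subseteq> V'" "V' \<subseteq> V"
      using u(1) V K(1) by (auto simp: V'_def)
    have NV: "N \<subseteq> V'" "N \<subseteq> V" using neighbours_subset[of E V' u] V'(5) by (auto simp: N_def)
    have finN: "finite N" using NV V finite_subset by blast
    have step: "num_cliques V E (Suc i) = num_cliques V' E (Suc i) + num_cliques N E i" for i
      using num_cliques_insert[OF V'(1,2), of E i] V'(3) by (simp add: N_def)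
    define H where "H = V' - K"
    have H: "finite H" "H \<inter> K = {}" "V' = H \<union> K" using V' by (auto simp: H_def)
    obtain L where L: "\<And>a. a \<in> H \<Longrightarrow> L a \<subseteq> neighbours E V' a"
      "\<And>i. num_cliques V' E (Suc i) = num_cliques K E (Suc i) + (\<Sum>a\<in>H. num_cliques (L a) E i)"
      using num_cliques_decompose[OF H(1) finK H(2), of E] H(3) by metis
    define h where "h = (\<Sum>a\<in>H. num_cliques (L a) E j)"
    \<comment> \<open>\<open>g\<close> is the surplus of the link of \<open>u\<close> over
      \<open>p choose j\<close>, and \<open>h\<close> counts the cliques of \<open>V'\<close> not
      inside \<open>K\<close>; together they make up \<open>f\<close>.\<close>
    define g where "g = num_cliques N E j - ?M"
    have Nj: "num_cliques N E j = ?M + g" using u(2) by (simp add: g_def N_def V'_def)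
    have hg: "h + g = f" using m step[of j] L(2)[of j] nK[of "Suc j"] Nj by (simp add: h_def)
    have rest: "num_cliques V' E (Suc (Suc j)) \<le> (n choose Suc (Suc j)) + ?F j h"
    proof -
      have "(\<Sum>a\<in>H. num_cliques (L a) E (Suc j)) \<le> (\<Sum>a\<in>H. ?F j (num_cliques (L a) E j))"
      proof (rule sum_mono)
        fix a assume "a \<in> H"
        then have "L a \<subseteq> V" using L(1) neighbours_subset[of E V' a] V'(5) by blast
        then show "num_cliques (L a) E (Suc j) \<le> ?F j (num_cliques (L a) E j)" by (rule KK)
      qed
      also have "\<dots> \<le> ?F j h"
        unfolding h_def by (rule sum_colex_bound_le[OF q H(1) pq(5) j])
          (use hg sizes[of h j] j in \<open>simp add: h_def\<close>)
      finally show ?thesis using L(2)[of "Suc j"] nK by simp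
    qed
    have N1: "num_cliques N E (Suc j) \<le> ?F j (?M + g)" using KK[OF NV(2)] Nj by simp
    \<comment> \<open>The cliques in \<open>N\<close> lie inside \<open>K\<close> or are among the
      \<open>h\<close> others. \<open>N\<close> meets \<open>K\<close> in at most \<open>p\<close>
      vertices, because a larger intersection alone would contain \<open>Suc p choose j\<close>
      cliques, more than \<open>?M + f\<close>.\<close>
    have N2: "num_cliques N E (Suc j) \<le> (p choose Suc j) + h"
    proof -
      define a where "a = card (N \<inter> K)"
      have cl: "num_cliques (N \<inter> K) E i = a choose i" for i
        using num_cliques_clique[of "N \<inter> K" E i] finN K(2) by (auto simp: a_def clique_def)
      have "a choose j \<le> num_cliques N E j" using num_cliques_mono[OF finN, of "N \<inter> K" E j] cl by simp
      then have "a choose j < Suc p choose j" using Nj hg fM by linarith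
      then have "a \<le> p" using binomial_right_mono[of "Suc p" a j] by (meson not_less_eq_eq not_le)
      then have ap: "a choose Suc j \<le> p choose Suc j" by (rule binomial_right_mono)
      let ?Q = "\<lambda>W. {X \<in> [W]\<^bsup>Suc j\<^esup>. clique X E}"
      have finQ: "finite (?Q V')" using finite_cliques[OF V'(1)] .
      have KV: "?Q K \<subseteq> ?Q V'" using V'(4) by (auto simp: nsets_def)
      have "?Q N \<subseteq> ?Q (N \<inter> K) \<union> (?Q V' - ?Q K)" using NV(1) by (auto simp: nsets_def)
      then have "card (?Q N) \<le> card (?Q (N \<inter> K) \<union> (?Q V' - ?Q K))"
        by (rule card_mono[rotated]) (use finQ finite_cliques[of "N \<inter> K"] finN in simp)
      also have "\<dots> \<le> card (?Q (N \<inter> K)) + card (?Q V' - ?Q K)" by (rule card_Un_le)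
      also have "card (?Q V' - ?Q K) = card (?Q V') - card (?Q K)"
        by (rule card_Diff_subset[OF finite_subset[OF KV finQ] KV])
      finally have "num_cliques N E (Suc j) \<le> num_cliques (N \<inter> K) E (Suc j)
          + (num_cliques V' E (Suc j) - num_cliques K E (Suc j))"
        unfolding num_cliques_def .
      then show ?thesis using L(2)[of j] cl ap by (simp add: h_def)
    qed
    show ?thesis
    proof (cases "g = 0")
      case True
      then have "num_cliques N E (Suc j) \<le> p choose Suc j"
        using N1 colex_bound_binomial[OF q pq(3) j] by simp
      then show ?thesis using step[of "Suc j"] rest hg True by simp
    next
      case False
      \<comment> \<open>For \<open>j = 1\<close> the bound \<open>f < p choose 0\<close> gives
        \<open>f = 0\<close>, hence \<open>g = 0\<close>.\<close>
      have "j \<noteq> 1" using f hg False by auto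
      then obtain i where i: "j = Suc i" "i > 0" using j by (cases j) auto
      have gle: "g \<le> p choose i" using f hg i by simp
      have "num_cliques N E (Suc j) \<le> (p choose Suc j) + ?F i g"
        using N1 colex_bound_binomial_add_le[OF q i(2) pq(2) gle] i(1) by simp
      then have "num_cliques N E (Suc j) \<le> (p choose Suc j) + min h (?F i g)" using N2 by simp
      \<comment> \<open>\<open>N1\<close> and \<open>N2\<close> leave exactly the minimum that a
        cone over \<open>g\<close> sets beside \<open>h\<close> sets contributes, and this family
        has \<open>h + g = f\<close> members.\<close>
      moreover have "?F j h + min h (?F i g) \<le> ?F j f"
        using colex_bound_cone[OF q i(2) pq(4), of h g] sizes[of h j] sizes[of g i] hg i by simp
      ultimately show ?thesis using step[of "Suc j"] rest by simp
    qed
  next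
    case False
    define H where "H = V - K"
    have H: "finite H" "H \<inter> K = {}" "V = H \<union> K" using V K(1) by (auto simp: H_def)
    obtain L where L: "\<And>a. a \<in> H \<Longrightarrow> L a \<subseteq> neighbours E V a"
      "\<And>i. num_cliques V E (Suc i) = num_cliques K E (Suc i) + (\<Sum>a\<in>H. num_cliques (L a) E i)"
      using num_cliques_decompose[OF H(1) finK H(2), of E] H(3) by metis
    define y where "y = (\<lambda>a. num_cliques (L a) E j)"
    have sum: "sum y H = ?M + f" using m L(2)[of j] nK[of "Suc j"] by (simp add: y_def)
    \<comment> \<open>No vertex reaches the threshold in this case, so \<open>p choose j\<close> is
      a cap for all links.\<close>
    have y: "y a \<le> ?M" if a: "a \<in> H" for a
    proof -
      have "neighbours E V a = neighbours E (V - {a}) a" by (auto simp: neighbours_def)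
      then have "y a \<le> num_cliques (neighbours E (V - {a}) a) E j"
        unfolding y_def using L(1)[OF a] V by (intro num_cliques_mono) (auto simp: neighbours_def)
      moreover have "\<not> ?M \<le> num_cliques (neighbours E (V - {a}) a) E j"
        using False a unfolding H_def by blast
      ultimately show ?thesis by linarith
    qed
    have "(\<Sum>a\<in>H. num_cliques (L a) E (Suc j)) \<le> (\<Sum>a\<in>H. ?F j (y a))"
    proof (rule sum_mono)
      fix a assume "a \<in> H"
      then have "L a \<subseteq> V" using L(1) neighbours_subset[of E V a] by blast
      then show "num_cliques (L a) E (Suc j) \<le> ?F j (y a)" unfolding y_def by (rule KK)
    qed
    also have "\<dots> \<le> ?F j (min (sum y H) ?M) + ?F j (sum y H - ?M)"
      by (rule sum_colex_bound_capped_le[OF q H(1) pq(5,3) j _ y]) (use sum sizes[of "?M + f" j] j in simp_all)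
    also have "\<dots> = (p choose Suc j) + ?F j f"
      unfolding sum using colex_bound_binomial[OF q pq(3) j] by simp
    finally show ?thesis using L(2)[of "Suc j"] nK by simp
  qed
qed

section \<open>The value of LG\<close>

lemma ibinom_nat: "ibinom (int n) (int j) = n choose j"
  by (simp add: ibinom_def binomial_eq_0)

lemma binomial_interval_unique:
  fixes x y :: nat
  assumes "x choose k \<le> m" "m < Suc x choose k" "y choose k \<le> m" "m < Suc y choose k"
  shows "x = y"
proof (rule ccontr)
  assume "x \<noteq> y"
  then consider "Suc x \<le> y" | "Suc y \<le> x" by linarith
  then show False
    by cases (use binomial_right_mono[of "Suc x" y k] binomial_right_mono[of "Suc y" x k] assms in linarith)+
qed

text \<open>The \<open>a\<close>-terms form a canonical representation of \<open>f\<close> at level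
  \<open>j\<close>. Their shifted sum is therefore the Kruskal-Katona bound of \<open>f\<close> and
  depends on \<open>f\<close> alone.\<close>

lemma LG_repD:
  assumes rep: "LG_rep (Suc j) m s P Q a" and j: "j > 0"
  defines "n \<equiv> nat P" and "p \<equiv> nat Q" and "f \<equiv> \<Sum>i=1..s. a (Suc j - i) choose (Suc j - i)"
  shows "P = int n" "Q = int p" "m = (n choose Suc j) + (p choose j) + f" "f < p choose (j - 1)" "p < n"
    and "\<And>q. j + f < q \<Longrightarrow> (\<Sum>i=1..s. a (Suc j - i) choose (Suc j - i + 1)) = colex_bound q {..<q} j f"
proof -
  have PQ: "P > Q" "Q \<ge> int (Suc j) - 2" using rep by (auto simp: LG_rep_def)
  show P: "P = int n" and Q: "Q = int p" using PQ j by (auto simp: n_def p_def)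
  show pn: "p < n" using PQ P Q by simp
  have j1: "int (Suc j) - 1 = int j" "int (Suc j) - 2 = int (j - 1)" using j by auto
  show m: "m = (n choose Suc j) + (p choose j) + f"
    using rep ibinom_nat[of n "Suc j"] ibinom_nat[of p j] unfolding LG_rep_def P Q j1 f_def by simp
  show "f < p choose (j - 1)"
  proof -
    \<comment> \<open>In the degenerate alternative \<open>f = 0\<close>, and
      \<open>p choose (j - 1)\<close> is 1, so the strict inequality holds there too.\<close>
    have "f < ibinom (int p) (int (j - 1)) \<or> int p = int (j - 1) \<and> s = 0"
      using rep unfolding LG_rep_def P Q j1 f_def by blast
    then show ?thesis using ibinom_nat[of p "j - 1"] by (auto simp: f_def)
  qed
  fix q assume q: "j + f < q"
  show "(\<Sum>i=1..s. a (Suc j - i) choose (Suc j - i + 1)) = colex_bound q {..<q} j f"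
  proof (cases s)
    case 0
    then show ?thesis using q colex_bound_0[of q] by (simp add: f_def)
  next
    case (Suc t)
    have shift: "(\<Sum>i=1..s. G (Suc j - i)) = (\<Sum>i=0..t. G (j - i))" for G :: "nat \<Rightarrow> nat"
    proof -
      have "(\<Sum>i=1..s. G (Suc j - i)) = (\<Sum>i=Suc 0..Suc t. G (Suc j - i))" using Suc by simp
      also have "\<dots> = (\<Sum>i=0..t. G (Suc j - Suc i))" by (rule sum.shift_bounds_cl_Suc_ivl)
      finally show ?thesis by simp
    qed
    have can: "canonical_rep j f t a"
      unfolding canonical_rep_def
    proof (intro conjI allI impI)
      show "t < j" using rep Suc by (simp add: LG_rep_def)
      show "a (j - t) \<ge> j - t" using rep Suc by (simp add: LG_rep_def)
      show "f = (\<Sum>i=0..t. a (j - i) choose (j - i))"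
        unfolding f_def by (rule shift[of "\<lambda>x. a x choose x"])
      fix i assume "i < t"
      then have "1 \<le> Suc i \<and> Suc i < s" using Suc by simp
      then have "a (Suc j - Suc i) > a (Suc j - Suc i - 1)"
        using rep unfolding LG_rep_def by blast
      then show "a (j - i - 1) < a (j - i)" by simp
    qed
    have "a j < j + f" using binomial_le_bound[OF j canonical_rep_bounds(1)[OF can]] .
    then have "colex_bound q {..<q} j f = (\<Sum>i=0..t. a (j - i) choose (j - i + 1))"
      using canonical_rep_colex_bound[OF can, of q] q by simp
    then show ?thesis using shift[of "\<lambda>x. a x choose (x + 1)"] by simp
  qed
qed

lemma ex_LG_rep:
  assumes m: "m > 0" and j: "j > 0"
  shows "\<exists>s P Q a. LG_rep (Suc j) m s P Q a"
proof -
  define n where "n = canonical_lead (Suc j) m"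
  have n: "n choose Suc j \<le> m" "m < Suc n choose Suc j"
    using canonical_lead_bounds[OF m, of "Suc j"] by (simp_all add: n_def)
  define e where "e = m - (n choose Suc j)"
  have me: "m = (n choose Suc j) + e" using n by (simp add: e_def)
  have en: "e < n choose j" using n(2) me by simp
  have jn: "Suc j \<le> n"
  proof (rule ccontr)
    assume "\<not> Suc j \<le> n"
    then have "Suc n choose Suc j \<le> Suc j choose Suc j" by (intro binomial_right_mono) simp
    then show False using n m by simp
  qed
  have j1: "int (Suc j) - 1 = int j" "int (Suc j) - 2 = int (j - 1)" using j by auto
  obtain p f where pf: "e = (p choose j) + f" "f < p choose (j - 1)" "p < n" "j - 1 \<le> p"
  proof (cases "e = 0")
    case True
    \<comment> \<open>The entry \<open>k - 2\<close>: it contributes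
      \<open>(j - 1) choose j = 0\<close>, while \<open>(j - 1) choose (j - 1) = 1\<close> exceeds
      \<open>f = 0\<close>.\<close>
    show ?thesis by (rule that[of "j - 1" 0]) (use True j jn in auto)
  next
    case False
    define p where "p = canonical_lead j e"
    have p: "p choose j \<le> e" "e < Suc p choose j"
      using canonical_lead_bounds[of e j] False j by (simp_all add: p_def)
    have "p < n" using binomial_right_mono[of n p j] p en by linarith
    moreover have "j - 1 \<le> p"
    proof (rule ccontr)
      assume "\<not> j - 1 \<le> p"
      then have "Suc p choose j \<le> (j - 1) choose j" by (intro binomial_right_mono) simp
      moreover have "(j - 1) choose j = 0" using j by (intro binomial_eq_0) simp
      ultimately show False using p(2) by linarith
    qed
    moreover have "e - (p choose j) < p choose (j - 1)" using p j by (cases j) simp_all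
    ultimately show ?thesis using that[of p "e - (p choose j)"] p(1) by simp
  qed
  have base: "LG_rep (Suc j) m s (int n) (int p) a"
    if "s < Suc j" "\<forall>i. 1 \<le> i \<and> i < s \<longrightarrow> a (Suc j - i) > a (Suc j - i - 1)"
      "s \<ge> 1 \<longrightarrow> a (Suc j - s) \<ge> Suc j - s" "f = (\<Sum>i=1..s. a (Suc j - i) choose (Suc j - i))" for s a
    unfolding LG_rep_def j1 ibinom_nat that(4)[symmetric] using that pf me by simp
  show ?thesis
  proof (cases "f = 0")
    case True
    show ?thesis using base[of 0 "\<lambda>_. 0"] True by auto
  next
    case False
    then obtain t a where can: "canonical_rep j f t a" using ex_canonical_rep[of f j] j by blast
    have "LG_rep (Suc j) m (Suc t) (int n) (int p) a"
    proof (rule base)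
      show "Suc t < Suc j" using can by (simp add: canonical_rep_def)
      show "Suc t \<ge> 1 \<longrightarrow> a (Suc j - Suc t) \<ge> Suc j - Suc t" using can by (simp add: canonical_rep_def)
      show "\<forall>i. 1 \<le> i \<and> i < Suc t \<longrightarrow> a (Suc j - i) > a (Suc j - i - 1)"
      proof (intro allI impI)
        fix i assume i: "1 \<le> i \<and> i < Suc t"
        then obtain i' where "i = Suc i'" by (cases i) auto
        then show "a (Suc j - i) > a (Suc j - i - 1)" using can i by (simp add: canonical_rep_def)
      qed
      have "(\<Sum>i=1..Suc t. a (Suc j - i) choose (Suc j - i)) = (\<Sum>i=0..t. a (j - i) choose (j - i))"
        using sum.shift_bounds_cl_Suc_ivl[of "\<lambda>i. a (Suc j - i) choose (Suc j - i)" 0 t] by simp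
      then show "f = (\<Sum>i=1..Suc t. a (Suc j - i) choose (Suc j - i))"
        using can by (simp add: canonical_rep_def del: sum.cl_ivl_Suc)
    qed
    then show ?thesis by blast
  qed
qed

text \<open>The \<open>THE\<close> in \<open>LG\<close> is justified by the uniqueness of the two
  upper entries and of \<open>f\<close>; the \<open>a\<close>-terms enter only through the bound for
  \<open>f\<close>.\<close>

lemma LG_Suc:
  assumes m: "m > 0" and j: "j > 0"
  obtains n p f where "m = (n choose Suc j) + (p choose j) + f" "f < p choose (j - 1)" "p < n"
    "\<And>q. j + f < q \<Longrightarrow>
      LG (Suc j) m = (n choose Suc (Suc j)) + (p choose Suc j) + colex_bound q {..<q} j f"
proof -
  obtain s P Q a where rep: "LG_rep (Suc j) m s P Q a" using ex_LG_rep[OF m j] by blast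
  define n where "n = nat P"
  define p where "p = nat Q"
  define f where "f = (\<Sum>i=1..s. a (Suc j - i) choose (Suc j - i))"
  note D = LG_repD[OF rep j, folded n_def p_def f_def]
  have jj: "int (Suc j) + 1 = int (Suc (Suc j))" by simp
  have LG: "LG (Suc j) m = (n choose Suc (Suc j)) + (p choose Suc j) + colex_bound q {..<q} j f"
    if q: "j + f < q" for q
    unfolding LG_def
  proof (rule the_equality)
    show "\<exists>s P Q a. LG_rep (Suc j) m s P Q a \<and>
      (n choose Suc (Suc j)) + (p choose Suc j) + colex_bound q {..<q} j f
      = ibinom P (int (Suc j) + 1) + ibinom Q (int (Suc j)) + (\<Sum>i=1..s. a (Suc j - i) choose (Suc j - i + 1))"
      using rep D(6)[OF q] unfolding jj
      by (intro exI[of _ s] exI[of _ P] exI[of _ Q] exI[of _ a] conjI rep) (simp only: D(1,2) ibinom_nat)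
    fix v assume "\<exists>s P Q a. LG_rep (Suc j) m s P Q a \<and>
      v = ibinom P (int (Suc j) + 1) + ibinom Q (int (Suc j)) + (\<Sum>i=1..s. a (Suc j - i) choose (Suc j - i + 1))"
    then obtain s' P' Q' a' where rep': "LG_rep (Suc j) m s' P' Q' a'"
      and v: "v = ibinom P' (int (Suc j) + 1) + ibinom Q' (int (Suc j)) + (\<Sum>i=1..s'. a' (Suc j - i) choose (Suc j - i + 1))"
      by blast
    define n' where "n' = nat P'"
    define p' where "p' = nat Q'"
    define f' where "f' = (\<Sum>i=1..s'. a' (Suc j - i) choose (Suc j - i))"
    note D' = LG_repD[OF rep' j, folded n'_def p'_def f'_def]
    have up: "(x choose j) + y < Suc x choose j" if "y < x choose (j - 1)" for x y
      using that j by (cases j) simp_all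
    \<comment> \<open>The terms after the leading one stay below \<open>z choose j\<close>, the
      increment of \<open>z choose Suc j\<close>, so \<open>m\<close> determines the leading entry.
      \<open>up\<close> does the same one level down.\<close>
    have lead: "(z choose Suc j) + ((x choose j) + y) < Suc z choose Suc j" if "y < x choose (j - 1)" "x < z" for x y z
      using up[OF that(1)] binomial_right_mono[of "Suc x" z j] that(2) by simp
    have nn: "n' = n"
      by (rule binomial_interval_unique[of _ "Suc j" m])
        (use D(3) D'(3) lead[OF D(4,5)] lead[OF D'(4,5)] in linarith)+
    then have e: "(p' choose j) + f' = (p choose j) + f" using D(3) D'(3) by simp
    have pp: "p' = p"
      by (rule binomial_interval_unique[of _ j "(p choose j) + f"])
        (use e up[OF D(4)] up[OF D'(4)] in linarith)+
    then have "f' = f" using e by simp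
    then show "v = (n choose Suc (Suc j)) + (p choose Suc j) + colex_bound q {..<q} j f"
      using v D'(6)[of q] q nn pp unfolding jj by (simp only: D'(1,2) ibinom_nat)
  qed
  show ?thesis by (rule that[OF D(3,4,5) LG])
qed

text \<open>For \<open>k = 1\<close> there are no \<open>a\<close>-terms and
  \<open>ibinom Q (-1)\<close> vanishes for every \<open>Q\<close>, so only the degenerate
  alternative \<open>Q = -1\<close> remains and \<open>P = m\<close>.\<close>

lemma LG_1: "LG (Suc 0) m = m choose 2"
  unfolding LG_def
proof (rule the_equality)
  have i2: "int (Suc 0) + 1 = int 2" by simp
  have "LG_rep (Suc 0) m 0 (int m) (-1) (\<lambda>_. 0)"
    using ibinom_nat[of m 1] by (simp add: LG_rep_def ibinom_def[of "-1"])
  moreover have "m choose 2 = ibinom (int m) (int (Suc 0) + 1) + ibinom (-1) (int (Suc 0))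
      + (\<Sum>i=1..0. (0::nat) choose (Suc 0 - i + 1))"
    unfolding i2 ibinom_nat by (simp add: ibinom_def)
  ultimately show "\<exists>s P Q a. LG_rep (Suc 0) m s P Q a \<and> m choose 2
      = ibinom P (int (Suc 0) + 1) + ibinom Q (int (Suc 0)) + (\<Sum>i=1..s. a (Suc 0 - i) choose (Suc 0 - i + 1))"
    by blast
  fix v assume "\<exists>s P Q a. LG_rep (Suc 0) m s P Q a \<and>
    v = ibinom P (int (Suc 0) + 1) + ibinom Q (int (Suc 0)) + (\<Sum>i=1..s. a (Suc 0 - i) choose (Suc 0 - i + 1))"
  then obtain s P Q a where rep: "LG_rep (Suc 0) m s P Q a"
    and v: "v = ibinom P (int (Suc 0) + 1) + ibinom Q (int (Suc 0)) + (\<Sum>i=1..s. a (Suc 0 - i) choose (Suc 0 - i + 1))"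
    by blast
  have s: "s = 0" and P: "P > Q" using rep by (auto simp: LG_rep_def)
  have Q: "Q = -1" using rep s by (auto simp: LG_rep_def ibinom_def)
  have P': "P = int (nat P)" using P Q by simp
  have "m = nat P"
    using rep s Q ibinom_nat[of "nat P" 1] P' by (simp add: LG_rep_def ibinom_def[of "-1"])
  then show "v = m choose 2"
    using v s Q ibinom_nat[of "nat P" 2] P' unfolding i2 by (simp add: ibinom_def[of "-1"])
qed

theorem theorem2p18:
  fixes k m :: nat and V :: "'a set" and E :: "'a set set"
  assumes "k > 0" and "m > 0"
    and "finite V" and "simple_graph V E"
    and "num_cliques V E k = m"
  shows "num_cliques V E (k + 1) \<le>
    (case SM k m of None \<Rightarrow> LG k m | Some t \<Rightarrow> max (LG k m) t)"
proof -
  define n where "n = canonical_lead k m"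
  have n: "n choose k \<le> m" "m < Suc n choose k"
    using canonical_lead_bounds[OF assms(2,1)] by (simp_all add: n_def)
  have kn: "k \<le> n"
  proof (rule ccontr)
    assume "\<not> k \<le> n"
    then have "Suc n choose k \<le> k choose k" by (intro binomial_right_mono) simp
    then show False using n assms(2) by simp
  qed
  show ?thesis
  proof (cases "\<exists>K\<subseteq>V. clique K E \<and> card K = n")
    case True
    then obtain K where K: "K \<subseteq> V" "clique K E" "card K = n" by blast
    have "num_cliques V E (k + 1) \<le> LG k m"
    \<comment> \<open>For \<open>k = 1\<close> the second representation has the entry -1; here
      \<open>m\<close> is the number of vertices and the trivial bound on edges is already the value
      of \<open>LG\<close>.\<close>
    proof (cases "k = 1")
      case True
      have "{X \<in> [V]\<^bsup>Suc 0\<^esup>. clique X E} = {X. X \<subseteq> V \<and> card X = 1}"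
        using finite_subset[OF _ assms(3)] by (auto simp: nsets_def clique_def card_1_singleton_iff)
      then have "card V = m"
        using n_subsets[OF assms(3), of 1] assms(5) True by (simp add: num_cliques_def)
      then show ?thesis using num_cliques_le_binomial[OF assms(3), of E 2] LG_1[of m] True
        by (simp add: numeral_2_eq_2)
    next
      case False
      then obtain j where j: "k = Suc j" "j > 0" using assms(1) by (cases k) auto
      obtain n' p f where LG: "m = (n' choose Suc j) + (p choose j) + f" "f < p choose (j - 1)" "p < n'"
        "\<And>q. j + f < q \<Longrightarrow> LG (Suc j) m = (n' choose Suc (Suc j)) + (p choose Suc j) + colex_bound q {..<q} j f"
        using LG_Suc[OF assms(2) j(2)] by metis
      \<comment> \<open>The remaining terms stay below \<open>n' choose j\<close>, so the leading
        entry behind \<open>LG\<close> is the canonical one, which is the size of the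
        clique.\<close>
      have "n' = n"
      proof (rule binomial_interval_unique[of _ "Suc j" m])
        have "(p choose j) + f < Suc p choose j" using LG(2) j(2) by (cases j) simp_all
        also have "\<dots> \<le> n' choose j" by (rule binomial_right_mono) (use LG(3) in simp)
        finally show "m < Suc n' choose Suc j" using LG(1) by simp
      qed (use LG(1) n j in simp_all)
      define q where "q = card V + p + f + j + (p choose j) + 2"
      have "num_cliques V E (Suc (Suc j)) \<le> (n choose Suc (Suc j)) + (p choose Suc j) + colex_bound q {..<q} j f"
        by (rule num_cliques_large_clique[OF assms(3) K j(2) _ LG(2)])
          (use assms(5) LG(1) j \<open>n' = n\<close> in \<open>simp_all add: q_def\<close>)
      also have "\<dots> = LG (Suc j) m" using LG(4)[of q] \<open>n' = n\<close> by (simp add: q_def)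
      finally show ?thesis using j by simp
    qed
    then show ?thesis by (cases "SM k m") auto
  next
    case False
    have small: "card K < n" if K: "K \<subseteq> V" "clique K E" for K
    proof (rule ccontr)
      assume "\<not> card K < n"
      then obtain L where "L \<subseteq> K" "card L = n" by (meson not_less obtain_subset_with_card_n)
      then have "L \<subseteq> V" "clique L E" "card L = n" using K by (auto simp: clique_def)
      then show False using False by blast
    qed
    \<comment> \<open>If \<open>n = k\<close>, the absence of an n-clique would give
      \<open>m = 0\<close>. So \<open>SM\<close> is defined in this case.\<close>
    have "k < n"
    proof (rule ccontr)
      assume "\<not> k < n"
      then have "num_cliques V E k = 0" using small kn by (intro num_cliques_eq_0) fastforce
      then show False using assms by simp
    qed
    define q where "q = n - 1"
    have SM: "SM k m = Some (colex_bound q {..<q} k m)"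
      using SM_eq[OF assms(2,1)] \<open>k < n\<close> by (simp add: q_def n_def)
    have q: "q > 0" using \<open>k < n\<close> assms(1) by (simp add: q_def)
    have "num_cliques V E (Suc k) \<le> colex_bound q {..<q} k (num_cliques V E k)"
    proof (rule num_cliques_le_colex_bound[OF q order_refl assms(3,1)])
      show "card K \<le> card {..<q}" if "K \<subseteq> V" "clique K E" for K
        using small[OF that] by (simp add: q_def)
    qed
    then show ?thesis using SM assms(5) by simp
  qed
qed

end
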